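(* Fix $T>0$ and $p\in(0,1)$ and let $(X,A,H,M)$ and $\eta$ satisfy Assumption $\mathcal A_{\sup}$ or Assumption $\mathcal A_{no\sup}$. Assume in addition one of the following three conditions: (a) $H$ is predictable; (b) $M$ has no negative jumps; (c) $\mathbb E[H_T]<\infty$. Fix arbitrary $u,\lambda>0$ and set $$\tau:=\inf\{s\ge0\mid H_s\ge\lambda u\},\qquad\sigma:=\inf\{s\ge0\mid X_s>u\},\qquad\inf\emptyset:=+\infty.$$ Then for all $t\in[0,T]$ $$\mathbf 1_{\{X_t^*>u\}}\,u\le X_{t\wedge\sigma}\wedge u\le I_t^{L}+M_t^{L}+H_t^{L},$$ where $(I^L_t)$ is the non-decreasing process $$I_t^L:=\begin{cases}\int_{(0,t]}\eta(X^*_{s^-})\mathbf 1_{\{X^*_{s^-}\le u\}}\,dA_s&\text{under }\mathcal A_{\sup},\\ \int_{(0,t]}\eta(X_{s^-})\mathbf 1_{\{X^*_{s^-}\le u\}}\,dA_s&\text{under }\mathcal A_{no\sup},\end{cases}$$ $(M^L_t)$ is a local martingale with càdlàg paths starting in $0$ defined by $$M_t^L:=\begin{cases}\lim_{n\to\infty}M_{t\wedge\tau^{(n)}\wedge\sigma}&\text{in case (a)},\\ M_{t\wedge\tau\wedge\sigma}&\text{in case (b)},\\ \tilde M_{t\wedge\sigma}\mathbf 1_{\{\mathbb E[H_T\mid\mathcal F_0]\le u\}}&\text{in case (c)},\end{cases}$$ (where $(\tau^{(n)})_n$ denotes an announcing sequence of $\tau$ and $\tilde M_t:=M_t+\mathbb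 E[H_T\mid\mathcal F_t]-\mathbb E[H_T\mid\mathcal F_0]$ for $t\in[0,T]$), and $(H^L_t)$ is the non-decreasing process $$H_t^L:=\begin{cases}H_t\wedge(\lambda u)+u\mathbf 1_{\{H_t\ge\lambda u\}}&\text{in case (a)},\\ H_t\wedge(\lambda u)+u\mathbf 1_{\{H_t\ge\lambda u\}}&\text{in case (b)},\\ \mathbb E[H_T\mid\mathcal F_0]\wedge u&\text{in case (c)}.\end{cases}$$
   Context: All processes are defined on a filtered probability space $(\Omega,\mathcal F,\mathbb P,(\mathcal F_t)_{t\ge0})$ satisfying the usual conditions. $X_t^*:=\sup_{0\le s\le t}X_s$, $X^*_{t^-}:=\sup_{s<t}X_s$ for $t>0$, $X^*_{0^-}:=X_0$. Assumption $\mathcal A_{\sup}$: $(X_t)_{t\ge0}$ is an adapted right-continuous process with $X\ge c_0$ for some constant $c_0\ge0$; $(A_t)_{t\ge0}$ is a predictable non-decreasing càdlàg process with $A_0=0$; $(H_t)_{t\ge0}$ is an adapted non-negative non-decreasing càdlàg process; $(M_t)_{t\ge0}$ is a càdlàg local martingale with $M_0=0$; $\eta:[c_0,\infty)\to[0,\infty)$ is a continuous non-decreasing function with $\eta(x)>0$ for $x>c_0$; and for all $t\ge0$ $$X_t\le\int_{(0,t]}\eta(X^*_{s^-})\,dA_s+M_t+H_t\qquad\mathbb P\text{-a.s.}$$ Assumption $\mathcal A_{no\sup}$: the same assumptions on the processes and $\eta$, in addition $X$ has left limits, and for all $t\ge0$ $$X_t\le\int_{(0,t]}\eta(X_{s^-})\,dA_s+M_t+H_t\qquad\mathbb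 P\text{-a.s.}$$ In case (a), $\tau$ is a predictable stopping time; an announcing sequence is a non-decreasing sequence of stopping times $\tau^{(n)}\to\tau$ with $\tau^{(n)}<\tau$ on $\{\tau>0\}$ (and $\tau^{(n)}=0$ on $\{\tau=0\}$). In case (c) a càdlàg version of $\tilde M$ is taken. *)

theory Defs
  imports "HOL-Probability.Probability"
begin

section \<open>Filtered probability spaces in continuous time\<close>

text \<open>
  Time is \<^typ>\<open>real\<close>, but only times \<open>t \<ge> 0\<close> are ever used; a filtration on \<open>[0,\<infinity>)\<close> is turned into
  one on \<^typ>\<open>real\<close> by putting \<open>F t = F 0\<close> for \<open>t < 0\<close>.  Processes have type
  \<open>real \<Rightarrow> 'a \<Rightarrow> real\<close>, and path properties (right-continuity, existence of left limits,
  monotonicity, lower bounds) are required of every path, not only of almost every path.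
\<close>

locale usual_filtered_prob_space =
  prob_space P + complete_measure P + filtration "space P" F
  for P :: "'a measure" and F :: "real \<Rightarrow> 'a measure" +
  assumes subalgebra_F: "\<And>t. subalgebra P (F t)"
    and null_sets_F0: "null_sets P \<subseteq> sets (F 0)"
    and right_continuous_F: "\<And>t. 0 \<le> t \<Longrightarrow> (\<Inter>s\<in>{t<..}. sets (F s)) = sets (F t)"

definition right_continuous_path :: "(real \<Rightarrow> real) \<Rightarrow> bool" where
  "right_continuous_path f \<longleftrightarrow> (\<forall>t\<ge>0. continuous (at_right t) f)"

definition has_left_limits :: "(real \<Rightarrow> real) \<Rightarrow> bool" where
  "has_left_limits f \<longleftrightarrow> (\<forall>t>0. \<exists>l. (f \<longlongrightarrow> l) (at_left t))"

definition cadlag :: "(real \<Rightarrow> real) \<Rightarrow> bool" where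
  "cadlag f \<longleftrightarrow> right_continuous_path f \<and> has_left_limits f"

text \<open>\<open>f\<^bsub>t-\<^esub>\<close> for \<open>t > 0\<close>.\<close>

definition left_lim :: "(real \<Rightarrow> real) \<Rightarrow> real \<Rightarrow> real" where
  "left_lim f t = Lim (at_left t) f"

definition adapted :: "(real \<Rightarrow> 'a measure) \<Rightarrow> (real \<Rightarrow> 'a \<Rightarrow> real) \<Rightarrow> bool" where
  "adapted F X \<longleftrightarrow> (\<forall>t\<ge>0. X t \<in> borel_measurable (F t))"

definition nondecreasing_process :: "(real \<Rightarrow> 'a measure) \<Rightarrow> (real \<Rightarrow> 'a \<Rightarrow> real) \<Rightarrow> bool" where
  "nondecreasing_process F X \<longleftrightarrow>
     adapted F X \<and> (\<forall>\<omega>\<in>space (F 0). mono_on {0..} (\<lambda>t. X t \<omega>))"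

definition predictable_sigma :: "(real \<Rightarrow> 'a measure) \<Rightarrow> (real \<times> 'a) measure" where
  "predictable_sigma F = sigma ({0..} \<times> space (F 0))
     ({{0} \<times> B | B. B \<in> sets (F 0)} \<union>
      {{s<..t} \<times> B | s t B. 0 \<le> s \<and> s \<le> t \<and> B \<in> sets (F s)})"

definition predictable_process :: "(real \<Rightarrow> 'a measure) \<Rightarrow> (real \<Rightarrow> 'a \<Rightarrow> real) \<Rightarrow> bool" where
  "predictable_process F X \<longleftrightarrow> (\<lambda>(t, \<omega>). X t \<omega>) \<in> borel_measurable (predictable_sigma F)"

text \<open>
  Stopping times take values in \<open>[0,\<infinity>]\<close>.  The library's \<^const>\<open>stopping_time\<close> wants the index set
  of the filtration to be the value type, so \<open>F\<close> is pulled back along \<^const>\<open>enn2real\<close>; at the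
  index \<open>\<infinity>\<close> (sent to \<open>0\<close>) the condition \<open>{\<tau> \<le> \<infinity>} \<in> F 0\<close> is void, and what remains is
  \<open>{\<tau> \<le> t} \<in> F t\<close> for all real \<open>t \<ge> 0\<close>.
\<close>

definition stop_time :: "(real \<Rightarrow> 'a measure) \<Rightarrow> ('a \<Rightarrow> ennreal) \<Rightarrow> bool" where
  "stop_time F \<tau> \<longleftrightarrow> stopping_time (\<lambda>t. F (enn2real t)) \<tau>"

lemma stop_time_iff:
  assumes "\<And>t. space (F t) = \<Omega>"
  shows "stop_time F \<tau> \<longleftrightarrow> (\<forall>t\<ge>0. {\<omega> \<in> \<Omega>. \<tau> \<omega> \<le> ennreal t} \<in> sets (F t))"
proof (intro iffI allI impI)
  fix t :: real
  assume "stop_time F \<tau>" and "0 \<le> t"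
  then have "Measurable.pred (F t) (\<lambda>\<omega>. \<tau> \<omega> \<le> ennreal t)"
    using stopping_timeD[of "\<lambda>t. F (enn2real t)" \<tau> "ennreal t"] by (simp add: stop_time_def)
  then show "{\<omega> \<in> \<Omega>. \<tau> \<omega> \<le> ennreal t} \<in> sets (F t)"
    by (simp add: pred_def assms)
next
  assume *: "\<forall>t\<ge>0. {\<omega> \<in> \<Omega>. \<tau> \<omega> \<le> ennreal t} \<in> sets (F t)"
  show "stop_time F \<tau>"
    unfolding stop_time_def
  proof
    fix t :: ennreal
    show "Measurable.pred (F (enn2real t)) (\<lambda>\<omega>. \<tau> \<omega> \<le> t)"
    proof (cases t)
      case (real s)
      then show ?thesis
        using *[rule_format, of s] by (simp add: pred_def assms)
    next
      case top
      then show ?thesis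
        by simp
    qed
  qed
qed

text \<open>The real number \<open>t \<and> \<tau>\<close> for \<open>0 \<le> t < \<infinity>\<close> and \<open>\<tau> \<in> [0,\<infinity>]\<close>.\<close>

definition tmin :: "real \<Rightarrow> ennreal \<Rightarrow> real" where
  "tmin t \<tau> = enn2real (min (ennreal t) \<tau>)"

definition announcing_sequence ::
  "(real \<Rightarrow> 'a measure) \<Rightarrow> ('a \<Rightarrow> ennreal) \<Rightarrow> (nat \<Rightarrow> 'a \<Rightarrow> ennreal) \<Rightarrow> bool" where
  "announcing_sequence F \<tau> \<tau>s \<longleftrightarrow>
     (\<forall>n. stop_time F (\<tau>s n)) \<and>
     (\<forall>\<omega>\<in>space (F 0).
        incseq (\<lambda>n. \<tau>s n \<omega>) \<and> (\<lambda>n. \<tau>s n \<omega>) \<longlonglongrightarrow> \<tau> \<omega> \<and>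
        (\<tau> \<omega> > 0 \<longrightarrow> (\<forall>n. \<tau>s n \<omega> < \<tau> \<omega>)) \<and>
        (\<tau> \<omega> = 0 \<longrightarrow> (\<forall>n. \<tau>s n \<omega> = 0)))"

definition martingale ::
  "'a measure \<Rightarrow> (real \<Rightarrow> 'a measure) \<Rightarrow> (real \<Rightarrow> 'a \<Rightarrow> real) \<Rightarrow> bool" where
  "martingale P F X \<longleftrightarrow>
     adapted F X \<and> (\<forall>t\<ge>0. integrable P (X t)) \<and>
     (\<forall>s\<ge>0. \<forall>t\<ge>s. AE \<omega> in P. real_cond_exp P (F s) (X t) \<omega> = X s \<omega>)"

definition local_martingale ::
  "'a measure \<Rightarrow> (real \<Rightarrow> 'a measure) \<Rightarrow> (real \<Rightarrow> 'a \<Rightarrow> real) \<Rightarrow> bool" where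
  "local_martingale P F X \<longleftrightarrow>
     adapted F X \<and>
     (\<exists>S :: nat \<Rightarrow> 'a \<Rightarrow> ennreal.
        (\<forall>n. stop_time F (S n)) \<and>
        (AE \<omega> in P. incseq (\<lambda>n. S n \<omega>) \<and> (\<lambda>n. S n \<omega>) \<longlonglongrightarrow> \<infinity>) \<and>
        (\<forall>n. martingale P F (\<lambda>t \<omega>. X (tmin t (S n \<omega>)) \<omega> - X 0 \<omega>)))"

definition cadlag_local_martingale_from_0 ::
  "'a measure \<Rightarrow> (real \<Rightarrow> 'a measure) \<Rightarrow> (real \<Rightarrow> 'a \<Rightarrow> real) \<Rightarrow> bool" where
  "cadlag_local_martingale_from_0 P F X \<longleftrightarrow>
     local_martingale P F X \<and> (\<forall>\<omega>\<in>space P. cadlag (\<lambda>t. X t \<omega>)) \<and> (AE \<omega> in P. X 0 \<omega> = 0)"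

definition no_negative_jumps :: "'a measure \<Rightarrow> (real \<Rightarrow> 'a \<Rightarrow> real) \<Rightarrow> bool" where
  "no_negative_jumps P M \<longleftrightarrow> (AE \<omega> in P. \<forall>t>0. left_lim (\<lambda>s. M s \<omega>) t \<le> M t \<omega>)"

section \<open>The two standing assumptions\<close>

text \<open>
  Running suprema are extended-real valued: a right-continuous path without left limits may be
  unbounded on a bounded time interval.
\<close>

definition sup_upto :: "(real \<Rightarrow> real) \<Rightarrow> real \<Rightarrow> ereal" where
  "sup_upto x t = (SUP s\<in>{0..t}. ereal (x s))"

definition sup_before :: "(real \<Rightarrow> real) \<Rightarrow> real \<Rightarrow> ereal" where
  "sup_before x t = (if t > 0 then SUP s\<in>{0..<t}. ereal (x s) else ereal (x 0))"

text \<open>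
  The monotone extension of \<open>\<eta> : [c0,\<infinity>) \<rightarrow> [0,\<infinity>)\<close> to \<open>\<infinity>\<close>, needed only where the running supremum
  is infinite.
\<close>

definition eta_ext :: "real \<Rightarrow> (real \<Rightarrow> real) \<Rightarrow> ereal \<Rightarrow> ennreal" where
  "eta_ext c0 \<eta> x =
     (if x = \<infinity> then SUP r\<in>{c0..}. ennreal (\<eta> r) else ennreal (\<eta> (real_of_ereal x)))"

datatype regime = Sup_Regime | No_Sup_Regime

fun eta_integrand :: "regime \<Rightarrow> real \<Rightarrow> (real \<Rightarrow> real) \<Rightarrow> (real \<Rightarrow> real) \<Rightarrow> real \<Rightarrow> ennreal" where
  "eta_integrand Sup_Regime c0 \<eta> x s = eta_ext c0 \<eta> (sup_before x s)"
| "eta_integrand No_Sup_Regime c0 \<eta> x s = ennreal (\<eta> (left_lim x s))"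

text \<open>
  \<open>\<integral>\<^bsub>(0,t]\<^esub> f da\<close> for a non-decreasing right-continuous \<open>a : [0,\<infinity>) \<rightarrow> \<real>\<close>, continued to the left of \<open>0\<close>
  as a constant so that \<^const>\<open>interval_measure\<close> applies.
\<close>

definition stieltjes :: "(real \<Rightarrow> real) \<Rightarrow> (real \<Rightarrow> ennreal) \<Rightarrow> real \<Rightarrow> ennreal" where
  "stieltjes a f t = (\<integral>\<^sup>+s\<in>{0<..t}. f s \<partial>interval_measure (\<lambda>r. a (max 0 r)))"

definition gronwall_assumption ::
  "regime \<Rightarrow> 'a measure \<Rightarrow> (real \<Rightarrow> 'a measure) \<Rightarrow> real \<Rightarrow> (real \<Rightarrow> real) \<Rightarrow>
   (real \<Rightarrow> 'a \<Rightarrow> real) \<Rightarrow> (real \<Rightarrow> 'a \<Rightarrow> real) \<Rightarrow> (real \<Rightarrow> 'a \<Rightarrow> real) \<Rightarrow> (real \<Rightarrow> 'a \<Rightarrow> real) \<Rightarrow> bool"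
where
  "gronwall_assumption r P F c0 \<eta> X A H M \<longleftrightarrow>
     0 \<le> c0 \<and>
     adapted F X \<and>
     (\<forall>\<omega>\<in>space P. right_continuous_path (\<lambda>t. X t \<omega>) \<and> (\<forall>t\<ge>0. c0 \<le> X t \<omega>)) \<and>
     (r = No_Sup_Regime \<longrightarrow> (\<forall>\<omega>\<in>space P. has_left_limits (\<lambda>t. X t \<omega>))) \<and>
     predictable_process F A \<and> (AE \<omega> in P. A 0 \<omega> = 0) \<and>
     (\<forall>\<omega>\<in>space P. cadlag (\<lambda>t. A t \<omega>) \<and> mono_on {0..} (\<lambda>t. A t \<omega>)) \<and>
     adapted F H \<and>
     (\<forall>\<omega>\<in>space P. cadlag (\<lambda>t. H t \<omega>) \<and> mono_on {0..} (\<lambda>t. H t \<omega>) \<and> (\<forall>t\<ge>0. 0 \<le> H t \<omega>)) \<and>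
     cadlag_local_martingale_from_0 P F M \<and>
     continuous_on {c0..} \<eta> \<and> mono_on {c0..} \<eta> \<and> (\<forall>x\<ge>c0. 0 \<le> \<eta> x) \<and> (\<forall>x>c0. 0 < \<eta> x) \<and>
     (\<forall>t\<ge>0. AE \<omega> in P.
        ereal (X t \<omega>) \<le>
          enn2ereal (stieltjes (\<lambda>s. A s \<omega>) (eta_integrand r c0 \<eta> (\<lambda>s. X s \<omega>)) t)
          + ereal (M t \<omega> + H t \<omega>))"

section \<open>The processes of the estimate\<close>

definition hit_H :: "(real \<Rightarrow> 'a \<Rightarrow> real) \<Rightarrow> real \<Rightarrow> 'a \<Rightarrow> ennreal" where
  "hit_H H b \<omega> = (INF s\<in>{s. 0 \<le> s \<and> b \<le> H s \<omega>}. ennreal s)"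

definition exit_X :: "(real \<Rightarrow> 'a \<Rightarrow> real) \<Rightarrow> real \<Rightarrow> 'a \<Rightarrow> ennreal" where
  "exit_X X u \<omega> = (INF s\<in>{s. 0 \<le> s \<and> u < X s \<omega>}. ennreal s)"

text \<open>
  The integral below is finite: where the indicator is nonzero, the integrand is at most \<open>\<eta> u\<close>.
\<close>

definition I_L ::
  "regime \<Rightarrow> real \<Rightarrow> (real \<Rightarrow> real) \<Rightarrow> (real \<Rightarrow> 'a \<Rightarrow> real) \<Rightarrow> (real \<Rightarrow> 'a \<Rightarrow> real) \<Rightarrow> real \<Rightarrow>
   real \<Rightarrow> 'a \<Rightarrow> real" where
  "I_L r c0 \<eta> X A u t \<omega> =
     enn2real (stieltjes (\<lambda>s. A s \<omega>)
       (\<lambda>s. eta_integrand r c0 \<eta> (\<lambda>q. X q \<omega>) s * of_bool (sup_before (\<lambda>q. X q \<omega>) s \<le> ereal u)) t)"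

definition H_L_ab :: "(real \<Rightarrow> 'a \<Rightarrow> real) \<Rightarrow> real \<Rightarrow> real \<Rightarrow> real \<Rightarrow> 'a \<Rightarrow> real" where
  "H_L_ab H lam u t \<omega> = min (H t \<omega>) (lam * u) + u * of_bool (lam * u \<le> H t \<omega>)"

definition H_L_c ::
  "'a measure \<Rightarrow> (real \<Rightarrow> 'a measure) \<Rightarrow> (real \<Rightarrow> 'a \<Rightarrow> real) \<Rightarrow> real \<Rightarrow> real \<Rightarrow> real \<Rightarrow> 'a \<Rightarrow> real" where
  "H_L_c P F H T u t \<omega> = min (real_cond_exp P (F 0) (H T) \<omega>) u"

definition M_L_a_seq ::
  "(real \<Rightarrow> 'a \<Rightarrow> real) \<Rightarrow> (real \<Rightarrow> 'a \<Rightarrow> real) \<Rightarrow> real \<Rightarrow> (nat \<Rightarrow> 'a \<Rightarrow> ennreal) \<Rightarrow>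
   nat \<Rightarrow> real \<Rightarrow> 'a \<Rightarrow> real" where
  "M_L_a_seq X M u \<tau>s n t \<omega> = M (tmin t (min (\<tau>s n \<omega>) (exit_X X u \<omega>))) \<omega>"

definition M_L_a ::
  "(real \<Rightarrow> 'a \<Rightarrow> real) \<Rightarrow> (real \<Rightarrow> 'a \<Rightarrow> real) \<Rightarrow> real \<Rightarrow> (nat \<Rightarrow> 'a \<Rightarrow> ennreal) \<Rightarrow>
   real \<Rightarrow> 'a \<Rightarrow> real" where
  "M_L_a X M u \<tau>s t \<omega> = lim (\<lambda>n. M_L_a_seq X M u \<tau>s n t \<omega>)"

definition M_L_b ::
  "(real \<Rightarrow> 'a \<Rightarrow> real) \<Rightarrow> (real \<Rightarrow> 'a \<Rightarrow> real) \<Rightarrow> (real \<Rightarrow> 'a \<Rightarrow> real) \<Rightarrow> real \<Rightarrow> real \<Rightarrow>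
   real \<Rightarrow> 'a \<Rightarrow> real" where
  "M_L_b X H M lam u t \<omega> = M (tmin t (min (hit_H H (lam * u) \<omega>) (exit_X X u \<omega>))) \<omega>"

text \<open>
  \<open>N\<close> is a version on \<open>[0,T]\<close>, with cadlag paths, of
  \<open>M\<^sub>t + E[H\<^sub>T | F\<^sub>t] - E[H\<^sub>T | F\<^sub>0]\<close>.  Freezing a process at time \<open>T\<close> expresses that only its
  restriction to \<open>[0,T]\<close> is meant.
\<close>

definition cadlag_version_M_tilde ::
  "'a measure \<Rightarrow> (real \<Rightarrow> 'a measure) \<Rightarrow> (real \<Rightarrow> 'a \<Rightarrow> real) \<Rightarrow> (real \<Rightarrow> 'a \<Rightarrow> real) \<Rightarrow> real \<Rightarrow>
   (real \<Rightarrow> 'a \<Rightarrow> real) \<Rightarrow> bool" where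
  "cadlag_version_M_tilde P F H M T N \<longleftrightarrow>
     (\<forall>\<omega>\<in>space P. cadlag (\<lambda>t. N (min t T) \<omega>)) \<and>
     (\<forall>t\<in>{0..T}. AE \<omega> in P.
        N t \<omega> = M t \<omega> + real_cond_exp P (F t) (H T) \<omega> - real_cond_exp P (F 0) (H T) \<omega>)"

definition M_L_c ::
  "'a measure \<Rightarrow> (real \<Rightarrow> 'a measure) \<Rightarrow> (real \<Rightarrow> 'a \<Rightarrow> real) \<Rightarrow> (real \<Rightarrow> 'a \<Rightarrow> real) \<Rightarrow> real \<Rightarrow> real \<Rightarrow>
   (real \<Rightarrow> 'a \<Rightarrow> real) \<Rightarrow> real \<Rightarrow> 'a \<Rightarrow> real" where
  "M_L_c P F X H T u N t \<omega> =
     N (tmin t (exit_X X u \<omega>)) \<omega> * of_bool (real_cond_exp P (F 0) (H T) \<omega> \<le> u)"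

definition L_estimate ::
  "'a measure \<Rightarrow> real \<Rightarrow> real \<Rightarrow> (real \<Rightarrow> 'a \<Rightarrow> real) \<Rightarrow>
   (real \<Rightarrow> 'a \<Rightarrow> real) \<Rightarrow> (real \<Rightarrow> 'a \<Rightarrow> real) \<Rightarrow> (real \<Rightarrow> 'a \<Rightarrow> real) \<Rightarrow> bool" where
  "L_estimate P T u X IL ML HL \<longleftrightarrow>
     (\<forall>t\<in>{0..T}. AE \<omega> in P.
        of_bool (sup_upto (\<lambda>s. X s \<omega>) t > ereal u) * u \<le> min (X (tmin t (exit_X X u \<omega>)) \<omega>) u \<and>
        min (X (tmin t (exit_X X u \<omega>)) \<omega>) u \<le> IL t \<omega> + ML t \<omega> + HL t \<omega>)"

end

theory Submission
  imports Defs "HOL-Library.Sublist"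
begin

text \<open>
  The estimate is a pathwise one.  Before the exit time \<open>\<sigma>\<close> the process \<open>X\<close> is at most \<open>u\<close>, so the
  integrand of the integral inequality agrees up to \<open>\<sigma>\<close> with the cut integrand of \<open>I\<^sup>L\<close>, and the inequality,
  assumed for each time separately, holds at all these times simultaneously
  (\<open>integral_inequality_below\<close>).  At \<open>t \<and> \<sigma>\<close> it gives \<open>X \<le> I\<^sup>L + M + H\<close>; what remains is to trade \<open>H\<close> for the
  bounded \<open>H\<^sup>L\<close> at the price of altering \<open>M\<close>.

  In the cases (a) and (b) nothing happens before the time \<open>\<tau>\<close> at which \<open>H\<close> reaches \<open>\<lambda>u\<close>.  From \<open>\<tau>\<close> on the
  summand \<open>u\<close> of \<open>H\<^sup>L\<close> dominates \<open>X \<and> u\<close>, and it suffices that \<open>I\<^sup>L + M\<^sup>L + \<lambda>u\<close> is non-negative.  Just before \<open>\<tau>\<close>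
  this follows from \<open>0 \<le> X \<le> I\<^sup>L + M + \<lambda>u\<close>, so it holds for the left limit \<open>M\<^bsub>\<tau>-\<^esub>\<close>.  This left limit is \<open>M\<^sup>L\<close>
  in case (a), and is at most \<open>M\<^sup>L = M\<^sub>\<tau>\<close> when \<open>M\<close> has no negative jumps (\<open>estimate_at_hit\<close>).  In case (c)
  monotonicity gives \<open>H\<^sub>s \<le> E[H\<^sub>T | F\<^sub>s]\<close>, and the martingale on the right is part of the modified \<open>M\<close>
  (\<open>H_le_N\<close>, \<open>estimate_c\<close>).

  Most of the text establishes the facts about processes on which this rests.
  \<^item> Stopping preserves martingales (\<open>stopped_martingale\<close>), and for an announced time so does stopping just
    before it (\<open>announced_stop_local_martingale\<close>).  Both are limits of stopping at times with finitely
    many values, and the limits are justified by uniform integrability.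
  \<^item> The hitting time of a level by a predictable \<open>H\<close> has an announcing sequence
    (\<open>announcing_sequence_exists\<close>).  Its graph is a predictable set; by inner regularity it is exhausted,
    up to a null set, by countable intersections of finite unions of rectangles \<open>[s, t] \<times> B\<close> with \<open>B\<close> known
    before \<open>s\<close>.  Entrances into such sets can be foreseen, and for a set inside the graph the only possible
    entrance is the hitting time itself.
  \<^item> The martingale \<open>E[H\<^sub>T | F\<^sub>t]\<close> has a cadlag version (\<open>cadlag_conditional_expectations\<close>), by Doob's
    upcrossing inequality.
  \<^item> \<open>I\<^sup>L\<close> is adapted (\<open>stieltjes_measurable\<close>): the normalised Stieltjes measures of \<open>A\<close> form a kernel.
\<close>

section \<open>Stopped paths and the usual conditions\<close>

lemma tmin_eq: "0 \<le> t \<Longrightarrow> tmin t a = (if ennreal t \<le> a then t else enn2real a)"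
  unfolding tmin_def by (auto simp: min_def)

lemma tmin_top [simp]: "0 \<le> t \<Longrightarrow> tmin t \<top> = t"
  by (simp add: tmin_eq)

lemma tmin_real: "0 \<le> t \<Longrightarrow> 0 \<le> a \<Longrightarrow> tmin t (ennreal a) = min t a"
  by (simp add: tmin_eq min_def)

lemma tmin_nonneg [simp]: "0 \<le> tmin t a"
  by (simp add: tmin_def)

lemma tmin_zero [simp]: "tmin 0 a = 0"
  by (simp add: tmin_def)

lemma tmin_le: "0 \<le> t \<Longrightarrow> tmin t a \<le> t"
  by (cases a) (auto simp: tmin_real)

lemma tmin_tmin: "0 \<le> t \<Longrightarrow> tmin (tmin t a) b = tmin t (min a b)"
proof -
  have "min (ennreal t) a < \<top>" by (simp add: min_less_iff_disj)
  then show ?thesis by (simp add: tmin_def min.assoc)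
qed

lemma ennreal_tmin: "0 \<le> t \<Longrightarrow> ennreal (tmin t a) = min (ennreal t) a"
  by (cases a) (auto simp: tmin_real min_def ennreal_le_iff2)

lemma stopped_right_continuous:
  assumes "right_continuous_path f"
  shows "right_continuous_path (\<lambda>t. f (tmin t a))"
  unfolding right_continuous_path_def continuous_within
proof (intro allI impI)
  fix t :: real assume t: "0 \<le> t"
  show "((\<lambda>s. f (tmin s a)) \<longlongrightarrow> f (tmin t a)) (at_right t)"
  proof (cases "ennreal t < a")
    case True
    obtain d where d: "t < d" "ennreal d \<le> a"
    proof (cases a)
      case (real r)
      then show ?thesis using True that[of r] t by (auto simp: ennreal_less_iff)
    qed (use that[of "t + 1"] in auto)
    have "(f \<longlongrightarrow> f t) (at_right t)"
      using assms t by (simp add: right_continuous_path_def continuous_within)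
    moreover have "\<forall>\<^sub>F s in at_right t. f (tmin s a) = f s"
      using eventually_at_right_less[of t] eventually_at_right_real[OF d(1)]
    proof eventually_elim
      case (elim s)
      then have "ennreal s \<le> a" using d by (meson ennreal_leI greaterThanLessThan_iff less_imp_le order_trans)
      then show ?case using elim t by (simp add: tmin_eq)
    qed
    moreover have "tmin t a = t" using True t by (simp add: tmin_eq less_imp_le)
    ultimately show ?thesis by (simp add: tendsto_cong)
  next
    case False
    then have a: "a \<le> ennreal t" by simp
    have "\<forall>\<^sub>F s in at_right t. f (tmin s a) = f (tmin t a)"
      using eventually_at_right_less[of t]
    proof eventually_elim
      case (elim s)
      then have "a \<le> ennreal s" using a by (meson ennreal_leI less_imp_le order_trans)
      then show ?case using a unfolding tmin_def by (simp add: min_absorb2)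
    qed
    then show ?thesis by (simp add: tendsto_eventually)
  qed
qed

lemma stopped_left_limits:
  assumes "has_left_limits f"
  shows "has_left_limits (\<lambda>t. f (tmin t a))"
  unfolding has_left_limits_def
proof (intro allI impI)
  fix t :: real assume t: "0 < t"
  show "\<exists>l. ((\<lambda>s. f (tmin s a)) \<longlongrightarrow> l) (at_left t)"
  proof (cases "ennreal t \<le> a")
    case True
    obtain l where "(f \<longlongrightarrow> l) (at_left t)"
      using assms t by (auto simp: has_left_limits_def)
    moreover have "\<forall>\<^sub>F s in at_left t. f (tmin s a) = f s"
      using eventually_at_left_real[OF t]
    proof eventually_elim
      case (elim s)
      then have "ennreal s \<le> a" using True by (meson ennreal_leI greaterThanLessThan_iff less_imp_le order_trans)
      then show ?case using elim t by (simp add: tmin_eq)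
    qed
    ultimately show ?thesis by (auto simp: tendsto_cong)
  next
    case False
    then obtain r where r: "0 \<le> r" "a = ennreal r" "r < t" by (cases a) (auto simp: ennreal_less_iff not_le)
    have "\<forall>\<^sub>F s in at_left t. f (tmin s a) = f r"
      using eventually_at_left_real[OF r(3)]
      by eventually_elim (use r in \<open>auto simp: tmin_real\<close>)
    then show ?thesis by (auto intro: tendsto_eventually)
  qed
qed

lemma stopped_cadlag: "cadlag f \<Longrightarrow> cadlag (\<lambda>t. f (tmin t a))"
  by (simp add: cadlag_def stopped_right_continuous stopped_left_limits)

lemma rationals_decreasing_to:
  fixes t b :: real
  assumes "t < b"
  obtains q :: "nat \<Rightarrow> real" where "\<And>n. q n \<in> \<rat>" "\<And>n. t < q n" "\<And>n. q n < b" "q \<longlonglongrightarrow> t"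
proof -
  have "\<exists>q. q \<in> \<rat> \<and> t < q \<and> q < t + min (b - t) (1 / real (Suc n))" for n
    using Rats_dense_in_real[of t "t + min (b - t) (1 / real (Suc n))"] assms by auto
  then obtain q where q: "\<And>n. q n \<in> \<rat>" "\<And>n. t < q n" "\<And>n. q n < t + min (b - t) (1 / real (Suc n))"
    by metis
  have "q \<longlonglongrightarrow> t"
  proof (rule tendsto_sandwich[where f="\<lambda>_. t" and h="\<lambda>n. t + 1 / real (Suc n)"])
    have "(\<lambda>n. t + 1 / real (Suc n)) \<longlonglongrightarrow> t + 0"
      by (intro tendsto_add tendsto_const LIMSEQ_Suc lim_const_over_n)
    then show "(\<lambda>n. t + 1 / real (Suc n)) \<longlonglongrightarrow> t" by simp
    have "q n \<le> t + 1 / real (Suc n)" for n using q(3)[of n] by linarith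
    then show "\<forall>\<^sub>F n in sequentially. q n \<le> t + 1 / real (Suc n)" by (intro always_eventually allI)
  qed (use q(2) in \<open>auto intro!: always_eventually less_imp_le\<close>)
  moreover have "q n < b" for n using q(3)[of n] by linarith
  ultimately show ?thesis using q that by blast
qed

context usual_filtered_prob_space
begin

lemma F_sub: "A \<in> sets (F t) \<Longrightarrow> A \<in> sets P"
  using subalgebra_F[of t] by (auto simp: subalgebra_def)

lemma F_mono: "s \<le> t \<Longrightarrow> A \<in> sets (F s) \<Longrightarrow> A \<in> sets (F t)"
  using sets_F_mono by blast

lemma measurable_F_P: "f \<in> borel_measurable (F t) \<Longrightarrow> f \<in> borel_measurable P"
  using measurable_from_subalg[OF subalgebra_F] .

lemma measurable_F_mono: "s \<le> t \<Longrightarrow> f \<in> borel_measurable (F s) \<Longrightarrow> f \<in> borel_measurable (F t)"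
  by (rule measurable_from_subalg[of "F t" "F s"]) (auto simp: subalgebra_def space_F sets_F_mono)

lemma F_sigma_finite_subalgebra: "sigma_finite_subalgebra P (F t)"
proof -
  interpret finite_measure_subalgebra P "F t"
    by standard (rule subalgebra_F)
  show ?thesis by (rule sigma_finite_subalgebra_axioms)
qed

lemma null_sets_F: "0 \<le> t \<Longrightarrow> N \<in> null_sets P \<Longrightarrow> N \<in> sets (F t)"
  using null_sets_F0 F_mono by blast

lemma AE_null_set:
  assumes "AE \<omega> in P. Q \<omega>"
  shows "{\<omega>\<in>space P. \<not> Q \<omega>} \<in> null_sets P"
proof -
  from assms obtain N where N: "{\<omega>\<in>space P. \<not> Q \<omega>} \<subseteq> N" "N \<in> null_sets P"
    by (auto simp: eventually_ae_filter)
  then show ?thesis using complete2 by blast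
qed

text \<open>
  Since \<open>F 0\<close> contains the null sets and \<open>P\<close> is complete, changing a set on a null set does not
  affect the time at which it is known.
\<close>

lemma F_AE_eq_set:
  assumes "0 \<le> t" "A \<in> sets (F t)" "AE \<omega> in P. \<omega> \<in> A \<longleftrightarrow> \<omega> \<in> B" "B \<subseteq> space P"
  shows "B \<in> sets (F t)"
proof -
  let ?N = "{\<omega>\<in>space P. \<not> (\<omega> \<in> A \<longleftrightarrow> \<omega> \<in> B)}"
  have N: "?N \<in> null_sets P" using assms(3) by (rule AE_null_set)
  have "?N \<inter> B \<in> null_sets P" using N complete2[of "?N \<inter> B" ?N] by auto
  then have "?N \<inter> B \<in> sets (F t)" "?N \<in> sets (F t)" using N null_sets_F assms(1) by auto
  then have "(A - ?N) \<union> (?N \<inter> B) \<in> sets (F t)"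
    using assms(2) by (intro sets.Un sets.Diff)
  moreover have "(A - ?N) \<union> (?N \<inter> B) = B"
    using assms(4) sets.sets_into_space[OF assms(2)] by (auto simp: space_F)
  ultimately show ?thesis by (rule back_subst[where P="\<lambda>A. A \<in> sets (F t)"])
qed

lemma measurable_F_AE_eq:
  fixes f g :: "'a \<Rightarrow> real"
  assumes "0 \<le> t" "f \<in> borel_measurable (F t)" "AE \<omega> in P. f \<omega> = g \<omega>"
  shows "g \<in> borel_measurable (F t)"
proof (rule borel_measurableI)
  fix S :: "real set" assume "open S"
  then have "f -` S \<inter> space (F t) \<in> sets (F t)" using assms(2) by (auto intro: measurable_sets)
  then show "g -` S \<inter> space (F t) \<in> sets (F t)"
    by (rule F_AE_eq_set[OF assms(1)]) (use assms(3) in \<open>auto simp: space_F\<close>)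
qed

lemma F_right:
  assumes "0 \<le> t" "\<And>s. t < s \<Longrightarrow> A \<in> sets (F s)"
  shows "A \<in> sets (F t)"
proof -
  have "A \<in> (\<Inter>s\<in>{t<..}. sets (F s))" using assms(2) by blast
  then show ?thesis unfolding right_continuous_F[OF assms(1)] .
qed

lemma measurable_F_right:
  fixes f :: "'a \<Rightarrow> 'b::topological_space"
  assumes "0 \<le> t" "\<And>s. t < s \<Longrightarrow> f \<in> borel_measurable (F s)"
  shows "f \<in> borel_measurable (F t)"
proof (rule borel_measurableI)
  fix S :: "'b set" assume "open S"
  then show "f -` S \<inter> space (F t) \<in> sets (F t)"
    using measurable_sets[OF assms(2), of _ S] by (auto simp: space_F intro: F_right[OF assms(1)])
qed

lemma stop_iff: "stop_time F \<tau> \<longleftrightarrow> (\<forall>t\<ge>0. {\<omega> \<in> space P. \<tau> \<omega> \<le> ennreal t} \<in> sets (F t))"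
  by (rule stop_time_iff) (rule space_F)

lemma stop_le: "stop_time F \<tau> \<Longrightarrow> 0 \<le> t \<Longrightarrow> {\<omega> \<in> space P. \<tau> \<omega> \<le> ennreal t} \<in> sets (F t)"
  by (simp add: stop_iff)

lemma stop_gt: "stop_time F \<tau> \<Longrightarrow> 0 \<le> t \<Longrightarrow> {\<omega> \<in> space P. ennreal t < \<tau> \<omega>} \<in> sets (F t)"
  using sets.compl_sets[OF stop_le[of \<tau> t]]
  by (rule back_subst[where P="\<lambda>A. A \<in> sets (F t)"]) (auto simp: space_F)

lemma stop_min: "stop_time F \<tau> \<Longrightarrow> stop_time F \<rho> \<Longrightarrow> stop_time F (\<lambda>\<omega>. min (\<tau> \<omega>) (\<rho> \<omega>))"
  unfolding stop_time_def by (rule stopping_time_min)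

lemma stop_measurable: "stop_time F \<tau> \<Longrightarrow> \<tau> \<in> borel_measurable P"
  unfolding stop_time_def
  by (rule measurable_stopping_time[of "\<lambda>t. F (enn2real t)"]) (use subalgebra_F in \<open>auto simp: subalgebra_def\<close>)

text \<open>Right-continuity of the filtration lets strict inequalities decide stopping times.\<close>

lemma stop_ltI:
  assumes "\<And>t. 0 < t \<Longrightarrow> {\<omega> \<in> space P. \<tau> \<omega> < ennreal t} \<in> sets (F t)"
  shows "stop_time F \<tau>"
  unfolding stop_iff
proof (intro allI impI)
  fix t :: real assume t: "0 \<le> t"
  show "{\<omega> \<in> space P. \<tau> \<omega> \<le> ennreal t} \<in> sets (F t)"
  proof (rule F_right[OF t])
    fix s assume s: "t < s"
    define q where "q n = t + (s - t) / real (Suc n)" for n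
    have q: "t < q n" "q n \<le> s" for n
      using s by (auto simp: q_def field_simps intro!: mult_right_mono)
    have lim: "(\<lambda>n. ennreal (q n)) \<longlonglongrightarrow> ennreal t"
    proof (rule tendsto_ennrealI)
      have "(\<lambda>n. t + (s - t) / real (Suc n)) \<longlonglongrightarrow> t + 0"
        by (intro tendsto_add tendsto_const LIMSEQ_Suc lim_const_over_n)
      then show "q \<longlonglongrightarrow> t" by (simp add: q_def[abs_def])
    qed
    have "{\<omega> \<in> space P. \<tau> \<omega> \<le> ennreal t} = (\<Inter>n. {\<omega> \<in> space P. \<tau> \<omega> < ennreal (q n)})"
    proof safe
      fix \<omega> n assume "\<tau> \<omega> \<le> ennreal t"
      also have "ennreal t < ennreal (q n)" using q[of n] t by (simp add: ennreal_lessI)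
      finally show "\<tau> \<omega> < ennreal (q n)" .
    next
      fix \<omega> assume *: "\<omega> \<in> (\<Inter>n. {\<omega> \<in> space P. \<tau> \<omega> < ennreal (q n)})"
      then show "\<omega> \<in> space P" by auto
      show "\<tau> \<omega> \<le> ennreal t"
        by (rule Lim_bounded2[OF lim]) (use * in \<open>auto intro: less_imp_le\<close>)
    qed
    also have "\<dots> \<in> sets (F s)"
    proof (rule sets.countable_INT')
      show "range (\<lambda>n. {\<omega> \<in> space P. \<tau> \<omega> < ennreal (q n)}) \<subseteq> sets (F s)"
      proof safe
        fix n
        have "0 < q n" using q(1)[of n] t by simp
        then show "{\<omega> \<in> space P. \<tau> \<omega> < ennreal (q n)} \<in> sets (F s)"
          using q(2) by (intro F_mono[OF _ assms])
      qed
    qed auto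
    finally show "{\<omega> \<in> space P. \<tau> \<omega> \<le> ennreal t} \<in> sets (F s)" .
  qed
qed

lemma rational_between_right:
  assumes "u < X t" "((X::real\<Rightarrow>real) \<longlongrightarrow> X t) (at_right t)" "t < s" "0 \<le> t"
  obtains q where "q \<in> \<rat>" "t < q" "q < s" "u < X q"
proof -
  have "\<forall>\<^sub>F x in at_right t. u < X x" using order_tendstoD(1)[OF assms(2,1)] .
  then obtain b where b: "t < b" "\<And>y. t < y \<Longrightarrow> y < b \<Longrightarrow> u < X y"
    by (auto simp: eventually_at_right_field)
  obtain q where "q \<in> \<rat>" "t < q" "q < min b s" using Rats_dense_in_real[of t "min b s"] b assms(3) by auto
  then show ?thesis using that b by auto
qed

text \<open>
  The exit time is not a hitting time of a closed set, so \<open>{\<sigma> \<le> t}\<close> is not visible at time \<open>t\<close>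
  without looking slightly ahead; \<open>{\<sigma> < t}\<close> is a union over rational times.
\<close>

lemma exit_X_stop:
  assumes "adapted F X" "\<And>\<omega>. \<omega> \<in> space P \<Longrightarrow> right_continuous_path (\<lambda>t. X t \<omega>)"
  shows "stop_time F (exit_X X u)"
proof (rule stop_ltI)
  fix t :: real assume t: "0 < t"
  have "{\<omega> \<in> space P. exit_X X u \<omega> < ennreal t} = (\<Union>q\<in>\<rat>\<inter>{0..<t}. {\<omega>\<in>space (F t). u < X q \<omega>})"
  proof safe
    fix \<omega> assume w: "\<omega> \<in> space P" and "exit_X X u \<omega> < ennreal t"
    then obtain s where s: "0 \<le> s" "u < X s \<omega>" "s < t"
      using t by (auto simp: exit_X_def INF_less_iff ennreal_less_iff)
    obtain q where "q \<in> \<rat>" "s < q" "q < t" "u < X q \<omega>"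
      using rational_between_right[of u "\<lambda>t. X t \<omega>" s t] s assms(2)[OF w]
      by (auto simp: right_continuous_path_def continuous_within)
    then show "\<omega> \<in> (\<Union>q\<in>\<rat>\<inter>{0..<t}. {\<omega>\<in>space (F t). u < X q \<omega>})"
      using s w by (force simp: space_F)
  next
    fix \<omega> q assume "\<omega> \<in> space (F t)" "q \<in> \<rat>" "q \<in> {0..<t}" "u < X q \<omega>"
    then show "exit_X X u \<omega> < ennreal t"
      using t by (auto simp: exit_X_def INF_less_iff intro!: exI[of _ q] ennreal_lessI)
  qed (auto simp: space_F)
  also have "\<dots> \<in> sets (F t)"
  proof (rule sets.countable_UN'')
    show "countable (\<rat> \<inter> {0..<t})" by (simp add: countable_rat)
    fix q assume "q \<in> \<rat> \<inter> {0..<t}"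
    then have [measurable]: "X q \<in> borel_measurable (F t)"
      using assms(1) measurable_F_mono[of q t] by (auto simp: adapted_def)
    show "{\<omega>\<in>space (F t). u < X q \<omega>} \<in> sets (F t)" by measurable
  qed
  finally show "{\<omega> \<in> space P. exit_X X u \<omega> < ennreal t} \<in> sets (F t)" .
qed

end

text \<open>
  Right-continuity of the non-decreasing path makes the level attained at a finite hitting time.
\<close>

lemma hit_H_le_iff:
  assumes "right_continuous_path (\<lambda>t. H t \<omega>)" "mono_on {0..} (\<lambda>t. H t \<omega>)" "0 \<le> t"
  shows "hit_H H b \<omega> \<le> ennreal t \<longleftrightarrow> b \<le> H t \<omega>"
proof
  assume *: "hit_H H b \<omega> \<le> ennreal t"
  have ge: "b \<le> H s \<omega>" if s: "t < s" for s
  proof -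
    have "hit_H H b \<omega> < ennreal s" using * s assms(3) by (auto intro: le_less_trans ennreal_lessI)
    then obtain r where r: "0 \<le> r" "b \<le> H r \<omega>" "r < s"
      using s assms(3) by (auto simp: hit_H_def INF_less_iff ennreal_less_iff)
    then have "H r \<omega> \<le> H s \<omega>" using s by (intro mono_onD[OF assms(2)]) auto
    then show ?thesis using r by simp
  qed
  have "((\<lambda>t. H t \<omega>) \<longlongrightarrow> H t \<omega>) (at_right t)"
    using assms by (simp add: right_continuous_path_def continuous_within)
  moreover have "\<forall>\<^sub>F s in at_right t. b \<le> H s \<omega>"
    using eventually_at_right_less[of t] by eventually_elim (rule ge)
  ultimately show "b \<le> H t \<omega>" by (rule tendsto_lowerbound) simp
next
  assume "b \<le> H t \<omega>"
  then show "hit_H H b \<omega> \<le> ennreal t" using assms(3) by (auto simp: hit_H_def intro!: INF_lower2[of t])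
qed

context usual_filtered_prob_space
begin

lemma hit_H_stop:
  assumes "adapted F H"
    "\<And>\<omega>. \<omega> \<in> space P \<Longrightarrow> right_continuous_path (\<lambda>t. H t \<omega>) \<and> mono_on {0..} (\<lambda>t. H t \<omega>)"
  shows "stop_time F (hit_H H b)"
  unfolding stop_iff
proof (intro allI impI)
  fix t :: real assume t: "0 \<le> t"
  then have [measurable]: "H t \<in> borel_measurable (F t)" using assms(1) by (simp add: adapted_def)
  have "{\<omega> \<in> space P. hit_H H b \<omega> \<le> ennreal t} = {\<omega> \<in> space (F t). b \<le> H t \<omega>}"
    using assms(2) t by (auto simp: hit_H_le_iff space_F)
  also have "\<dots> \<in> sets (F t)" by measurable
  finally show "{\<omega> \<in> space P. hit_H H b \<omega> \<le> ennreal t} \<in> sets (F t)" .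
qed

end

section \<open>Uniform integrability and times with finitely many values\<close>

lemma LIMSEQ_ceiling_grid:
  fixes r :: real
  shows "(\<lambda>m. \<lceil>real (Suc m) * r\<rceil> / real (Suc m)) \<longlonglongrightarrow> r"
proof (rule tendsto_sandwich)
  show "\<forall>\<^sub>F m in sequentially. r \<le> \<lceil>real (Suc m) * r\<rceil> / real (Suc m)"
    by (intro always_eventually allI) (simp add: field_simps)
  show "\<forall>\<^sub>F m in sequentially. \<lceil>real (Suc m) * r\<rceil> / real (Suc m) \<le> r + 1 / real (Suc m)"
  proof (intro always_eventually allI)
    fix m
    have "real_of_int \<lceil>real (Suc m) * r\<rceil> \<le> real (Suc m) * r + 1" by linarith
    then have "\<lceil>real (Suc m) * r\<rceil> / real (Suc m) \<le> (real (Suc m) * r + 1) / real (Suc m)"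
      by (rule divide_right_mono) simp
    then show "\<lceil>real (Suc m) * r\<rceil> / real (Suc m) \<le> r + 1 / real (Suc m)"
      by (simp add: add_divide_distrib)
  qed
  have "(\<lambda>m. r + 1 / real (Suc m)) \<longlonglongrightarrow> r + 0"
    by (intro tendsto_add tendsto_const LIMSEQ_Suc lim_const_over_n)
  then show "(\<lambda>m. r + 1 / real (Suc m)) \<longlonglongrightarrow> r" by simp
qed simp

lemma right_continuous_path_LIMSEQ:
  assumes "right_continuous_path f" "0 \<le> t" "x \<longlonglongrightarrow> t" "\<And>n. t \<le> x n"
  shows "(\<lambda>n. f (x n)) \<longlonglongrightarrow> f t"
proof -
  have "continuous (at t within {t..}) f"
    using assms(1,2) by (simp add: right_continuous_path_def at_within_Ici_at_right continuous_within)
  then show ?thesis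
    using assms(3,4) by (simp add: continuous_within_sequentially comp_def)
qed

text \<open>
  The martingale property is handled through integrals over events rather than through conditional
  expectations.
\<close>

abbreviation integral_on :: "'a measure \<Rightarrow> 'a set \<Rightarrow> ('a \<Rightarrow> real) \<Rightarrow> real" where
  "integral_on M A f \<equiv> (\<integral>\<omega>. indicator A \<omega> * f \<omega> \<partial>M)"

text \<open>
  Uniform integrability is expressed by the excess of the modulus over a level \<open>c\<close>: it tends to \<open>0\<close> as
  \<open>c\<close> grows, and unlike the tail integral it is convex in \<open>f\<close>, hence monotone along martingales.
\<close>

abbreviation excess :: "'a measure \<Rightarrow> real \<Rightarrow> ('a \<Rightarrow> real) \<Rightarrow> real" where
  "excess M c f \<equiv> (\<integral>\<omega>. max 0 (\<bar>f \<omega>\<bar> - c) \<partial>M)"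

text \<open>
  Conditional Jensen for \<open>x \<mapsto> max 0 (\<bar>x\<bar> - c)\<close>: on the two events where the excess of \<open>Y\<close> is positive it
  is affine, so only the averages of \<open>Y\<close> and \<open>Z\<close> over these events have to be compared.
\<close>

lemma excess_bound:
  fixes Y Z :: "'a \<Rightarrow> real"
  assumes "integrable M Y" "integrable M Z" "0 \<le> c"
    and "integral_on M {\<omega>\<in>space M. c < Y \<omega>} Y = integral_on M {\<omega>\<in>space M. c < Y \<omega>} Z"
    and "integral_on M {\<omega>\<in>space M. Y \<omega> < - c} Y = integral_on M {\<omega>\<in>space M. Y \<omega> < - c} Z"
    and "finite_measure M"
  shows "excess M c Y \<le> excess M c Z"
proof -
  interpret finite_measure M by fact
  note [measurable] = borel_measurable_integrable[OF assms(1)] borel_measurable_integrable[OF assms(2)]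
  define A where "A = {\<omega>\<in>space M. c < Y \<omega>}"
  define B where "B = {\<omega>\<in>space M. Y \<omega> < - c}"
  have [measurable]: "A \<in> sets M" "B \<in> sets M" unfolding A_def B_def by measurable
  have int [simp]: "integrable M (\<lambda>\<omega>. indicator A \<omega> * Y \<omega>)" "integrable M (\<lambda>\<omega>. indicator A \<omega> * Z \<omega>)"
    "integrable M (\<lambda>\<omega>. indicator B \<omega> * Y \<omega>)" "integrable M (\<lambda>\<omega>. indicator B \<omega> * Z \<omega>)"
    using integrable_mult_indicator[of A M Y] integrable_mult_indicator[of A M Z]
      integrable_mult_indicator[of B M Y] integrable_mult_indicator[of B M Z] assms(1,2) by simp_all
  have int2 [simp]: "integrable M (\<lambda>\<omega>. indicator A \<omega> * c)" "integrable M (\<lambda>\<omega>. indicator B \<omega> * c)"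
    using integrable_mult_indicator[of A M "\<lambda>_. c"] integrable_mult_indicator[of B M "\<lambda>_. c"] by simp_all
  have exp: "(\<integral>\<omega>. (indicator A \<omega> * W \<omega> - indicator A \<omega> * c) + (- (indicator B \<omega> * W \<omega>) - indicator B \<omega> * c) \<partial>M)
      = integral_on M A W - integral_on M A (\<lambda>\<omega>. c)
        + (- integral_on M B W - integral_on M B (\<lambda>\<omega>. c))"
    if "integrable M W" for W
  proof -
    have "integrable M (\<lambda>\<omega>. indicator A \<omega> * W \<omega>)" "integrable M (\<lambda>\<omega>. indicator B \<omega> * W \<omega>)"
      using integrable_mult_indicator[of A M W] integrable_mult_indicator[of B M W] that by simp_all
    then show ?thesis
      using int2 by (simp only: Bochner_Integration.integral_add Bochner_Integration.integral_diff
        Bochner_Integration.integral_minus Bochner_Integration.integrable_diff integrable_minus)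
  qed
  have "excess M c Y
      = (\<integral>\<omega>. (indicator A \<omega> * Y \<omega> - indicator A \<omega> * c) + (- (indicator B \<omega> * Y \<omega>) - indicator B \<omega> * c) \<partial>M)"
    using assms(3) by (intro Bochner_Integration.integral_cong) (auto simp: A_def B_def indicator_def)
  also have "\<dots> = (\<integral>\<omega>. (indicator A \<omega> * Z \<omega> - indicator A \<omega> * c) + (- (indicator B \<omega> * Z \<omega>) - indicator B \<omega> * c) \<partial>M)"
    using assms(4,5)[folded A_def B_def] assms(1,2) by (simp only: exp)
  also have "\<dots> \<le> excess M c Z"
  proof (rule integral_mono)
    show "integrable M (\<lambda>\<omega>. max 0 (\<bar>Z \<omega>\<bar> - c))"
      using assms(2) by (intro integrable_max Bochner_Integration.integrable_diff integrable_abs) auto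
    show "integrable M (\<lambda>\<omega>. (indicator A \<omega> * Z \<omega> - indicator A \<omega> * c) + (- (indicator B \<omega> * Z \<omega>) - indicator B \<omega> * c))"
      using int int2 by (intro Bochner_Integration.integrable_add Bochner_Integration.integrable_diff integrable_minus)
    fix \<omega>
    show "(indicator A \<omega> * Z \<omega> - indicator A \<omega> * c) + (- (indicator B \<omega> * Z \<omega>) - indicator B \<omega> * c) \<le> max 0 (\<bar>Z \<omega>\<bar> - c)"
      using assms(3) by (auto simp: A_def B_def indicator_def)
  qed
  finally show ?thesis .
qed

text \<open>
  A substitute for Vitali's convergence theorem: the truncations to \<open>[-c, c]\<close> converge by dominated
  convergence, and the uniform bound on the excess over \<open>c\<close> is inherited by the limit through
  Fatou's lemma.
\<close>

lemma uniform_excess_limit: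
  fixes Z :: "nat \<Rightarrow> 'a \<Rightarrow> real"
  assumes "finite_measure M" "\<And>n. integrable M (Z n)" "Y \<in> borel_measurable M"
    and lim: "AE \<omega> in M. (\<lambda>n. Z n \<omega>) \<longlonglongrightarrow> Y \<omega>"
    and excess: "\<And>\<epsilon>. 0 < \<epsilon> \<Longrightarrow> \<exists>c\<ge>0. \<forall>n. excess M c (Z n) \<le> \<epsilon>"
  shows "integrable M Y"
    and "A \<in> sets M \<Longrightarrow> (\<lambda>n. integral_on M A (Z n)) \<longlonglongrightarrow> integral_on M A Y"
    and "(\<And>n. excess M c (Z n) \<le> e) \<Longrightarrow> 0 \<le> e \<Longrightarrow> excess M c Y \<le> e"
proof -
  interpret finite_measure M by fact
  note [measurable] = borel_measurable_integrable[OF assms(2)] assms(3)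
  have intZ: "integrable M (\<lambda>\<omega>. max 0 (\<bar>Z n \<omega>\<bar> - c))" for n c
    using assms(2)[of n] by (intro integrable_max Bochner_Integration.integrable_diff integrable_abs) auto
  have fatou: "(\<integral>\<^sup>+\<omega>. ennreal (max 0 (\<bar>Y \<omega>\<bar> - c)) \<partial>M) \<le> ennreal e"
    if "\<And>n. excess M c (Z n) \<le> e" for c e
  proof -
    have "(\<integral>\<^sup>+\<omega>. ennreal (max 0 (\<bar>Y \<omega>\<bar> - c)) \<partial>M) = (\<integral>\<^sup>+\<omega>. liminf (\<lambda>n. ennreal (max 0 (\<bar>Z n \<omega>\<bar> - c))) \<partial>M)"
    proof (rule nn_integral_cong_AE)
      from lim show "AE \<omega> in M. ennreal (max 0 (\<bar>Y \<omega>\<bar> - c)) = liminf (\<lambda>n. ennreal (max 0 (\<bar>Z n \<omega>\<bar> - c)))"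
      proof eventually_elim
        case (elim \<omega>)
        then have "(\<lambda>n. ennreal (max 0 (\<bar>Z n \<omega>\<bar> - c))) \<longlonglongrightarrow> ennreal (max 0 (\<bar>Y \<omega>\<bar> - c))"
          by (intro tendsto_ennrealI tendsto_max tendsto_const tendsto_diff tendsto_rabs)
        then show ?case by (simp add: tendsto_iff_Liminf_eq_Limsup)
      qed
    qed
    also have "\<dots> \<le> liminf (\<lambda>n. (\<integral>\<^sup>+\<omega>. ennreal (max 0 (\<bar>Z n \<omega>\<bar> - c)) \<partial>M))"
      by (rule nn_integral_liminf) measurable
    also have "\<dots> = liminf (\<lambda>n. ennreal (excess M c (Z n)))"
      by (subst nn_integral_eq_integral[OF intZ]) simp_all
    also have "\<dots> \<le> ennreal e"
      using that by (intro Liminf_le always_eventually allI ennreal_leI) auto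
    finally show ?thesis .
  qed
  show int: "integrable M Y"
  proof (rule integrableI_bounded)
    obtain c where c: "c \<ge> 0" "\<And>n. excess M c (Z n) \<le> 1" using excess[of 1] by auto
    have "(\<integral>\<^sup>+\<omega>. ennreal (norm (Y \<omega>)) \<partial>M) \<le> (\<integral>\<^sup>+\<omega>. ennreal (max 0 (\<bar>Y \<omega>\<bar> - c)) + ennreal c \<partial>M)"
    proof (rule nn_integral_mono)
      fix \<omega>
      have "ennreal (norm (Y \<omega>)) \<le> ennreal (max 0 (\<bar>Y \<omega>\<bar> - c) + c)" by (rule ennreal_leI) auto
      also have "\<dots> = ennreal (max 0 (\<bar>Y \<omega>\<bar> - c)) + ennreal c" using c(1) by (intro ennreal_plus) auto
      finally show "ennreal (norm (Y \<omega>)) \<le> ennreal (max 0 (\<bar>Y \<omega>\<bar> - c)) + ennreal c" .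
    qed
    also have "\<dots> = (\<integral>\<^sup>+\<omega>. ennreal (max 0 (\<bar>Y \<omega>\<bar> - c)) \<partial>M) + ennreal c * emeasure M (space M)"
      by (simp add: nn_integral_add)
    also have "\<dots> \<le> ennreal 1 + ennreal c * emeasure M (space M)"
      using fatou[OF c(2)] by (intro add_mono) auto
    also have "\<dots> < \<infinity>" by (simp add: ennreal_mult_less_top emeasure_eq_measure)
    finally show "(\<integral>\<^sup>+\<omega>. ennreal (norm (Y \<omega>)) \<partial>M) < \<infinity>" .
  qed simp
  have intY: "integrable M (\<lambda>\<omega>. max 0 (\<bar>Y \<omega>\<bar> - c))" for c
    using int by (intro integrable_max Bochner_Integration.integrable_diff integrable_abs) auto
  show excY: "excess M c Y \<le> e"
    if "\<And>n. excess M c (Z n) \<le> e" "0 \<le> e" for c e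
    using fatou[OF that(1)] that(2) by (subst (asm) nn_integral_eq_integral[OF intY]) simp_all
  assume A [measurable]: "A \<in> sets M"
  let ?tr = "\<lambda>c x::real. max (- c) (min c x)"
  show "(\<lambda>n. integral_on M A (Z n)) \<longlonglongrightarrow> integral_on M A Y"
  proof (rule LIMSEQ_I)
    fix r :: real assume r: "0 < r"
    obtain c where c: "c \<ge> 0" "\<And>n. excess M c (Z n) \<le> r / 4" using excess[of "r/4"] r by auto
    have near: "\<bar>integral_on M A W - integral_on M A (\<lambda>\<omega>. ?tr c (W \<omega>))\<bar> \<le> r / 4"
      if W: "integrable M W" "excess M c W \<le> r / 4" for W
    proof -
      note [measurable] = borel_measurable_integrable[OF W(1)]
      have 1: "integrable M (\<lambda>\<omega>. indicator A \<omega> * W \<omega>)" using integrable_mult_indicator[OF A W(1)] by simp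
      have 2: "integrable M (\<lambda>\<omega>. indicator A \<omega> * ?tr c (W \<omega>))"
        using W(1) by (rule Bochner_Integration.integrable_bound) (use c(1) in \<open>auto simp: indicator_def\<close>)
      have "\<bar>integral_on M A W - integral_on M A (\<lambda>\<omega>. ?tr c (W \<omega>))\<bar>
          = \<bar>\<integral>\<omega>. indicator A \<omega> * W \<omega> - indicator A \<omega> * ?tr c (W \<omega>) \<partial>M\<bar>"
        using 1 2 by simp
      also have "\<dots> \<le> (\<integral>\<omega>. \<bar>indicator A \<omega> * W \<omega> - indicator A \<omega> * ?tr c (W \<omega>)\<bar> \<partial>M)"
        by (rule integral_abs_bound)
      also have "\<dots> \<le> excess M c W"
      proof (rule integral_mono)
        show "integrable M (\<lambda>\<omega>. max 0 (\<bar>W \<omega>\<bar> - c))"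
          using W(1) by (intro integrable_max Bochner_Integration.integrable_diff integrable_abs) auto
      qed (use 1 2 c(1) in \<open>auto simp: indicator_def\<close>)
      finally show ?thesis using W(2) by simp
    qed
    have "(\<lambda>n. integral_on M A (\<lambda>\<omega>. ?tr c (Z n \<omega>))) \<longlonglongrightarrow> integral_on M A (\<lambda>\<omega>. ?tr c (Y \<omega>))"
    proof (rule integral_dominated_convergence[where w="\<lambda>_. c"])
      from lim show "AE \<omega> in M. (\<lambda>n. indicator A \<omega> * ?tr c (Z n \<omega>)) \<longlonglongrightarrow> indicator A \<omega> * ?tr c (Y \<omega>)"
        by eventually_elim (intro tendsto_intros)
    qed (use c(1) in \<open>auto simp: indicator_def\<close>)
    from LIMSEQ_D[OF this, of "r/4"] r obtain n0 where n0: "\<And>n. n \<ge> n0 \<Longrightarrow>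
        \<bar>integral_on M A (\<lambda>\<omega>. ?tr c (Z n \<omega>)) - integral_on M A (\<lambda>\<omega>. ?tr c (Y \<omega>))\<bar> < r / 4"
      by auto
    have "norm (integral_on M A (Z n) - integral_on M A Y) < r" if "n \<ge> n0" for n
      using n0[OF that] near[OF assms(2) c(2), of n] near[OF int excY[OF c(2)]] r unfolding real_norm_def by linarith
    then show "\<exists>n0. \<forall>n\<ge>n0. norm (integral_on M A (Z n) - integral_on M A Y) < r"
      by blast
  qed
qed

lemma excess_tendsto_zero:
  fixes Z :: "'a \<Rightarrow> real"
  assumes "integrable M Z" "0 < \<epsilon>"
  shows "\<exists>c\<ge>0. excess M c Z \<le> \<epsilon>"
proof -
  note [measurable] = borel_measurable_integrable[OF assms(1)]
  have "(\<lambda>n. excess M (real n) Z) \<longlonglongrightarrow> (\<integral>\<omega>. 0 \<partial>M)"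
  proof (rule integral_dominated_convergence[where w="\<lambda>\<omega>. \<bar>Z \<omega>\<bar>"])
    show "AE \<omega> in M. (\<lambda>n. max 0 (\<bar>Z \<omega>\<bar> - real n)) \<longlonglongrightarrow> 0"
    proof (rule AE_I2)
      fix \<omega>
      obtain n0 where n0: "\<bar>Z \<omega>\<bar> \<le> real n0" using real_arch_simple by blast
      then have "\<forall>\<^sub>F n in sequentially. max 0 (\<bar>Z \<omega>\<bar> - real n) = 0"
        by (intro eventually_sequentiallyI[of n0]) auto
      then show "(\<lambda>n. max 0 (\<bar>Z \<omega>\<bar> - real n)) \<longlonglongrightarrow> 0" by (rule tendsto_eventually)
    qed
  qed (use assms in auto)
  then have "\<forall>\<^sub>F n in sequentially. excess M (real n) Z < \<epsilon>"
    using assms(2) by (auto dest: order_tendstoD)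
  then obtain n where "excess M (real n) Z < \<epsilon>"
    by (meson eventually_happens trivial_limit_sequentially)
  then show ?thesis by (intro exI[of _ "real n"]) simp
qed

context usual_filtered_prob_space
begin

lemma martingale_int:
  assumes "martingale P F Y" "0 \<le> s" "s \<le> t" "A \<in> sets (F s)"
  shows "integral_on P A (Y s) = integral_on P A (Y t)"
proof -
  interpret sigma_finite_subalgebra P "F s" by (rule F_sigma_finite_subalgebra)
  have int: "integrable P (Y t)" and ae: "AE \<omega> in P. real_cond_exp P (F s) (Y t) \<omega> = Y s \<omega>"
    using assms by (auto simp: martingale_def)
  note [measurable] = F_sub[OF assms(4)]
  have "Y s \<in> borel_measurable (F s)" using assms by (auto simp: martingale_def adapted_def)
  then have [measurable]: "Y s \<in> borel_measurable P" by (rule measurable_F_P)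
  have "integral_on P A (Y t) = integral_on P A (real_cond_exp P (F s) (Y t))"
    using real_cond_exp_intA[OF int assms(4)] by (simp add: set_lebesgue_integral_def)
  also have "\<dots> = integral_on P A (Y s)"
    using ae by (intro integral_cong_AE) auto
  finally show ?thesis ..
qed

lemma martingaleI:
  assumes "adapted F Y" "\<And>t. 0 \<le> t \<Longrightarrow> integrable P (Y t)"
    and "\<And>s t A. 0 \<le> s \<Longrightarrow> s \<le> t \<Longrightarrow> A \<in> sets (F s) \<Longrightarrow>
      integral_on P A (Y t) = integral_on P A (Y s)"
  shows "martingale P F Y"
  unfolding martingale_def
proof (intro conjI allI impI)
  fix s t :: real assume st: "0 \<le> s" "s \<le> t"
  interpret sigma_finite_subalgebra P "F s" by (rule F_sigma_finite_subalgebra)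
  show "AE \<omega> in P. real_cond_exp P (F s) (Y t) \<omega> = Y s \<omega>"
  proof (rule real_cond_exp_charact)
    fix A assume "A \<in> sets (F s)"
    from assms(3)[OF st this] show "(\<integral>\<omega>\<in>A. Y t \<omega> \<partial>P) = (\<integral>\<omega>\<in>A. Y s \<omega> \<partial>P)"
      by (simp add: set_lebesgue_integral_def)
  next
    show "Y s \<in> borel_measurable (F s)" using assms(1) st by (simp add: adapted_def)
    show "integrable P (Y t)" "integrable P (Y s)" using assms(2) st by simp_all
  qed
qed (use assms(1,2) in auto)

lemma simple_stop_measurable:
  fixes \<kappa> :: "'a \<Rightarrow> real"
  assumes "adapted F Y" "finite G" "\<And>g. g \<in> G \<Longrightarrow> 0 \<le> g \<and> g \<le> t"
    and "\<And>\<omega>. \<omega> \<in> space P \<Longrightarrow> \<kappa> \<omega> \<in> G"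
    and "\<And>g. g \<in> G \<Longrightarrow> {\<omega>\<in>space P. \<kappa> \<omega> = g} \<in> sets (F g)"
  shows "(\<lambda>\<omega>. Y (\<kappa> \<omega>) \<omega>) \<in> borel_measurable (F t)"
proof -
  have "(\<lambda>\<omega>. \<Sum>g\<in>G. indicator {\<omega>\<in>space P. \<kappa> \<omega> = g} \<omega> * Y g \<omega>) \<in> borel_measurable (F t)"
  proof (rule borel_measurable_sum)
    fix g assume g: "g \<in> G"
    then have g': "0 \<le> g" "g \<le> t" using assms(3) by auto
    then have "Y g \<in> borel_measurable (F t)"
      using assms(1) by (intro measurable_F_mono[of g t]) (simp_all add: adapted_def)
    moreover have "{\<omega>\<in>space P. \<kappa> \<omega> = g} \<in> sets (F t)"
      using F_mono[OF g'(2) assms(5)[OF g]] .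
    ultimately show "(\<lambda>\<omega>. indicator {\<omega>\<in>space P. \<kappa> \<omega> = g} \<omega> * Y g \<omega>) \<in> borel_measurable (F t)"
      by (intro borel_measurable_times borel_measurable_indicator)
  qed
  also have "?this \<longleftrightarrow> ?thesis"
  proof (rule measurable_cong)
    fix \<omega> assume "\<omega> \<in> space (F t)"
    then have w: "\<omega> \<in> space P" by (simp add: space_F)
    then have "(\<Sum>g\<in>G. indicator {\<omega>\<in>space P. \<kappa> \<omega> = g} \<omega> * Y g \<omega>) = (\<Sum>g\<in>G. if g = \<kappa> \<omega> then Y g \<omega> else 0)"
      by (intro sum.cong) auto
    also have "\<dots> = Y (\<kappa> \<omega>) \<omega>"
      using assms(2) assms(4)[OF w] by (simp only: sum.delta if_True)
    finally show "(\<Sum>g\<in>G. indicator {\<omega>\<in>space P. \<kappa> \<omega> = g} \<omega> * Y g \<omega>) = Y (\<kappa> \<omega>) \<omega>" .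
  qed
  finally show ?thesis .
qed

text \<open>
  A stopping time with finitely many values \<open>g\<close> splits every event \<open>B\<close> that is known when it stops
  into the pieces \<open>B \<inter> {\<kappa> = g}\<close>, each of them known at the deterministic time \<open>g\<close>.
\<close>

lemma simple_stop_int:
  fixes \<kappa> :: "'a \<Rightarrow> real"
  assumes Y: "martingale P F Y" and G: "finite G" "\<And>g. g \<in> G \<Longrightarrow> 0 \<le> g \<and> g \<le> t"
    and \<kappa>: "\<And>\<omega>. \<omega> \<in> space P \<Longrightarrow> \<kappa> \<omega> \<in> G"
    and t: "0 \<le> t"
  shows "(\<And>g. g \<in> G \<Longrightarrow> {\<omega>\<in>space P. \<kappa> \<omega> = g} \<in> sets (F g)) \<Longrightarrow> integrable P (\<lambda>\<omega>. Y (\<kappa> \<omega>) \<omega>)"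
    and "(\<And>g. g \<in> G \<Longrightarrow> {\<omega>\<in>space P. \<kappa> \<omega> = g} \<in> sets (F g)) \<Longrightarrow>
      (\<And>g. g \<in> G \<Longrightarrow> {\<omega>\<in>B. \<kappa> \<omega> = g} \<in> sets (F g)) \<Longrightarrow> B \<subseteq> space P \<Longrightarrow>
      integral_on P B (\<lambda>\<omega>. Y (\<kappa> \<omega>) \<omega>) = integral_on P B (Y t)"
proof -
  have int: "integrable P (Y g)" if "g \<in> G" for g using that Y G by (auto simp: martingale_def)
  have intt: "integrable P (Y t)" using t Y by (auto simp: martingale_def)
  have intB: "integrable P (\<lambda>\<omega>. indicator {\<omega>\<in>B. \<kappa> \<omega> = g} \<omega> * Y h \<omega>)"
    if "{\<omega>\<in>B. \<kappa> \<omega> = g} \<in> sets (F g)" "integrable P (Y h)" for g h B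
    using integrable_mult_indicator[OF F_sub[OF that(1)] that(2)] by simp
  have dec: "indicator B \<omega> * Y (\<kappa> \<omega>) \<omega> = (\<Sum>g\<in>G. indicator {\<omega>\<in>B. \<kappa> \<omega> = g} \<omega> * Y g \<omega>)"
    "indicator B \<omega> * Y t \<omega> = (\<Sum>g\<in>G. indicator {\<omega>\<in>B. \<kappa> \<omega> = g} \<omega> * Y t \<omega>)"
    if w: "\<omega> \<in> space P" for \<omega> B
  proof -
    have "(\<Sum>g\<in>G. indicator {\<omega>\<in>B. \<kappa> \<omega> = g} \<omega> * Y g \<omega>) = (\<Sum>g\<in>G. if g = \<kappa> \<omega> then indicator B \<omega> * Y g \<omega> else 0)"
      "(\<Sum>g\<in>G. indicator {\<omega>\<in>B. \<kappa> \<omega> = g} \<omega> * Y t \<omega>) = (\<Sum>g\<in>G. if g = \<kappa> \<omega> then indicator B \<omega> * Y t \<omega> else 0)"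
      by (auto intro!: sum.cong simp: indicator_def)
    then show "indicator B \<omega> * Y (\<kappa> \<omega>) \<omega> = (\<Sum>g\<in>G. indicator {\<omega>\<in>B. \<kappa> \<omega> = g} \<omega> * Y g \<omega>)"
      "indicator B \<omega> * Y t \<omega> = (\<Sum>g\<in>G. indicator {\<omega>\<in>B. \<kappa> \<omega> = g} \<omega> * Y t \<omega>)"
      using G(1) \<kappa>[OF w] by (simp_all only: sum.delta if_True)
  qed
  show "integrable P (\<lambda>\<omega>. Y (\<kappa> \<omega>) \<omega>)" if *: "\<And>g. g \<in> G \<Longrightarrow> {\<omega>\<in>space P. \<kappa> \<omega> = g} \<in> sets (F g)"
  proof -
    have "integrable P (\<lambda>\<omega>. \<Sum>g\<in>G. indicator {\<omega>\<in>space P. \<kappa> \<omega> = g} \<omega> * Y g \<omega>)"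
      using intB[of "space P"] * int by (intro Bochner_Integration.integrable_sum) auto
    also have "?this \<longleftrightarrow> integrable P (\<lambda>\<omega>. indicator (space P) \<omega> * Y (\<kappa> \<omega>) \<omega>)"
      by (rule Bochner_Integration.integrable_cong[OF refl dec(1)[symmetric]])
    also have "\<dots> \<longleftrightarrow> ?thesis"
      by (rule Bochner_Integration.integrable_cong) auto
    finally show ?thesis .
  qed
  show "integral_on P B (\<lambda>\<omega>. Y (\<kappa> \<omega>) \<omega>) = integral_on P B (Y t)"
    if *: "\<And>g. g \<in> G \<Longrightarrow> {\<omega>\<in>B. \<kappa> \<omega> = g} \<in> sets (F g)"
  proof -
    have "integral_on P B (\<lambda>\<omega>. Y (\<kappa> \<omega>) \<omega>) = (\<integral>\<omega>. (\<Sum>g\<in>G. indicator {\<omega>\<in>B. \<kappa> \<omega> = g} \<omega> * Y g \<omega>) \<partial>P)"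
      by (intro Bochner_Integration.integral_cong refl dec)
    also have "\<dots> = (\<Sum>g\<in>G. \<integral>\<omega>. indicator {\<omega>\<in>B. \<kappa> \<omega> = g} \<omega> * Y g \<omega> \<partial>P)"
      using intB * int by (intro Bochner_Integration.integral_sum) auto
    also have "\<dots> = (\<Sum>g\<in>G. \<integral>\<omega>. indicator {\<omega>\<in>B. \<kappa> \<omega> = g} \<omega> * Y t \<omega> \<partial>P)"
      using * G by (intro sum.cong refl martingale_int[OF Y]) auto
    also have "\<dots> = (\<integral>\<omega>. (\<Sum>g\<in>G. indicator {\<omega>\<in>B. \<kappa> \<omega> = g} \<omega> * Y t \<omega>) \<partial>P)"
      using intB * intt by (intro Bochner_Integration.integral_sum[symmetric]) auto
    also have "\<dots> = integral_on P B (Y t)"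
      by (intro Bochner_Integration.integral_cong refl dec(2)[symmetric])
    finally show ?thesis .
  qed
qed

end

section \<open>Optional stopping in continuous time\<close>

lemma tmin_le_iff: "0 \<le> q \<Longrightarrow> q < t \<Longrightarrow> tmin t a \<le> q \<longleftrightarrow> a \<le> ennreal q"
  by (cases a) (auto simp: tmin_real top_unique)

context usual_filtered_prob_space
begin

text \<open>
  Rounding \<open>\<rho>\<close> up to multiples of \<open>1 / (m + 1)\<close> and clipping to \<open>[s, t]\<close> gives stopping times with
  finitely many values.  They approach from above, which is what right-continuity of paths needs.
\<close>

lemma stop_grid:
  assumes \<rho>: "stop_time F \<rho>" and st: "0 \<le> s" "s \<le> t"
  obtains G :: "nat \<Rightarrow> real set" and \<kappa> :: "nat \<Rightarrow> 'a \<Rightarrow> real"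
  where "\<forall>m. finite (G m)" "\<forall>m. \<forall>g\<in>G m. s \<le> g \<and> g \<le> t"
    "\<forall>m. \<forall>\<omega>\<in>space P. \<kappa> m \<omega> \<in> G m"
    "\<forall>m. \<forall>g\<in>G m. {\<omega>\<in>space P. \<kappa> m \<omega> = g} \<in> sets (F g)"
    "\<forall>m \<omega>. max s (tmin t (\<rho> \<omega>)) \<le> \<kappa> m \<omega>"
    "\<forall>\<omega>. (\<lambda>m. \<kappa> m \<omega>) \<longlonglongrightarrow> max s (tmin t (\<rho> \<omega>))"
proof -
  have t: "0 \<le> t" using st by simp
  define \<kappa> where "\<kappa> m \<omega> = min t (max s (\<lceil>real (Suc m) * tmin t (\<rho> \<omega>)\<rceil> / real (Suc m)))" for m \<omega>
  define G where "G m = (\<lambda>i. min t (max s (real_of_int i / real (Suc m)))) ` {0..\<lceil>real (Suc m) * t\<rceil>}" for m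
  have fin: "finite (G m)" for m by (simp add: G_def)
  have rng: "s \<le> g \<and> g \<le> t" if "g \<in> G m" for g m using that st by (auto simp: G_def)
  have in_G: "\<kappa> m \<omega> \<in> G m" for m \<omega>
  proof -
    have "0 \<le> real (Suc m) * tmin t (\<rho> \<omega>)" by simp
    moreover have "real (Suc m) * tmin t (\<rho> \<omega>) \<le> real (Suc m) * t"
      using tmin_le[OF t] by (intro mult_left_mono) auto
    ultimately have "\<lceil>real (Suc m) * tmin t (\<rho> \<omega>)\<rceil> \<in> {0..\<lceil>real (Suc m) * t\<rceil>}"
      using ceiling_mono[of 0 "real (Suc m) * tmin t (\<rho> \<omega>)"] by (auto intro: ceiling_mono)
    then show ?thesis unfolding G_def \<kappa>_def by blast
  qed
  have le: "{\<omega>\<in>space P. \<kappa> m \<omega> \<le> g} \<in> sets (F g)" if g: "s \<le> g" for m g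
  proof (cases "t \<le> g")
    case True
    then have "{\<omega>\<in>space P. \<kappa> m \<omega> \<le> g} = space (F g)" by (auto simp: \<kappa>_def space_F)
    then show ?thesis by simp
  next
    case False
    define N where "N = real (Suc m)"
    have N: "0 < N" by (simp add: N_def)
    define q where "q = \<lfloor>N * g\<rfloor> / N"
    have "real_of_int \<lfloor>N * g\<rfloor> \<le> N * g" by simp
    then have q: "0 \<le> q" "q \<le> g" using N g st by (auto simp: q_def field_simps)
    have "\<kappa> m \<omega> \<le> g \<longleftrightarrow> \<rho> \<omega> \<le> ennreal q" for \<omega>
    proof -
      have "\<kappa> m \<omega> \<le> g \<longleftrightarrow> \<lceil>N * tmin t (\<rho> \<omega>)\<rceil> / N \<le> g"
        using False g by (auto simp: \<kappa>_def N_def min_le_iff_disj)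
      also have "\<dots> \<longleftrightarrow> real_of_int \<lceil>N * tmin t (\<rho> \<omega>)\<rceil> \<le> N * g" using N by (simp add: field_simps)
      also have "\<dots> \<longleftrightarrow> \<lceil>N * tmin t (\<rho> \<omega>)\<rceil> \<le> \<lfloor>N * g\<rfloor>" by (simp add: le_floor_iff)
      also have "\<dots> \<longleftrightarrow> N * tmin t (\<rho> \<omega>) \<le> real_of_int \<lfloor>N * g\<rfloor>" by (simp add: ceiling_le_iff)
      also have "\<dots> \<longleftrightarrow> tmin t (\<rho> \<omega>) \<le> q" using N by (simp add: q_def field_simps)
      also have "\<dots> \<longleftrightarrow> \<rho> \<omega> \<le> ennreal q" using q False by (intro tmin_le_iff) auto
      finally show ?thesis .
    qed
    then have "{\<omega>\<in>space P. \<kappa> m \<omega> \<le> g} = {\<omega>\<in>space P. \<rho> \<omega> \<le> ennreal q}" by simp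
    then show ?thesis using F_mono[OF q(2) stop_le[OF \<rho> q(1)]] by simp
  qed
  show ?thesis
  proof (rule that[of G \<kappa>]; intro allI ballI)
    fix m g assume g: "g \<in> G m"
    have "{\<omega>\<in>space P. \<kappa> m \<omega> = g} = {\<omega>\<in>space P. \<kappa> m \<omega> \<le> g} - (\<Union>h\<in>{h\<in>G m. h < g}. {\<omega>\<in>space P. \<kappa> m \<omega> \<le> h})"
    proof (intro set_eqI iffI)
      fix \<omega> assume "\<omega> \<in> {\<omega>\<in>space P. \<kappa> m \<omega> \<le> g} - (\<Union>h\<in>{h\<in>G m. h < g}. {\<omega>\<in>space P. \<kappa> m \<omega> \<le> h})"
      then have "\<omega> \<in> space P" "\<kappa> m \<omega> \<le> g" "\<not> \<kappa> m \<omega> < g" using in_G[of m \<omega>] by auto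
      then show "\<omega> \<in> {\<omega>\<in>space P. \<kappa> m \<omega> = g}" by simp
    qed auto
    also have "\<dots> \<in> sets (F g)"
    proof (intro sets.Diff sets.finite_UN)
      fix h assume "h \<in> {h\<in>G m. h < g}"
      then show "{\<omega>\<in>space P. \<kappa> m \<omega> \<le> h} \<in> sets (F g)"
        using rng[of h m] by (intro F_mono[OF _ le]) auto
    qed (use le rng[OF g] fin in auto)
    finally show "{\<omega>\<in>space P. \<kappa> m \<omega> = g} \<in> sets (F g)" .
  next
    fix m \<omega>
    have "tmin t (\<rho> \<omega>) \<le> \<lceil>real (Suc m) * tmin t (\<rho> \<omega>)\<rceil> / real (Suc m)" by (simp add: field_simps)
    then show "max s (tmin t (\<rho> \<omega>)) \<le> \<kappa> m \<omega>" using st tmin_le[OF t, of "\<rho> \<omega>"] by (auto simp: \<kappa>_def)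
  next
    fix \<omega>
    have "(\<lambda>m. \<kappa> m \<omega>) \<longlonglongrightarrow> min t (max s (tmin t (\<rho> \<omega>)))"
      unfolding \<kappa>_def by (intro tendsto_min tendsto_max tendsto_const LIMSEQ_ceiling_grid)
    then show "(\<lambda>m. \<kappa> m \<omega>) \<longlonglongrightarrow> max s (tmin t (\<rho> \<omega>))"
      using st tmin_le[OF t, of "\<rho> \<omega>"] by (simp add: min_absorb2)
  qed (use fin rng in_G in auto)
qed

lemma stopped_measurable:
  assumes "adapted F Y" "\<And>\<omega>. \<omega> \<in> space P \<Longrightarrow> right_continuous_path (\<lambda>t. Y t \<omega>)" "stop_time F \<rho>" "0 \<le> t"
  shows "(\<lambda>\<omega>. Y (tmin t (\<rho> \<omega>)) \<omega>) \<in> borel_measurable (F t)"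
proof -
  obtain G :: "nat \<Rightarrow> real set" and \<kappa> :: "nat \<Rightarrow> 'a \<Rightarrow> real"
    where "\<forall>m. finite (G m)" "\<forall>m. \<forall>g\<in>G m. 0 \<le> g \<and> g \<le> t"
      "\<forall>m. \<forall>\<omega>\<in>space P. \<kappa> m \<omega> \<in> G m"
      "\<forall>m. \<forall>g\<in>G m. {\<omega>\<in>space P. \<kappa> m \<omega> = g} \<in> sets (F g)"
      "\<forall>m \<omega>. max 0 (tmin t (\<rho> \<omega>)) \<le> \<kappa> m \<omega>"
      "\<forall>\<omega>. (\<lambda>m. \<kappa> m \<omega>) \<longlonglongrightarrow> max 0 (tmin t (\<rho> \<omega>))"
    by (rule stop_grid[OF assms(3) order_refl assms(4)]) (rule that)
  note G = this(1,2)[rule_format] and \<kappa> = this(3-6)[rule_format]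
  show ?thesis
  proof (rule borel_measurable_LIMSEQ_metric[where f="\<lambda>m \<omega>. Y (\<kappa> m \<omega>) \<omega>"])
    show "(\<lambda>\<omega>. Y (\<kappa> m \<omega>) \<omega>) \<in> borel_measurable (F t)" for m
      by (rule simple_stop_measurable[OF assms(1) G \<kappa>(1,2)])
    fix \<omega> assume "\<omega> \<in> space (F t)"
    then show "(\<lambda>m. Y (\<kappa> m \<omega>) \<omega>) \<longlonglongrightarrow> Y (tmin t (\<rho> \<omega>)) \<omega>"
      using \<kappa>(3)[of \<omega>] \<kappa>(4)[of \<omega>] assms(2)[of \<omega>]
      by (intro right_continuous_path_LIMSEQ[where f="\<lambda>t. Y t \<omega>" and x="\<lambda>m. \<kappa> m \<omega>" and t="tmin t (\<rho> \<omega>)"])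
        (auto simp: space_F max_absorb2)
  qed
qed

lemma adapted_stopped:
  assumes "adapted F Y" "\<And>\<omega>. \<omega> \<in> space P \<Longrightarrow> right_continuous_path (\<lambda>t. Y t \<omega>)" "stop_time F \<rho>"
  shows "adapted F (\<lambda>t \<omega>. Y (tmin t (\<rho> \<omega>)) \<omega>)"
  using stopped_measurable[OF assms] by (simp add: adapted_def)

text \<open>
  Optional sampling for the time \<open>max s (\<rho> \<and> t)\<close>, which never stops before \<open>s\<close>.  The identities for
  finitely many values pass to the limit because the sampled variables have uniformly small excess.
\<close>

lemma stop_after:
  assumes Y: "martingale P F Y" and rc: "\<And>\<omega>. \<omega> \<in> space P \<Longrightarrow> right_continuous_path (\<lambda>t. Y t \<omega>)"
    and \<rho>: "stop_time F \<rho>" and st: "0 \<le> s" "s \<le> t"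
  defines "Z \<equiv> \<lambda>\<omega>. Y (max s (tmin t (\<rho> \<omega>))) \<omega>"
  shows "integrable P Z"
    and "A \<in> sets (F s) \<Longrightarrow> integral_on P A Z = integral_on P A (Y t)"
    and "0 \<le> c \<Longrightarrow> excess P c Z \<le> excess P c (Y t)"
proof -
  have t: "0 \<le> t" using st by simp
  have ad: "adapted F Y" and intt: "integrable P (Y t)" using Y t by (auto simp: martingale_def)
  obtain G :: "nat \<Rightarrow> real set" and \<kappa> :: "nat \<Rightarrow> 'a \<Rightarrow> real"
    where "\<forall>m. finite (G m)" "\<forall>m. \<forall>g\<in>G m. s \<le> g \<and> g \<le> t"
      "\<forall>m. \<forall>\<omega>\<in>space P. \<kappa> m \<omega> \<in> G m"
      "\<forall>m. \<forall>g\<in>G m. {\<omega>\<in>space P. \<kappa> m \<omega> = g} \<in> sets (F g)"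
      "\<forall>m \<omega>. max s (tmin t (\<rho> \<omega>)) \<le> \<kappa> m \<omega>"
      "\<forall>\<omega>. (\<lambda>m. \<kappa> m \<omega>) \<longlonglongrightarrow> max s (tmin t (\<rho> \<omega>))"
    by (rule stop_grid[OF \<rho> st]) (rule that)
  note G = this(1,2)[rule_format] and \<kappa> = this(3-6)[rule_format]
  have G0: "0 \<le> g \<and> g \<le> t" if "g \<in> G m" for g m using G(2)[OF that] st by auto
  have int: "integrable P (\<lambda>\<omega>. Y (\<kappa> m \<omega>) \<omega>)" for m
    by (rule simple_stop_int(1)[OF Y G(1) G0 \<kappa>(1) t \<kappa>(2)])
  have intB: "integral_on P B (\<lambda>\<omega>. Y (\<kappa> m \<omega>) \<omega>) = integral_on P B (Y t)"
    if "\<And>g. g \<in> G m \<Longrightarrow> {\<omega>\<in>B. \<kappa> m \<omega> = g} \<in> sets (F g)" "B \<subseteq> space P" for m B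
    by (rule simple_stop_int(2)[OF Y G(1) G0 \<kappa>(1) t \<kappa>(2) that])
  have ex: "excess P c (\<lambda>\<omega>. Y (\<kappa> m \<omega>) \<omega>) \<le> excess P c (Y t)" if c: "0 \<le> c" for m c
  proof (rule excess_bound[OF int intt c _ _ finite_measure_axioms])
    have meas: "{\<omega>\<in>{\<omega>\<in>space P. Q (Y (\<kappa> m \<omega>) \<omega>)}. \<kappa> m \<omega> = g} \<in> sets (F g)"
      if g: "g \<in> G m" and [measurable]: "Measurable.pred borel Q" for g Q
    proof -
      have [measurable]: "Y g \<in> borel_measurable (F g)" using ad G0[OF g] by (simp add: adapted_def)
      have "{\<omega>\<in>{\<omega>\<in>space P. Q (Y (\<kappa> m \<omega>) \<omega>)}. \<kappa> m \<omega> = g} = {\<omega>\<in>space P. \<kappa> m \<omega> = g} \<inter> {\<omega>\<in>space (F g). Q (Y g \<omega>)}"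
        by (auto simp: space_F)
      also have "\<dots> \<in> sets (F g)" by (intro sets.Int \<kappa>(2) g) measurable
      finally show ?thesis .
    qed
    show "integral_on P {\<omega>\<in>space P. c < Y (\<kappa> m \<omega>) \<omega>} (\<lambda>\<omega>. Y (\<kappa> m \<omega>) \<omega>)
        = integral_on P {\<omega>\<in>space P. c < Y (\<kappa> m \<omega>) \<omega>} (Y t)"
      by (rule intB[OF meas]) auto
    show "integral_on P {\<omega>\<in>space P. Y (\<kappa> m \<omega>) \<omega> < - c} (\<lambda>\<omega>. Y (\<kappa> m \<omega>) \<omega>)
        = integral_on P {\<omega>\<in>space P. Y (\<kappa> m \<omega>) \<omega> < - c} (Y t)"
      by (rule intB[OF meas]) auto
  qed
  have unif: "\<exists>c\<ge>0. \<forall>m. excess P c (\<lambda>\<omega>. Y (\<kappa> m \<omega>) \<omega>) \<le> \<epsilon>" if "0 < \<epsilon>" for \<epsilon>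
    using excess_tendsto_zero[OF intt that] ex by (meson order_trans)
  have lim: "(\<lambda>m. Y (\<kappa> m \<omega>) \<omega>) \<longlonglongrightarrow> Z \<omega>" if "\<omega> \<in> space P" for \<omega>
    unfolding Z_def
    using \<kappa>(3)[of \<omega>] \<kappa>(4)[of \<omega>] rc[OF that] st(1)
    by (intro right_continuous_path_LIMSEQ[where f="\<lambda>t. Y t \<omega>" and x="\<lambda>m. \<kappa> m \<omega>" and t="max s (tmin t (\<rho> \<omega>))"]) auto
  have Zm: "Z \<in> borel_measurable P"
    by (rule borel_measurable_LIMSEQ_metric[OF borel_measurable_integrable[OF int] lim])
  note L = uniform_excess_limit[OF finite_measure_axioms int Zm AE_I2[OF lim] unif]
  show "integrable P Z" by (rule L(1))
  show "excess P c Z \<le> excess P c (Y t)" if "0 \<le> c"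
    using L(3)[OF _ _ ex[OF that]] by simp
  assume A: "A \<in> sets (F s)"
  have eq: "integral_on P A (\<lambda>\<omega>. Y (\<kappa> m \<omega>) \<omega>) = integral_on P A (Y t)" for m
  proof (rule intB)
    fix g assume g: "g \<in> G m"
    have "{\<omega>\<in>A. \<kappa> m \<omega> = g} = A \<inter> {\<omega>\<in>space P. \<kappa> m \<omega> = g}"
      using sets.sets_into_space[OF A] by (auto simp: space_F)
    then show "{\<omega>\<in>A. \<kappa> m \<omega> = g} \<in> sets (F g)"
      using \<kappa>(2)[OF g] F_mono[OF _ A, of g] G(2)[OF g] by auto
  qed (use sets.sets_into_space[OF A] in \<open>auto simp: space_F\<close>)
  show "integral_on P A Z = integral_on P A (Y t)"
    using L(2)[OF _ _ F_sub[OF A]] unfolding eq by (simp add: LIMSEQ_const_iff)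
qed

lemma stopped_excess:
  assumes Y: "martingale P F Y" and rc: "\<And>\<omega>. \<omega> \<in> space P \<Longrightarrow> right_continuous_path (\<lambda>t. Y t \<omega>)"
    and \<rho>: "stop_time F \<rho>" and t: "0 \<le> t" "0 \<le> c"
  shows "excess P c (\<lambda>\<omega>. Y (tmin t (\<rho> \<omega>)) \<omega>) \<le> excess P c (Y t)"
  using stop_after(3)[OF Y rc \<rho> order_refl t] by (simp add: max_absorb2)

text \<open>
  On \<open>{\<rho> \<le> s}\<close> the stopped process no longer moves after \<open>s\<close>; on the complement, which is known at
  time \<open>s\<close>, it is sampled after \<open>s\<close> and \<open>stop_after\<close> applies.
\<close>

lemma stopped_martingale:
  assumes Y: "martingale P F Y" and rc: "\<And>\<omega>. \<omega> \<in> space P \<Longrightarrow> right_continuous_path (\<lambda>t. Y t \<omega>)"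
    and \<rho>: "stop_time F \<rho>"
  shows "martingale P F (\<lambda>t \<omega>. Y (tmin t (\<rho> \<omega>)) \<omega>)"
proof (rule martingaleI)
  show "adapted F (\<lambda>t \<omega>. Y (tmin t (\<rho> \<omega>)) \<omega>)"
    using Y by (intro adapted_stopped rc \<rho>) (auto simp: martingale_def)
  show int: "integrable P (\<lambda>\<omega>. Y (tmin t (\<rho> \<omega>)) \<omega>)" if "0 \<le> t" for t
    using stop_after(1)[OF Y rc \<rho> order_refl that] by (simp add: max_absorb2)
  fix s t A assume s: "0 \<le> s" "s \<le> t" and A: "A \<in> sets (F s)"
  then have t: "0 \<le> t" by simp
  define B where "B = A \<inter> {\<omega>\<in>space P. ennreal s < \<rho> \<omega>}"
  define C where "C = A \<inter> {\<omega>\<in>space P. \<rho> \<omega> \<le> ennreal s}"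
  have BC: "B \<in> sets (F s)" "C \<in> sets (F s)"
    unfolding B_def C_def using A stop_gt[OF \<rho> s(1)] stop_le[OF \<rho> s(1)] by auto
  have A_sub: "A \<subseteq> space P" using sets.sets_into_space[OF A] by (simp add: space_F)
  have split: "integral_on P A W = integral_on P B W + integral_on P C W"
    if W: "integrable P W" for W :: "'a \<Rightarrow> real"
  proof -
    have "integrable P (\<lambda>\<omega>. indicator B \<omega> * W \<omega>)" "integrable P (\<lambda>\<omega>. indicator C \<omega> * W \<omega>)"
      using integrable_mult_indicator[OF F_sub[OF BC(1)] W] integrable_mult_indicator[OF F_sub[OF BC(2)] W] by simp_all
    moreover have "indicator A \<omega> * W \<omega> = indicator B \<omega> * W \<omega> + indicator C \<omega> * W \<omega>" for \<omega>
      using A_sub by (auto simp: indicator_def B_def C_def)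
    ultimately show ?thesis by (simp only: Bochner_Integration.integral_add)
  qed
  have "integral_on P B (\<lambda>\<omega>. Y (tmin t (\<rho> \<omega>)) \<omega>) = integral_on P B (\<lambda>\<omega>. Y (max s (tmin t (\<rho> \<omega>))) \<omega>)"
  proof (intro Bochner_Integration.integral_cong refl)
    fix \<omega>
    show "indicator B \<omega> * Y (tmin t (\<rho> \<omega>)) \<omega> = indicator B \<omega> * Y (max s (tmin t (\<rho> \<omega>))) \<omega>"
    proof (cases "\<omega> \<in> B")
      case True
      then have "ennreal s \<le> ennreal (tmin t (\<rho> \<omega>))" using s t by (auto simp: B_def ennreal_tmin intro: ennreal_leI)
      then have "s \<le> tmin t (\<rho> \<omega>)" by simp
      then show ?thesis by (simp add: max_absorb2)
    qed simp
  qed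
  also have "\<dots> = integral_on P B (Y t)"
    by (rule stop_after(2)[OF Y rc \<rho> s BC(1)])
  also have "\<dots> = integral_on P B (Y s)"
    by (rule martingale_int[OF Y s BC(1), symmetric])
  also have "\<dots> = integral_on P B (\<lambda>\<omega>. Y (tmin s (\<rho> \<omega>)) \<omega>)"
    using s by (intro Bochner_Integration.integral_cong refl) (auto simp: B_def tmin_eq indicator_def)
  finally have 1: "integral_on P B (\<lambda>\<omega>. Y (tmin t (\<rho> \<omega>)) \<omega>) = integral_on P B (\<lambda>\<omega>. Y (tmin s (\<rho> \<omega>)) \<omega>)" .
  have 2: "integral_on P C (\<lambda>\<omega>. Y (tmin t (\<rho> \<omega>)) \<omega>) = integral_on P C (\<lambda>\<omega>. Y (tmin s (\<rho> \<omega>)) \<omega>)"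
  proof (intro Bochner_Integration.integral_cong refl)
    fix \<omega>
    have "tmin t (\<rho> \<omega>) = tmin s (\<rho> \<omega>)" if "\<omega> \<in> C"
    proof -
      have 1: "\<rho> \<omega> \<le> ennreal s" using that by (simp add: C_def)
      also have "\<dots> \<le> ennreal t" by (rule ennreal_leI) (rule s(2))
      finally have "\<rho> \<omega> \<le> ennreal t" .
      with 1 show ?thesis by (simp add: tmin_def min_absorb2)
    qed
    then show "indicator C \<omega> * Y (tmin t (\<rho> \<omega>)) \<omega> = indicator C \<omega> * Y (tmin s (\<rho> \<omega>)) \<omega>"
      by (auto simp: indicator_def)
  qed
  show "integral_on P A (\<lambda>\<omega>. Y (tmin t (\<rho> \<omega>)) \<omega>) = integral_on P A (\<lambda>\<omega>. Y (tmin s (\<rho> \<omega>)) \<omega>)"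
    using 1 2 by (simp add: split[OF int[OF t]] split[OF int[OF s(1)]])
qed

lemma martingale_limit:
  fixes Z :: "nat \<Rightarrow> real \<Rightarrow> 'a \<Rightarrow> real"
  assumes Z: "\<And>n. martingale P F (Z n)"
    and lim: "\<And>t \<omega>. 0 \<le> t \<Longrightarrow> \<omega> \<in> space P \<Longrightarrow> (\<lambda>n. Z n t \<omega>) \<longlonglongrightarrow> Y t \<omega>"
    and unif: "\<And>t \<epsilon>. 0 \<le> t \<Longrightarrow> 0 < \<epsilon> \<Longrightarrow> \<exists>c\<ge>0. \<forall>n. excess P c (Z n t) \<le> \<epsilon>"
  shows "martingale P F Y"
proof (rule martingaleI)
  have meas: "Y t \<in> borel_measurable (F t)" if "0 \<le> t" for t
    by (rule borel_measurable_LIMSEQ_metric[where f="\<lambda>n. Z n t"])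
      (use Z lim that in \<open>auto simp: martingale_def adapted_def space_F\<close>)
  then show "adapted F Y" by (simp add: adapted_def)
  have int: "integrable P (Z n t)" if "0 \<le> t" for n t using Z that by (auto simp: martingale_def)
  note L = uniform_excess_limit[OF finite_measure_axioms int measurable_F_P[OF meas] AE_I2[OF lim] unif]
  show "integrable P (Y t)" if "0 \<le> t" for t using L(1)[OF that that that _ that] by simp
  fix s t A assume s: "0 \<le> s" "s \<le> t" and A: "A \<in> sets (F s)"
  then have t: "0 \<le> t" by simp
  have "(\<lambda>n. integral_on P A (Z n t)) \<longlonglongrightarrow> integral_on P A (Y t)"
    using L(2)[OF t t t _ t _ F_sub[OF A]] by simp
  moreover have "(\<lambda>n. integral_on P A (Z n s)) \<longlonglongrightarrow> integral_on P A (Y s)"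
    using L(2)[OF s(1) s(1) s(1) _ s(1) _ F_sub[OF A]] by simp
  ultimately show "integral_on P A (Y t) = integral_on P A (Y s)"
    using martingale_int[OF Z s A] by (simp add: LIMSEQ_unique)
qed

lemma martingale_diff:
  assumes "martingale P F Y" "martingale P F Z"
  shows "martingale P F (\<lambda>t \<omega>. Y t \<omega> - Z t \<omega>)"
proof (rule martingaleI)
  have int: "integrable P (Y t)" "integrable P (Z t)" if "0 \<le> t" for t using assms that by (auto simp: martingale_def)
  show "adapted F (\<lambda>t \<omega>. Y t \<omega> - Z t \<omega>)"
    using assms by (auto simp: martingale_def adapted_def intro!: borel_measurable_diff)
  show "integrable P (\<lambda>\<omega>. Y t \<omega> - Z t \<omega>)" if "0 \<le> t" for t using int[OF that] by simp
  fix s t A assume s: "0 \<le> s" "s \<le> t" and A: "A \<in> sets (F s)"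
  then have t: "0 \<le> t" by simp
  have "integrable P (\<lambda>\<omega>. indicator A \<omega> * Y r \<omega>)" "integrable P (\<lambda>\<omega>. indicator A \<omega> * Z r \<omega>)" if "0 \<le> r" for r
    using integrable_mult_indicator[OF F_sub[OF A] int(1)[OF that]]
      integrable_mult_indicator[OF F_sub[OF A] int(2)[OF that]] by simp_all
  then show "integral_on P A (\<lambda>\<omega>. Y t \<omega> - Z t \<omega>) = integral_on P A (\<lambda>\<omega>. Y s \<omega> - Z s \<omega>)"
    using martingale_int[OF assms(1) s A] martingale_int[OF assms(2) s A] s t by (simp add: right_diff_distrib)
qed

lemma martingale_const:
  assumes "integrable P Z" "Z \<in> borel_measurable (F 0)"
  shows "martingale P F (\<lambda>t. Z)"
  by (rule martingaleI) (use assms in \<open>auto simp: adapted_def intro: measurable_F_mono[of 0]\<close>)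

lemma martingale_uminus: "martingale P F Y \<Longrightarrow> martingale P F (\<lambda>t \<omega>. - Y t \<omega>)"
  using martingale_diff[OF martingale_const[of "\<lambda>_. 0"]] by simp

lemma martingale_add: "martingale P F Y \<Longrightarrow> martingale P F Z \<Longrightarrow> martingale P F (\<lambda>t \<omega>. Y t \<omega> + Z t \<omega>)"
  using martingale_diff[OF _ martingale_uminus[of Z], of Y] by simp

lemma martingale_restrict:
  assumes "martingale P F Y" "{\<omega>\<in>space P. Q \<omega>} \<in> sets (F 0)"
  shows "martingale P F (\<lambda>t \<omega>. Y t \<omega> * of_bool (Q \<omega>))"
proof (rule martingaleI)
  let ?G = "{\<omega>\<in>space P. Q \<omega>}"
  have G: "?G \<in> sets (F t)" if "0 \<le> t" for t using F_mono[OF that assms(2)] .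
  have eq: "Y t \<omega> * of_bool (Q \<omega>) = indicator ?G \<omega> * Y t \<omega>" if "\<omega> \<in> space P" for t \<omega>
    using that by (auto simp: indicator_def)
  show "adapted F (\<lambda>t \<omega>. Y t \<omega> * of_bool (Q \<omega>))"
    unfolding adapted_def
  proof (intro allI impI)
    fix t :: real assume t: "0 \<le> t"
    have "(\<lambda>\<omega>. indicator ?G \<omega> * Y t \<omega>) \<in> borel_measurable (F t)"
      using assms(1) t G[OF t] by (intro borel_measurable_times borel_measurable_indicator) (auto simp: martingale_def adapted_def)
    then show "(\<lambda>\<omega>. Y t \<omega> * of_bool (Q \<omega>)) \<in> borel_measurable (F t)"
      by (rule measurable_cong[THEN iffD1, rotated]) (simp add: eq space_F)
  qed
  show "integrable P (\<lambda>\<omega>. Y t \<omega> * of_bool (Q \<omega>))" if "0 \<le> t" for t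
    using integrable_mult_indicator[OF F_sub[OF assms(2)], of "Y t"] assms(1) that
    by (subst Bochner_Integration.integrable_cong[OF refl eq]) (auto simp: martingale_def)
  fix s t A assume s: "0 \<le> s" "s \<le> t" and A: "A \<in> sets (F s)"
  have eq2: "integral_on P A (\<lambda>\<omega>. (Y r \<omega> * of_bool (Q \<omega>))) = integral_on P (A \<inter> ?G) (Y r)" for r
    by (intro Bochner_Integration.integral_cong refl) (auto simp: indicator_def)
  show "integral_on P A (\<lambda>\<omega>. (Y t \<omega> * of_bool (Q \<omega>))) = integral_on P A (\<lambda>\<omega>. (Y s \<omega> * of_bool (Q \<omega>)))"
    unfolding eq2 using A G[OF s(1)] by (intro martingale_int[OF assms(1) s, symmetric]) auto
qed

lemma martingale_AE_cong:
  assumes Y: "martingale P F Y" and eq: "\<And>t. 0 \<le> t \<Longrightarrow> AE \<omega> in P. Y t \<omega> = Z t \<omega>"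
  shows "martingale P F Z"
proof (rule martingaleI)
  have Ym: "Y t \<in> borel_measurable (F t)" if "0 \<le> t" for t using Y that by (simp add: martingale_def adapted_def)
  have Zm: "Z t \<in> borel_measurable (F t)" if "0 \<le> t" for t
    using Y that by (intro measurable_F_AE_eq[OF that Ym eq])
  then show "adapted F Z" by (simp add: adapted_def)
  note [measurable] = measurable_F_P[OF Ym] measurable_F_P[OF Zm]
  show "integrable P (Z t)" if t: "0 \<le> t" for t
    using Y t integrable_cong_AE[of "Y t" P "Z t"] eq[OF t] measurable_F_P[OF Ym[OF t]] measurable_F_P[OF Zm[OF t]]
    by (auto simp: martingale_def)
  fix s t A assume s: "0 \<le> s" "s \<le> t" and A: "A \<in> sets (F s)"
  note [measurable] = F_sub[OF A]
  have "integral_on P A (Y r) = integral_on P A (Z r)" if r: "0 \<le> r" for r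
    using eq[OF r] r by (intro integral_cong_AE) auto
  from this[of s] this[of t] show "integral_on P A (Z t) = integral_on P A (Z s)"
    using martingale_int[OF Y s A] s by simp
qed

end

section \<open>Simple closed sets of time-state pairs\<close>

text \<open>
  Finite unions of rectangles \<open>[s, t] \<times> B\<close> where \<open>B\<close> is known at a time \<open>r\<close> strictly before \<open>s\<close> (or at
  time \<open>0\<close> if \<open>s = 0\<close>).  Two features make them useful: their sections in time are closed, so
  decreasing sequences can be handled by compactness, and their left ends can be foreseen.
\<close>

inductive simple_closed :: "(real \<Rightarrow> 'a measure) \<Rightarrow> (real \<times> 'a) set \<Rightarrow> bool" for F where
  empty: "simple_closed F {}"
| rect: "0 \<le> r \<Longrightarrow> B \<in> sets (F r) \<Longrightarrow> r < s \<or> r = 0 \<and> s = 0 \<Longrightarrow> s \<le> t \<Longrightarrow> simple_closed F ({s..t} \<times> B)"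
| union: "simple_closed F K \<Longrightarrow> simple_closed F L \<Longrightarrow> simple_closed F (K \<union> L)"

lemma simple_closed_section_closed:
  "simple_closed F K \<Longrightarrow> closed {t. (t, \<omega>) \<in> K}"
proof (induction rule: simple_closed.induct)
  case (rect r B s t)
  have "{x. (x, \<omega>) \<in> {s..t} \<times> B} = (if \<omega> \<in> B then {s..t} else {})" by auto
  then show ?case by simp
next
  case (union K L)
  have "{t. (t, \<omega>) \<in> K \<union> L} = {t. (t, \<omega>) \<in> K} \<union> {t. (t, \<omega>) \<in> L}" by auto
  then show ?case using union by auto
qed simp

lemma announcing_constants:
  fixes x :: ennreal
  obtains f :: "nat \<Rightarrow> ennreal" where "incseq f" "f \<longlonglongrightarrow> x" "0 < x \<longrightarrow> (\<forall>n. f n < x)" "x = 0 \<longrightarrow> (\<forall>n. f n = 0)"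
proof (cases "x = 0")
  case True
  then show ?thesis using that[of "\<lambda>_. 0"] by (auto simp: incseq_def)
next
  case False
  then have "0 < x" by (simp add: zero_less_iff_neq_zero)
  from approx_from_below_dense_linorder[OF this] obtain u where u: "\<And>n. u n < x" "u \<longlonglongrightarrow> x" by auto
  define f where "f n = Max (u ` {..n})" for n
  have "incseq f" unfolding f_def by (auto intro!: incseq_SucI Max_mono)
  moreover have lt: "f n < x" for n unfolding f_def using u(1) by (subst Max_less_iff) auto
  moreover have "f \<longlonglongrightarrow> x"
  proof (rule tendsto_sandwich[OF _ _ u(2) tendsto_const])
    show "\<forall>\<^sub>F n in sequentially. u n \<le> f n" by (auto simp: f_def intro!: always_eventually Max_ge)
    show "\<forall>\<^sub>F n in sequentially. f n \<le> x" using lt by (auto intro!: always_eventually less_imp_le)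
  qed
  ultimately show ?thesis using False that by blast
qed

context usual_filtered_prob_space
begin

lemma predictable_generators:
  "{{0} \<times> B | B. B \<in> sets (F 0)} \<union> {{s<..t} \<times> B | s t B. 0 \<le> s \<and> s \<le> t \<and> B \<in> sets (F s)}
    \<subseteq> Pow ({0..} \<times> space (F 0))"
  using sets.sets_into_space by (fastforce simp: space_F)

lemma space_predictable: "space (predictable_sigma F) = {0..} \<times> space P"
  unfolding predictable_sigma_def using space_measure_of[OF predictable_generators] by (simp add: space_F)

lemma sets_predictable: "sets (predictable_sigma F) = sigma_sets ({0..} \<times> space P)
   ({{0} \<times> B | B. B \<in> sets (F 0)} \<union> {{s<..t} \<times> B | s t B. 0 \<le> s \<and> s \<le> t \<and> B \<in> sets (F s)})"
  unfolding predictable_sigma_def using sets_measure_of[OF predictable_generators] by (simp add: space_F)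

lemma predictable_zero: "B \<in> sets (F 0) \<Longrightarrow> {0} \<times> B \<in> sets (predictable_sigma F)"
  unfolding sets_predictable by (rule sigma_sets.Basic) auto

lemma predictable_Ioc: "0 \<le> s \<Longrightarrow> B \<in> sets (F s) \<Longrightarrow> {s<..t} \<times> B \<in> sets (predictable_sigma F)"
proof (cases "s \<le> t")
  case True
  assume "0 \<le> s" "B \<in> sets (F s)"
  with True show ?thesis unfolding sets_predictable by (intro sigma_sets.Basic) auto
qed simp

lemma predictable_Ioi:
  assumes "0 \<le> s" "B \<in> sets (F s)"
  shows "{s<..} \<times> B \<in> sets (predictable_sigma F)"
proof -
  have "{s<..} \<times> B = (\<Union>n. {s<..real n} \<times> B)" using real_arch_simple by auto
  also have "\<dots> \<in> sets (predictable_sigma F)" using predictable_Ioc[OF assms] by (intro sets.countable_UN) auto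
  finally show ?thesis .
qed

lemma predictable_measurableI:
  assumes "f \<in> space M \<rightarrow> {0..} \<times> space P"
    and "\<And>B. B \<in> sets (F 0) \<Longrightarrow> f -` ({0} \<times> B) \<inter> space M \<in> sets M"
    and "\<And>s t B. 0 \<le> s \<Longrightarrow> s \<le> t \<Longrightarrow> B \<in> sets (F s) \<Longrightarrow> f -` ({s<..t} \<times> B) \<inter> space M \<in> sets M"
  shows "f \<in> measurable M (predictable_sigma F)"
  unfolding predictable_sigma_def
  by (rule measurable_measure_of[OF predictable_generators]) (use assms in \<open>auto simp: space_F\<close>)

lemma predictable_section:
  assumes "0 \<le> t"
  shows "(\<lambda>\<omega>. (t, \<omega>)) \<in> measurable (F t) (predictable_sigma F)"
proof (rule predictable_measurableI)
  fix B assume B: "B \<in> sets (F 0)"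
  have "(\<lambda>\<omega>. (t, \<omega>)) -` ({0} \<times> B) \<inter> space (F t) = (if t = 0 then B else {})"
    using sets.sets_into_space[OF B] by (auto simp: space_F)
  then show "(\<lambda>\<omega>. (t, \<omega>)) -` ({0} \<times> B) \<inter> space (F t) \<in> sets (F t)" using B by auto
next
  fix s r B assume B: "B \<in> sets (F s)"
  have "(\<lambda>\<omega>. (t, \<omega>)) -` ({s<..r} \<times> B) \<inter> space (F t) = (if s < t \<and> t \<le> r then B else {})"
    using sets.sets_into_space[OF B] by (auto simp: space_F)
  then show "(\<lambda>\<omega>. (t, \<omega>)) -` ({s<..r} \<times> B) \<inter> space (F t) \<in> sets (F t)" using F_mono[of s t B] B by auto
qed (use assms in \<open>auto simp: space_F\<close>)

lemma predictable_imp_adapted: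
  assumes "predictable_process F X"
  shows "adapted F X"
  unfolding adapted_def
proof (intro allI impI)
  fix t :: real assume "0 \<le> t"
  from measurable_compose[OF predictable_section[OF this] assms[unfolded predictable_process_def]]
  show "X t \<in> borel_measurable (F t)" by simp
qed

lemma stop_lt:
  assumes "stop_time F \<tau>" "0 < t"
  shows "{\<omega>\<in>space P. \<tau> \<omega> < ennreal t} \<in> sets (F t)"
proof -
  have "{\<omega>\<in>space P. \<tau> \<omega> < ennreal t} = (\<Union>q\<in>\<rat> \<inter> {0..<t}. {\<omega>\<in>space P. \<tau> \<omega> \<le> ennreal q})"
  proof safe
    fix \<omega> assume w: "\<omega> \<in> space P" and "\<tau> \<omega> < ennreal t"
    then obtain r where r: "0 \<le> r" "\<tau> \<omega> = ennreal r" "r < t"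
      by (cases "\<tau> \<omega>") (auto simp: ennreal_less_iff)
    then obtain q where "q \<in> \<rat>" "r < q" "q < t" using Rats_dense_in_real by blast
    then show "\<omega> \<in> (\<Union>q\<in>\<rat> \<inter> {0..<t}. {\<omega>\<in>space P. \<tau> \<omega> \<le> ennreal q})"
      using r w by (auto intro!: bexI[of _ q] ennreal_leI)
  next
    fix \<omega> q assume "\<tau> \<omega> \<le> ennreal q" "q \<in> {0..<t}"
    then show "\<tau> \<omega> < ennreal t" by (auto intro: le_less_trans ennreal_lessI)
  qed
  also have "\<dots> \<in> sets (F t)"
  proof (rule sets.countable_UN'')
    show "countable (\<rat> \<inter> {0..<t})" by (simp add: countable_rat)
    fix q assume "q \<in> \<rat> \<inter> {0..<t}"
    then show "{\<omega>\<in>space P. \<tau> \<omega> \<le> ennreal q} \<in> sets (F t)"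
      using F_mono[OF _ stop_le[OF assms(1), of q]] by auto
  qed
  finally show ?thesis .
qed

lemma simple_closed_subset: "simple_closed F K \<Longrightarrow> K \<subseteq> {0..} \<times> space P"
proof (induction rule: simple_closed.induct)
  case (rect r B s t)
  then show ?case using sets.sets_into_space[OF rect(2)] by (auto simp: space_F)
qed auto

lemma simple_closed_rect:
  "0 \<le> r \<Longrightarrow> B \<in> sets (F r) \<Longrightarrow> r < s \<or> r = 0 \<and> s = 0 \<Longrightarrow> simple_closed F ({s..t} \<times> B)"
  by (cases "s \<le> t") (auto intro: simple_closed.intros)

lemma simple_closed_Int:
  assumes "simple_closed F K" "simple_closed F L"
  shows "simple_closed F (K \<inter> L)"
  using assms(1)
proof (induction rule: simple_closed.induct)
  case (rect r B s t)
  note rect1 = rect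
  show ?case using assms(2)
  proof (induction rule: simple_closed.induct)
    case (rect r' B' s' t')
    have "B \<inter> B' \<in> sets (F (max r r'))"
      using rect1(2) rect(2) F_mono[of r "max r r'"] F_mono[of r' "max r r'"] by auto
    then have "simple_closed F ({max s s'..min t t'} \<times> (B \<inter> B'))"
      using rect1(1,3) rect(1,3) by (intro simple_closed_rect) auto
    also have "{max s s'..min t t'} \<times> (B \<inter> B') = {s..t} \<times> B \<inter> {s'..t'} \<times> B'" by auto
    finally show ?case .
  qed (auto simp: Int_Un_distrib intro: simple_closed.intros)
qed (auto simp: Int_Un_distrib2 intro: simple_closed.intros)

lemma simple_closed_predictable: "simple_closed F K \<Longrightarrow> K \<in> sets (predictable_sigma F)"
proof (induction rule: simple_closed.induct)
  case (rect r B s t)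
  show ?case
  proof (cases "r < s")
    case True
    define q where "q n = s - (s - r) / real (Suc n)" for n
    have q: "r \<le> q n" "q n < s" for n
    proof -
      have "(s - r) / real (Suc n) \<le> (s - r) / 1" using True by (intro divide_left_mono) auto
      then show "r \<le> q n" by (simp add: q_def)
      show "q n < s" using True by (simp add: q_def)
    qed
    have "(\<lambda>n. s - (s - r) / real (Suc n)) \<longlonglongrightarrow> s - 0"
      by (intro tendsto_diff tendsto_const LIMSEQ_Suc lim_const_over_n)
    then have lim: "q \<longlonglongrightarrow> s" by (simp add: q_def[abs_def])
    have "{s..t} \<times> B = (\<Inter>n. {q n<..t} \<times> B)"
    proof (intro set_eqI iffI)
      fix p assume "p \<in> (\<Inter>n. {q n<..t} \<times> B)"
      then have p: "\<And>n. q n < fst p" "fst p \<le> t" "snd p \<in> B" by auto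
      have "s \<le> fst p" by (rule LIMSEQ_le_const2[OF lim]) (use p(1) in \<open>auto intro: less_imp_le\<close>)
      then show "p \<in> {s..t} \<times> B" using p by (cases p) auto
    next
      fix p assume "p \<in> {s..t} \<times> B"
      then show "p \<in> (\<Inter>n. {q n<..t} \<times> B)" by (auto intro: less_le_trans[OF q(2)])
    qed
    also have "\<dots> \<in> sets (predictable_sigma F)"
    proof (intro sets.countable_INT image_subsetI)
      fix n show "{q n<..t} \<times> B \<in> sets (predictable_sigma F)"
        using q(1)[of n] rect(1) F_mono[OF q(1) rect(2)] by (intro predictable_Ioc) auto
    qed simp
    finally show ?thesis .
  next
    case False
    then have "r = 0" "s = 0" using rect by auto
    then have "{s..t} \<times> B = {0} \<times> B \<union> {0<..t} \<times> B" using rect by auto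
    then show ?thesis using predictable_zero[of B] predictable_Ioc[of 0 B t] rect \<open>r = 0\<close> by auto
  qed
qed auto

text \<open>
  A real-valued stopping time strictly before every time at which the path is in \<open>K\<close>, where a path that
  starts in \<open>K\<close> is stopped at \<open>0\<close>.
\<close>

definition stops_before :: "(real \<times> 'a) set \<Rightarrow> ('a \<Rightarrow> real) \<Rightarrow> bool" where
  "stops_before K E \<longleftrightarrow> (\<forall>x\<ge>0. {\<omega>\<in>space P. E \<omega> \<le> x} \<in> sets (F x)) \<and> (\<forall>\<omega>. 0 \<le> E \<omega>) \<and>
    (\<forall>t \<omega>. (t, \<omega>) \<in> K \<longrightarrow> E \<omega> \<le> t \<and> (0 < t \<longrightarrow> E \<omega> < t))"

text \<open>
  A simple closed set is entered through one of finitely many left ends, and the event that it is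
  entered through a given one is already decided strictly earlier.  The stopping time \<open>E\<close> comes within
  \<open>\<epsilon>\<close> of the entrance; entrances later than \<open>1 / \<epsilon>\<close>, or none at all, are only followed up to \<open>1 / \<epsilon>\<close>.
\<close>

lemma simple_closed_announce:
  assumes "simple_closed F K" "0 < \<epsilon>"
  shows "\<exists>E :: 'a \<Rightarrow> real. stops_before K E \<and>
    (\<forall>c \<omega>. (\<forall>t. (t, \<omega>) \<in> K \<longrightarrow> c \<le> t) \<longrightarrow> c \<le> 1 / \<epsilon> \<longrightarrow> c - \<epsilon> \<le> E \<omega>)"
  using assms(1)
proof (induction rule: simple_closed.induct)
  case empty
  have e1: "{\<omega>\<in>space P. n \<le> x} \<in> sets (F x)" for n x :: real
    using sets.top[of "F x"] by (cases "n \<le> x") (simp_all add: space_F)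
  have e2: "0 \<le> 1 / \<epsilon>" using assms(2) by simp
  have e4: "c - \<epsilon> \<le> 1 / \<epsilon>" if "c \<le> 1 / \<epsilon>" for c using that assms(2) by linarith
  show ?case
    unfolding stops_before_def by (rule exI[of _ "\<lambda>_. 1 / \<epsilon>"]) (use e1 e2 e4 in blast)
next
  case (rect r B s t)
  define E where "E \<omega> = (if \<omega> \<in> B then max r (s - \<epsilon>) else max r (1 / \<epsilon>))" for \<omega>
  have e1: "{\<omega>\<in>space P. E \<omega> \<le> x} \<in> sets (F x)" if "0 \<le> x" for x
  proof (cases "r \<le> x")
    case True
    have "{\<omega>\<in>space P. E \<omega> \<le> x} = (if max r (s - \<epsilon>) \<le> x then B else {}) \<union> (if max r (1 / \<epsilon>) \<le> x then space (F x) - B else {})"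
      using sets.sets_into_space[OF rect(2)] by (auto simp: E_def space_F)
    then show ?thesis using F_mono[OF True rect(2)] by auto
  next
    case False
    then have "{\<omega>\<in>space P. E \<omega> \<le> x} = {}" by (auto simp: E_def)
    then show ?thesis by (simp only: sets.empty_sets)
  qed
  have e2: "0 \<le> E \<omega>" for \<omega> using rect(1) by (auto simp: E_def)
  have e3: "E \<omega> \<le> x \<and> (0 < x \<longrightarrow> E \<omega> < x)" if "(x, \<omega>) \<in> {s..t} \<times> B" for x \<omega>
    using that rect(1,3) assms(2) by (auto simp: E_def)
  have e4: "c - \<epsilon> \<le> E \<omega>" if c: "\<forall>x. (x, \<omega>) \<in> {s..t} \<times> B \<longrightarrow> c \<le> x" "c \<le> 1 / \<epsilon>" for c \<omega>
  proof (cases "\<omega> \<in> B")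
    case True
    then have "c \<le> s" using c(1) rect(4) by auto
    then show ?thesis using True by (auto simp: E_def)
  next
    case False
    then show ?thesis using c(2) assms(2) by (simp add: E_def)
  qed
  show ?case
    unfolding stops_before_def
    by (rule exI[of _ E], intro conjI[OF conjI[OF _ conjI]] allI impI) (fact e1 e2 e3 e4)+
next
  case (union K L)
  from union.IH obtain E1 E2 :: "'a \<Rightarrow> real" where
    E1: "\<forall>x\<ge>0. {\<omega>\<in>space P. E1 \<omega> \<le> x} \<in> sets (F x)" "\<forall>\<omega>. 0 \<le> E1 \<omega>"
      "\<forall>t \<omega>. (t, \<omega>) \<in> K \<longrightarrow> E1 \<omega> \<le> t \<and> (0 < t \<longrightarrow> E1 \<omega> < t)"
      "\<forall>c \<omega>. (\<forall>t. (t, \<omega>) \<in> K \<longrightarrow> c \<le> t) \<longrightarrow> c \<le> 1 / \<epsilon> \<longrightarrow> c - \<epsilon> \<le> E1 \<omega>" and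
    E2: "\<forall>x\<ge>0. {\<omega>\<in>space P. E2 \<omega> \<le> x} \<in> sets (F x)" "\<forall>\<omega>. 0 \<le> E2 \<omega>"
      "\<forall>t \<omega>. (t, \<omega>) \<in> L \<longrightarrow> E2 \<omega> \<le> t \<and> (0 < t \<longrightarrow> E2 \<omega> < t)"
      "\<forall>c \<omega>. (\<forall>t. (t, \<omega>) \<in> L \<longrightarrow> c \<le> t) \<longrightarrow> c \<le> 1 / \<epsilon> \<longrightarrow> c - \<epsilon> \<le> E2 \<omega>"
    unfolding stops_before_def by (elim exE conjE) (rule that)
  have eq: "{\<omega>\<in>space P. min (E1 \<omega>) (E2 \<omega>) \<le> x} = {\<omega>\<in>space P. E1 \<omega> \<le> x} \<union> {\<omega>\<in>space P. E2 \<omega> \<le> x}" for x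
    by (auto simp: min_le_iff_disj)
  have m1: "\<forall>x\<ge>0. {\<omega>\<in>space P. min (E1 \<omega>) (E2 \<omega>) \<le> x} \<in> sets (F x)"
  proof (intro allI impI)
    fix x :: real assume "0 \<le> x"
    then show "{\<omega>\<in>space P. min (E1 \<omega>) (E2 \<omega>) \<le> x} \<in> sets (F x)"
      unfolding eq by (intro sets.Un E1(1)[rule_format] E2(1)[rule_format])
  qed
  have m2: "\<forall>\<omega>. 0 \<le> min (E1 \<omega>) (E2 \<omega>)" using E1(2) E2(2) by simp
  have m3: "\<forall>t \<omega>. (t, \<omega>) \<in> K \<union> L \<longrightarrow> min (E1 \<omega>) (E2 \<omega>) \<le> t \<and> (0 < t \<longrightarrow> min (E1 \<omega>) (E2 \<omega>) < t)"
    unfolding min_le_iff_disj min_less_iff_disj using E1(3) E2(3) by blast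
  have m4: "\<forall>c \<omega>. (\<forall>t. (t, \<omega>) \<in> K \<union> L \<longrightarrow> c \<le> t) \<longrightarrow> c \<le> 1 / \<epsilon> \<longrightarrow> c - \<epsilon> \<le> min (E1 \<omega>) (E2 \<omega>)"
    unfolding min.bounded_iff using E1(4) E2(4) by blast
  show ?case unfolding stops_before_def
    by (rule exI[of _ "\<lambda>\<omega>. min (E1 \<omega>) (E2 \<omega>)"]) (intro conjI m1 m2 m3 m4)
qed

text \<open>
  Countable intersections of simple closed sets: the class of inner approximants, still with closed
  sections and stable under finite unions and countable intersections.
\<close>

definition closed_delta :: "(real \<times> 'a) set \<Rightarrow> bool" where
  "closed_delta D \<longleftrightarrow> (\<exists>K :: nat \<Rightarrow> (real \<times> 'a) set. (\<forall>n. simple_closed F (K n)) \<and> D = (\<Inter>n. K n))"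

lemma closed_delta_simple: "simple_closed F K \<Longrightarrow> closed_delta K"
  unfolding closed_delta_def by (rule exI[of _ "\<lambda>_. K"]) auto

lemma closed_delta_INT:
  assumes "\<And>i::nat. closed_delta (D i)"
  shows "closed_delta (\<Inter>i. D i)"
proof -
  have "\<forall>i. \<exists>K. (\<forall>n::nat. simple_closed F (K n)) \<and> D i = (\<Inter>n. K n)"
    using assms unfolding closed_delta_def by blast
  from choice[OF this] obtain K :: "nat \<Rightarrow> nat \<Rightarrow> (real \<times> 'a) set"
    where K0: "\<forall>i. (\<forall>n. simple_closed F (K i n)) \<and> D i = (\<Inter>n. K i n)" ..
  have K: "simple_closed F (K i n)" "D i = (\<Inter>n. K i n)" for i n using K0 by simp_all
  have "(\<Inter>i. D i) = (\<Inter>k. K (fst (prod_decode k)) (snd (prod_decode k)))"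
  proof (intro set_eqI iffI)
    fix x assume *: "x \<in> (\<Inter>k. K (fst (prod_decode k)) (snd (prod_decode k)))"
    have "x \<in> K i n" for i n using INT_D[OF *, of "prod_encode (i, n)"] by simp
    then show "x \<in> (\<Inter>i. D i)" by (auto simp: K(2))
  qed (auto simp: K(2))
  then show ?thesis unfolding closed_delta_def
    by (intro exI[of _ "\<lambda>k. K (fst (prod_decode k)) (snd (prod_decode k))"]) (auto intro: K(1))
qed

lemma closed_delta_Un:
  assumes "closed_delta D" "closed_delta E"
  shows "closed_delta (D \<union> E)"
proof -
  obtain K L where K: "\<And>n. simple_closed F (K n)" "D = (\<Inter>n::nat. K n)"
    and L: "\<And>n. simple_closed F (L n)" "E = (\<Inter>n::nat. L n)"
    using assms unfolding closed_delta_def by (elim exE conjE) (rule that; simp)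
  have "closed_delta (\<Inter>i. \<Inter>n. K i \<union> L n)"
    by (intro closed_delta_INT closed_delta_simple simple_closed.union K L)
  also have "(\<Inter>i. \<Inter>n. K i \<union> L n) = D \<union> E" by (auto simp: K(2) L(2))
  finally show ?thesis .
qed

lemma closed_delta_finite_UN:
  fixes N :: nat
  assumes "\<And>i. closed_delta (D i)"
  shows "closed_delta (\<Union>i<N. D i)"
proof (induction N)
  case 0
  then show ?case by (simp add: closed_delta_simple simple_closed.empty)
next
  case (Suc N)
  then show ?case using closed_delta_Un[OF assms] by (simp add: lessThan_Suc)
qed

lemma closed_delta_predictable: "closed_delta D \<Longrightarrow> D \<in> sets (predictable_sigma F)"
  unfolding closed_delta_def
proof (elim exE conjE)
  fix K :: "nat \<Rightarrow> (real \<times> 'a) set" assume "\<forall>n. simple_closed F (K n)" "D = (\<Inter>n. K n)"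
  then show "D \<in> sets (predictable_sigma F)"
    using simple_closed_predictable by (auto simp del: INT_simps intro!: sets.countable_INT'[of UNIV K])
qed

end

section \<open>Inner approximation of predictable sets along a graph\<close>

context usual_filtered_prob_space
begin

text \<open>
  Probabilities of these traces form, as a function of \<open>C\<close>, a finite measure on the predictable
  \<open>\<sigma>\<close>-algebra that is carried by the graph of \<open>\<tau>\<close>.
\<close>

definition on_graph :: "('a \<Rightarrow> ennreal) \<Rightarrow> (real \<times> 'a) set \<Rightarrow> 'a set" where
  "on_graph \<tau> C = {\<omega>\<in>space P. \<tau> \<omega> \<noteq> \<top> \<and> (enn2real (\<tau> \<omega>), \<omega>) \<in> C}"

lemma on_graph_sets:
  assumes [measurable]: "\<tau> \<in> borel_measurable P" and C: "C \<in> sets (predictable_sigma F)"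
  shows "on_graph \<tau> C \<in> sets P"
proof -
  have "(\<lambda>\<omega>. (enn2real (\<tau> \<omega>), \<omega>)) \<in> measurable P (predictable_sigma F)"
  proof (rule predictable_measurableI)
    fix B assume "B \<in> sets (F 0)"
    then have [measurable]: "B \<in> sets P" by (rule F_sub)
    have "(\<lambda>\<omega>. (enn2real (\<tau> \<omega>), \<omega>)) -` ({0} \<times> B) \<inter> space P = {\<omega>\<in>space P. enn2real (\<tau> \<omega>) = 0 \<and> \<omega> \<in> B}" by auto
    also have "\<dots> \<in> sets P" by measurable
    finally show "(\<lambda>\<omega>. (enn2real (\<tau> \<omega>), \<omega>)) -` ({0} \<times> B) \<inter> space P \<in> sets P" .
  next
    fix s t B assume "B \<in> sets (F s)"
    then have [measurable]: "B \<in> sets P" by (rule F_sub)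
    have "(\<lambda>\<omega>. (enn2real (\<tau> \<omega>), \<omega>)) -` ({s<..t} \<times> B) \<inter> space P
        = {\<omega>\<in>space P. s < enn2real (\<tau> \<omega>) \<and> enn2real (\<tau> \<omega>) \<le> t \<and> \<omega> \<in> B}" by auto
    also have "\<dots> \<in> sets P" by measurable
    finally show "(\<lambda>\<omega>. (enn2real (\<tau> \<omega>), \<omega>)) -` ({s<..t} \<times> B) \<inter> space P \<in> sets P" .
  qed auto
  from measurable_sets[OF this C] have "(\<lambda>\<omega>. (enn2real (\<tau> \<omega>), \<omega>)) -` C \<inter> space P \<in> sets P" .
  moreover have "{\<omega>\<in>space P. \<tau> \<omega> \<noteq> \<top>} \<in> sets P" by measurable
  ultimately have "{\<omega>\<in>space P. \<tau> \<omega> \<noteq> \<top>} \<inter> ((\<lambda>\<omega>. (enn2real (\<tau> \<omega>), \<omega>)) -` C \<inter> space P) \<in> sets P" by (rule sets.Int[rotated])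
  also have "{\<omega>\<in>space P. \<tau> \<omega> \<noteq> \<top>} \<inter> ((\<lambda>\<omega>. (enn2real (\<tau> \<omega>), \<omega>)) -` C \<inter> space P) = on_graph \<tau> C"
    by (auto simp: on_graph_def)
  finally show ?thesis .
qed

text \<open>
  Inner regularity of that measure with respect to the class \<open>closed_delta\<close>.
\<close>

definition inner_approx :: "('a \<Rightarrow> ennreal) \<Rightarrow> (real \<times> 'a) set \<Rightarrow> bool" where
  "inner_approx \<tau> C \<longleftrightarrow> (\<forall>\<epsilon>>0. \<exists>D. closed_delta D \<and> D \<subseteq> C \<and> prob (on_graph \<tau> C - on_graph \<tau> D) \<le> \<epsilon>)"

lemma inner_approx_simple: "simple_closed F K \<Longrightarrow> inner_approx \<tau> K"
  unfolding inner_approx_def by (auto intro!: exI[of _ K] closed_delta_simple)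

text \<open>
  Finitely many of the sets carry almost all of the union, and \<open>closed_delta\<close> is stable under finite
  unions only.
\<close>

lemma inner_approx_UN:
  assumes \<tau>: "\<tau> \<in> borel_measurable P"
    and C: "\<And>i::nat. inner_approx \<tau> (C i)" "\<And>i. C i \<in> sets (predictable_sigma F)"
  shows "inner_approx \<tau> (\<Union>i. C i)"
  unfolding inner_approx_def
proof (intro allI impI)
  fix \<epsilon> :: real assume \<epsilon>: "0 < \<epsilon>"
  note gr = on_graph_sets[OF \<tau>]
  define G where "G N = on_graph \<tau> (\<Union>i<N. C i)" for N :: nat
  have Gs: "G N \<in> sets P" for N unfolding G_def using C(2) by (intro gr sets.finite_UN) auto
  have GU: "(\<Union>N. G N) = on_graph \<tau> (\<Union>i. C i)"
  proof (intro set_eqI iffI)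
    fix \<omega> assume "\<omega> \<in> on_graph \<tau> (\<Union>i. C i)"
    then obtain i where "\<omega> \<in> on_graph \<tau> (C i)" by (auto simp: on_graph_def)
    then have "\<omega> \<in> G (Suc i)" by (auto simp: G_def on_graph_def)
    then show "\<omega> \<in> (\<Union>N. G N)" by blast
  qed (auto simp: G_def on_graph_def)
  have "(\<lambda>N. prob (G N)) \<longlonglongrightarrow> prob (\<Union>N. G N)"
  proof (rule finite_Lim_measure_incseq)
    show "range G \<subseteq> events" using Gs by auto
    show "incseq G" by (auto simp: incseq_def G_def on_graph_def intro: less_le_trans)
  qed
  then have "\<forall>\<^sub>F N in sequentially. prob (\<Union>N. G N) - \<epsilon> / 2 < prob (G N)"
    using \<epsilon> by (intro order_tendstoD) auto
  then obtain N where N: "prob (\<Union>N. G N) - \<epsilon> / 2 < prob (G N)"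
    by (meson eventually_happens trivial_limit_sequentially)
  define \<delta> where "\<delta> = \<epsilon> / (2 * real (Suc N))"
  have \<delta>: "0 < \<delta>" "real N * \<delta> \<le> \<epsilon> / 2" using \<epsilon> by (auto simp: \<delta>_def field_simps)
  have "\<forall>i. \<exists>D. closed_delta D \<and> D \<subseteq> C i \<and> prob (on_graph \<tau> (C i) - on_graph \<tau> D) \<le> \<delta>"
    using C(1) \<delta>(1) unfolding inner_approx_def by blast
  from choice[OF this] obtain D :: "nat \<Rightarrow> (real \<times> 'a) set"
    where D0: "\<forall>i. closed_delta (D i) \<and> D i \<subseteq> C i \<and> prob (on_graph \<tau> (C i) - on_graph \<tau> (D i)) \<le> \<delta>" ..
  have D: "closed_delta (D i)" "D i \<subseteq> C i" "prob (on_graph \<tau> (C i) - on_graph \<tau> (D i)) \<le> \<delta>" for i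
    using D0 by simp_all
  have Ds: "D i \<in> sets (predictable_sigma F)" for i by (rule closed_delta_predictable[OF D(1)])
  have "prob (on_graph \<tau> (\<Union>i. C i) - on_graph \<tau> (\<Union>i<N. D i))
      \<le> prob (((\<Union>N. G N) - G N) \<union> (\<Union>i<N. on_graph \<tau> (C i) - on_graph \<tau> (D i)))"
  proof (rule finite_measure_mono)
    show "on_graph \<tau> (\<Union>i. C i) - on_graph \<tau> (\<Union>i<N. D i)
        \<subseteq> ((\<Union>N. G N) - G N) \<union> (\<Union>i<N. on_graph \<tau> (C i) - on_graph \<tau> (D i))"
      unfolding GU by (auto simp: G_def on_graph_def)
    show "((\<Union>N. G N) - G N) \<union> (\<Union>i<N. on_graph \<tau> (C i) - on_graph \<tau> (D i)) \<in> events"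
      using Gs gr[OF C(2)] gr[OF Ds] by (intro sets.Un sets.Diff sets.finite_UN sets.countable_UN) auto
  qed
  also have "\<dots> \<le> prob ((\<Union>N. G N) - G N) + prob (\<Union>i<N. on_graph \<tau> (C i) - on_graph \<tau> (D i))"
    using Gs gr[OF C(2)] gr[OF Ds] by (intro measure_Un_le sets.Diff sets.finite_UN sets.countable_UN) auto
  also have "prob ((\<Union>N. G N) - G N) \<le> \<epsilon> / 2"
    using N Gs by (subst finite_measure_Diff) (auto intro!: sets.countable_UN)
  also have "prob (\<Union>i<N. on_graph \<tau> (C i) - on_graph \<tau> (D i)) \<le> (\<Sum>i<N. prob (on_graph \<tau> (C i) - on_graph \<tau> (D i)))"
    using gr[OF C(2)] gr[OF Ds] by (intro finite_measure_subadditive_finite) auto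
  also have "\<dots> \<le> real N * \<delta>" using sum_mono[of "{..<N}" _ "\<lambda>_. \<delta>"] D(3) by simp
  also have "\<epsilon> / 2 + real N * \<delta> \<le> \<epsilon>" using \<delta>(2) by simp
  finally have "prob (on_graph \<tau> (\<Union>i. C i) - on_graph \<tau> (\<Union>i<N. D i)) \<le> \<epsilon>" by simp
  moreover have "(\<Union>i<N. D i) \<subseteq> (\<Union>i. C i)" using D(2) by blast
  moreover have "closed_delta (\<Union>i<N. D i)" by (rule closed_delta_finite_UN[OF D(1)])
  ultimately show "\<exists>D. closed_delta D \<and> D \<subseteq> (\<Union>i. C i) \<and> prob (on_graph \<tau> (\<Union>i. C i) - on_graph \<tau> D) \<le> \<epsilon>"
    by blast
qed

lemma inner_approx_INT:
  assumes \<tau>: "\<tau> \<in> borel_measurable P"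
    and C: "\<And>i::nat. inner_approx \<tau> (C i)" "\<And>i. C i \<in> sets (predictable_sigma F)"
  shows "inner_approx \<tau> (\<Inter>i. C i)"
  unfolding inner_approx_def
proof (intro allI impI)
  fix \<epsilon> :: real assume \<epsilon>: "0 < \<epsilon>"
  note gr = on_graph_sets[OF \<tau>]
  define \<delta> where "\<delta> i = \<epsilon> * (1 / 2) ^ Suc i" for i
  have sums: "\<delta> sums \<epsilon>" unfolding \<delta>_def using sums_mult[OF power_half_series, of \<epsilon>] by simp
  have \<delta>: "0 < \<delta> i" for i using \<epsilon> by (simp add: \<delta>_def)
  have "\<forall>i. \<exists>D. closed_delta D \<and> D \<subseteq> C i \<and> prob (on_graph \<tau> (C i) - on_graph \<tau> D) \<le> \<delta> i"
    using C(1) \<delta> unfolding inner_approx_def by blast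
  from choice[OF this] obtain D :: "nat \<Rightarrow> (real \<times> 'a) set"
    where D0: "\<forall>i. closed_delta (D i) \<and> D i \<subseteq> C i \<and> prob (on_graph \<tau> (C i) - on_graph \<tau> (D i)) \<le> \<delta> i" ..
  have D: "closed_delta (D i)" "D i \<subseteq> C i" "prob (on_graph \<tau> (C i) - on_graph \<tau> (D i)) \<le> \<delta> i" for i
    using D0 by simp_all
  have Ds: "D i \<in> sets (predictable_sigma F)" for i by (rule closed_delta_predictable[OF D(1)])
  have CD: "on_graph \<tau> (C i) - on_graph \<tau> (D i) \<in> events" for i using gr[OF C(2)] gr[OF Ds] by (rule sets.Diff)
  have summ: "summable (\<lambda>i. prob (on_graph \<tau> (C i) - on_graph \<tau> (D i)))"
    by (rule summable_comparison_test[OF _ sums_summable[OF sums]]) (use D(3) in auto)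
  have "prob (on_graph \<tau> (\<Inter>i. C i) - on_graph \<tau> (\<Inter>i. D i)) \<le> prob (\<Union>i. on_graph \<tau> (C i) - on_graph \<tau> (D i))"
    using CD by (intro finite_measure_mono sets.countable_UN) (auto simp: on_graph_def)
  also have "\<dots> \<le> (\<Sum>i. prob (on_graph \<tau> (C i) - on_graph \<tau> (D i)))"
    using CD summ by (intro finite_measure_subadditive_countably) auto
  also have "\<dots> \<le> suminf \<delta>" by (rule suminf_le[OF D(3) summ sums_summable[OF sums]])
  also have "\<dots> = \<epsilon>" using sums by (rule sums_unique[symmetric])
  finally have "prob (on_graph \<tau> (\<Inter>i. C i) - on_graph \<tau> (\<Inter>i. D i)) \<le> \<epsilon>" .
  moreover have "(\<Inter>i. D i) \<subseteq> (\<Inter>i. C i)" using D(2) by blast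
  moreover have "closed_delta (\<Inter>i. D i)" by (rule closed_delta_INT[OF D(1)])
  ultimately show "\<exists>D. closed_delta D \<and> D \<subseteq> (\<Inter>i. C i) \<and> prob (on_graph \<tau> (\<Inter>i. C i) - on_graph \<tau> D) \<le> \<epsilon>"
    by blast
qed

lemma inner_approx_Un:
  assumes "\<tau> \<in> borel_measurable P" "inner_approx \<tau> C" "inner_approx \<tau> D"
    "C \<in> sets (predictable_sigma F)" "D \<in> sets (predictable_sigma F)"
  shows "inner_approx \<tau> (C \<union> D)"
proof -
  have "inner_approx \<tau> (\<Union>i::nat. if i = 0 then C else D)"
    by (rule inner_approx_UN) (use assms in auto)
  also have "(\<Union>i::nat. if i = 0 then C else D) = C \<union> D"
    by (auto split: if_splits intro: exI[of _ "Suc 0"])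
  finally show ?thesis .
qed

lemma simple_closed_UN:
  fixes t :: "nat \<Rightarrow> real"
  assumes "\<tau> \<in> borel_measurable P" "0 \<le> s" "B \<in> sets (F s)"
  shows "inner_approx \<tau> (\<Union>n. {s + 1 / real (Suc n)..t n} \<times> B)"
    "(\<Union>n. {s + 1 / real (Suc n)..t n} \<times> B) \<in> sets (predictable_sigma F)"
proof -
  have sc: "simple_closed F ({s + 1 / real (Suc n)..t n} \<times> B)" for n
    using assms by (intro simple_closed_rect[of s]) auto
  show "inner_approx \<tau> (\<Union>n. {s + 1 / real (Suc n)..t n} \<times> B)"
    by (intro inner_approx_UN assms inner_approx_simple simple_closed_predictable sc)
  show "(\<Union>n. {s + 1 / real (Suc n)..t n} \<times> B) \<in> sets (predictable_sigma F)"
    by (intro sets.countable_UN image_subsetI simple_closed_predictable sc)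
qed

lemma Ioc_UN: "{s<..t} \<times> B = (\<Union>n. {s + 1 / real (Suc n)..t} \<times> B)"
proof (intro set_eqI iffI)
  fix p assume p: "p \<in> {s<..t} \<times> B"
  then have "0 < fst p - s" by auto
  from nat_approx_posE[OF this] obtain n where "1 / real (Suc n) < fst p - s" .
  then show "p \<in> (\<Union>n. {s + 1 / real (Suc n)..t} \<times> B)" using p by (auto intro!: exI[of _ n])
next
  fix p assume "p \<in> (\<Union>n. {s + 1 / real (Suc n)..t} \<times> B)"
  then obtain n where p: "p \<in> {s + 1 / real (Suc n)..t} \<times> B" by blast
  have "s < s + 1 / real (Suc n)" by simp
  also have "\<dots> \<le> fst p" using p by (auto simp del: of_nat_Suc)
  finally show "p \<in> {s<..t} \<times> B" using p by (cases p) auto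
qed

lemma Ioi_UN: "{s<..} \<times> B = (\<Union>n. {s + 1 / real (Suc n)..s + real n} \<times> B)"
proof (intro set_eqI iffI)
  fix p assume p: "p \<in> {s<..} \<times> B"
  then have "0 < fst p - s" by auto
  from nat_approx_posE[OF this] obtain n where n: "1 / real (Suc n) < fst p - s" .
  obtain m where m: "fst p - s \<le> real m" using real_arch_simple by blast
  have "1 / real (Suc (max n m)) \<le> 1 / real (Suc n)" by (intro divide_left_mono) auto
  then have "p \<in> {s + 1 / real (Suc (max n m))..s + real (max n m)} \<times> B" using p n m by (cases p) auto
  then show "p \<in> (\<Union>n. {s + 1 / real (Suc n)..s + real n} \<times> B)" by blast
next
  fix p assume "p \<in> (\<Union>n. {s + 1 / real (Suc n)..s + real n} \<times> B)"
  then obtain n where p: "p \<in> {s + 1 / real (Suc n)..s + real n} \<times> B" by blast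
  have "s < s + 1 / real (Suc n)" by simp
  also have "\<dots> \<le> fst p" using p by (auto simp del: of_nat_Suc)
  finally show "p \<in> {s<..} \<times> B" using p by (cases p) auto
qed

text \<open>
  The sets that are approximable together with their complements form a \<open>\<sigma>\<close>-algebra; it contains the
  generators because these and their complements are countable unions of simple closed sets.
\<close>

lemma inner_approx_predictable:
  assumes \<tau>: "\<tau> \<in> borel_measurable P" and C: "C \<in> sets (predictable_sigma F)"
  shows "inner_approx \<tau> C"
proof -
  let ?\<Omega> = "{0..} \<times> space P"
  have top: "space P \<in> sets (F t)" for t using sets.top[of "F t"] by (simp add: space_F)
  have Ioc: "inner_approx \<tau> ({s<..t} \<times> B)" if "0 \<le> s" "B \<in> sets (F s)" for s t B
    unfolding Ioc_UN by (rule simple_closed_UN(1)[OF \<tau> that])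
  have Ioi: "inner_approx \<tau> ({s<..} \<times> B)" if "0 \<le> s" "B \<in> sets (F s)" for s B
    unfolding Ioi_UN by (rule simple_closed_UN(1)[OF \<tau> that])
  have zero: "inner_approx \<tau> ({0} \<times> B)" if "B \<in> sets (F 0)" for B
  proof -
    have "inner_approx \<tau> ({0..0} \<times> B)" using that by (intro inner_approx_simple simple_closed_rect[of 0]) auto
    then show ?thesis by simp
  qed
  have compl: "space P - B \<in> sets (F s)" if "B \<in> sets (F s)" for s B
    using sets.compl_sets[OF that] by (simp add: space_F)
  have "inner_approx \<tau> C \<and> inner_approx \<tau> (?\<Omega> - C)"
    using C unfolding sets_predictable
  proof (induction rule: sigma_sets.induct)
    case (Basic C)
    then consider B where "C = {0} \<times> B" "B \<in> sets (F 0)"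
      | s t B where "C = {s<..t} \<times> B" "0 \<le> s" "s \<le> t" "B \<in> sets (F s)" by blast
    then show ?case
    proof cases
      case (1 B)
      have "inner_approx \<tau> ({0} \<times> (space P - B) \<union> {0<..} \<times> space P)"
        using 1 by (intro inner_approx_Un \<tau> zero Ioi compl top predictable_zero predictable_Ioi order_refl)
      also have "{0} \<times> (space P - B) \<union> {0<..} \<times> space P = ?\<Omega> - C"
        using sets.sets_into_space[OF 1(2)] 1 by (auto simp: space_F)
      finally show ?thesis using zero 1 by simp
    next
      case (2 s t B)
      have t: "0 \<le> t" using 2 by simp
      have "inner_approx \<tau> ((({0} \<times> space P \<union> {0<..s} \<times> space P) \<union> {s<..t} \<times> (space P - B)) \<union> {t<..} \<times> space P)"
        using 2 t by (intro inner_approx_Un \<tau> zero Ioc Ioi compl top sets.Un predictable_zero predictable_Ioc predictable_Ioi order_refl)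
      also have "(({0} \<times> space P \<union> {0<..s} \<times> space P) \<union> {s<..t} \<times> (space P - B)) \<union> {t<..} \<times> space P = ?\<Omega> - C"
        using sets.sets_into_space[OF 2(4)] 2 by (auto simp: space_F)
      finally show ?thesis using Ioc 2 by simp
    qed
  next
    case Empty
    have "inner_approx \<tau> ({0} \<times> space P \<union> {0<..} \<times> space P)"
      by (intro inner_approx_Un \<tau> zero Ioi top predictable_zero predictable_Ioi order_refl)
    also have "{0::real} \<times> space P \<union> {0<..} \<times> space P = ?\<Omega>" by auto
    finally show ?case by (simp add: inner_approx_simple simple_closed.empty)
  next
    case (Compl C)
    then have "C \<subseteq> ?\<Omega>" using sigma_sets_into_sp predictable_generators by (metis (no_types, lifting) sets.sets_into_space sets_predictable space_predictable)
    then have "?\<Omega> - (?\<Omega> - C) = C" by blast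
    then show ?case using Compl by simp
  next
    case (Union C)
    have Cs: "C i \<in> sets (predictable_sigma F)" for i using Union(1) by (simp add: sets_predictable)
    have Cs': "?\<Omega> - C i \<in> sets (predictable_sigma F)" for i
      using sets.compl_sets[OF Cs[of i]] by (simp add: space_predictable)
    have "inner_approx \<tau> (\<Inter>i. ?\<Omega> - C i)"
      using Union by (intro inner_approx_INT \<tau> Cs') auto
    also have "(\<Inter>i. ?\<Omega> - C i) = ?\<Omega> - (\<Union>i. C i)" by blast
    finally show ?case using Union by (auto intro!: inner_approx_UN \<tau> Cs)
  qed
  then show ?thesis by simp
qed

end

section \<open>Announcing sequences\<close>

context usual_filtered_prob_space
begin

text \<open>
  Compactness: if the intersection of decreasing closed sections has no point up to time \<open>b\<close>, then
  neither has one of the sections.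
\<close>

lemma decreasing_closed_escape:
  fixes L :: "nat \<Rightarrow> (real \<times> 'a) set"
  assumes cl: "\<And>n. closed {t. (t, \<omega>) \<in> L n}" and pos: "\<And>n. L n \<subseteq> {0..} \<times> space P"
    and dec: "\<And>m n. m \<le> n \<Longrightarrow> L n \<subseteq> L m"
    and out: "\<And>t. (t, \<omega>) \<in> (\<Inter>n. L n) \<Longrightarrow> b < t"
  shows "\<exists>n0. \<forall>n\<ge>n0. \<forall>t. (t, \<omega>) \<in> L n \<longrightarrow> b \<le> t"
proof (rule ccontr)
  assume *: "\<not> ?thesis"
  define A where "A n = {t. (t, \<omega>) \<in> L n} \<inter> {0..b}" for n
  have "\<Inter>(range A) \<noteq> {}"
  proof (rule compact_nest)
    show "compact (A n)" for n unfolding A_def by (intro closed_Int_compact cl) simp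
    show "A n \<subseteq> A m" if "m \<le> n" for m n using dec[OF that] unfolding A_def by blast
    show "A n \<noteq> {}" for n
    proof -
      from * obtain m t where m: "n \<le> m" "(t, \<omega>) \<in> L m" "\<not> b \<le> t" by blast
      then have "(t, \<omega>) \<in> L n" using dec by blast
      then have "t \<in> A n" using m(3) pos[of n] by (auto simp: A_def)
      then show ?thesis by blast
    qed
  qed
  then obtain t where t: "\<And>n. t \<in> A n" by blast
  then have "(t, \<omega>) \<in> (\<Inter>n. L n)" "t \<le> b" by (auto simp: A_def)
  then show False using out by fastforce
qed

text \<open>
  The approximation of one inner set of the graph: a stopping time that lies strictly before the
  graph wherever the inner set meets it, and close to it up to a small probability.
\<close>

lemma announce_step:
  fixes j :: nat
  assumes \<tau>: "\<tau> \<in> borel_measurable P" and D: "closed_delta D"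
    and graph: "\<And>t \<omega>. (t, \<omega>) \<in> D \<Longrightarrow> \<tau> \<omega> = ennreal t"
  defines "d \<equiv> \<lambda>\<omega>. if \<omega> \<in> on_graph \<tau> D then min (real j) (enn2real (\<tau> \<omega>)) else real j"
  shows "\<exists>E :: 'a \<Rightarrow> real. stops_before D E \<and>
    {\<omega>\<in>space P. E \<omega> < d \<omega> - 1 / real (Suc j)} \<in> events \<and>
    prob {\<omega>\<in>space P. E \<omega> < d \<omega> - 1 / real (Suc j)} < (1 / 2) ^ j"
proof -
  obtain K :: "nat \<Rightarrow> (real \<times> 'a) set" where K: "\<forall>n. simple_closed F (K n)" "D = (\<Inter>n. K n)"
    using D unfolding closed_delta_def by (elim exE conjE)
  define L where "L n = (\<Inter>m\<in>{..n}. K m)" for n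
  have Lsc: "simple_closed F (L n)" for n
  proof (induction n)
    case (Suc n)
    then show ?case using simple_closed_Int[of "K (Suc n)" "L n"] K(1) by (simp add: L_def atMost_Suc)
  qed (use K(1) in \<open>simp add: L_def\<close>)
  have LD: "(\<Inter>n. L n) = D" unfolding K(2) L_def by auto
  have Ldec: "L n \<subseteq> L m" if "m \<le> n" for m n using that unfolding L_def by auto
  have "\<forall>n. \<exists>E :: 'a \<Rightarrow> real. stops_before (L n) E \<and>
    (\<forall>c \<omega>. (\<forall>t. (t, \<omega>) \<in> L n \<longrightarrow> c \<le> t) \<longrightarrow> c \<le> 1 / (1 / real (Suc n)) \<longrightarrow> c - 1 / real (Suc n) \<le> E \<omega>)"
    by (intro allI simple_closed_announce Lsc) simp
  from choice[OF this] obtain E :: "nat \<Rightarrow> 'a \<Rightarrow> real" where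
    E0: "\<forall>n. stops_before (L n) (E n) \<and>
    (\<forall>c \<omega>. (\<forall>t. (t, \<omega>) \<in> L n \<longrightarrow> c \<le> t) \<longrightarrow> c \<le> 1 / (1 / real (Suc n)) \<longrightarrow> c - 1 / real (Suc n) \<le> E n \<omega>)" ..
  have E: "\<forall>x\<ge>0. {\<omega>\<in>space P. E n \<omega> \<le> x} \<in> sets (F x)" "\<forall>\<omega>. 0 \<le> E n \<omega>"
    "\<forall>t \<omega>. (t, \<omega>) \<in> L n \<longrightarrow> E n \<omega> \<le> t \<and> (0 < t \<longrightarrow> E n \<omega> < t)"
    "\<And>c \<omega>. (\<forall>t. (t, \<omega>) \<in> L n \<longrightarrow> c \<le> t) \<Longrightarrow> c \<le> real (Suc n) \<Longrightarrow> c - 1 / real (Suc n) \<le> E n \<omega>" for n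
    using spec[OF E0, of n] unfolding stops_before_def by simp_all
  have Em [measurable]: "E n \<in> borel_measurable P" for n
  proof (rule borel_measurableI_le)
    fix x
    show "{\<omega>\<in>space P. E n \<omega> \<le> x} \<in> events"
    proof (cases "0 \<le> x")
      case True
      then show ?thesis using F_sub E(1)[of n] by blast
    next
      case False
      have "\<not> E n \<omega> \<le> x" for \<omega> using False E(2)[of n, rule_format, of \<omega>] by linarith
      then show ?thesis by simp
    qed
  qed
  have [measurable]: "on_graph \<tau> D \<in> events" by (rule on_graph_sets[OF \<tau> closed_delta_predictable[OF D]])
  have [measurable]: "d \<in> borel_measurable P" unfolding d_def using \<tau> by measurable
  define W where "W m = {\<omega>\<in>space P. E m \<omega> < d \<omega> - 1 / real (Suc j)}" for m
  have Wm: "W m \<in> events" for m unfolding W_def by measurable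
  have ev: "\<exists>n0. \<forall>n\<ge>n0. \<omega> \<notin> W n" if w: "\<omega> \<in> space P" for \<omega>
  proof -
    \<comment> \<open>one half of the tolerance is spent on \<open>L n\<close> against \<open>D\<close>, the other on \<open>E n\<close> against \<open>L n\<close>\<close>
    define b where "b = d \<omega> - 1 / (2 * real (Suc j))"
    have "\<exists>n0. \<forall>n\<ge>n0. \<forall>t. (t, \<omega>) \<in> L n \<longrightarrow> b \<le> t"
    proof (rule decreasing_closed_escape)
      fix t assume "(t, \<omega>) \<in> (\<Inter>n. L n)"
      then have tD: "(t, \<omega>) \<in> D" unfolding LD .
      then have t: "0 \<le> t" using simple_closed_subset[OF Lsc[of 0]] LD by auto
      have "\<omega> \<in> on_graph \<tau> D" using graph[OF tD] tD w t by (simp add: on_graph_def)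
      then have "d \<omega> \<le> t" using graph[OF tD] t by (simp add: d_def)
      then show "b < t" unfolding b_def by (smt (verit) divide_pos_pos of_nat_0_less_iff zero_less_Suc)
    qed (use simple_closed_section_closed[OF Lsc] simple_closed_subset[OF Lsc] Ldec in auto)
    then obtain n0 where n0: "\<And>n t. n \<ge> n0 \<Longrightarrow> (t, \<omega>) \<in> L n \<Longrightarrow> b \<le> t" by blast
    have "\<omega> \<notin> W n" if n: "n \<ge> max n0 (2 * Suc j)" for n
    proof -
      have "d \<omega> \<le> real j" by (simp add: d_def)
      also have "\<dots> \<le> real (Suc n)" using n by simp
      finally have "d \<omega> \<le> real (Suc n)" .
      moreover have "0 < 1 / (2 * real (Suc j))" by simp
      ultimately have "b \<le> real (Suc n)" unfolding b_def by linarith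
      then have 1: "b - 1 / real (Suc n) \<le> E n \<omega>" using n n0[of n] by (intro E(4)) auto
      have "1 / real (Suc n) \<le> 1 / (2 * real (Suc j))" using n by (intro divide_left_mono) auto
      then have "d \<omega> - (1 / (2 * real (Suc j)) + 1 / (2 * real (Suc j))) \<le> E n \<omega>" using 1 unfolding b_def by linarith
      also have "1 / (2 * real (Suc j)) + 1 / (2 * real (Suc j)) = 1 / real (Suc j)" by (simp add: field_simps)
      finally show ?thesis by (simp add: W_def not_less)
    qed
    then show ?thesis by blast
  qed
  have "(\<lambda>n. prob (\<Union>m\<in>{n..}. W m)) \<longlonglongrightarrow> prob (\<Inter>n. \<Union>m\<in>{n..}. W m)"
  proof (rule finite_Lim_measure_decseq)
    show "range (\<lambda>n. \<Union>m\<in>{n..}. W m) \<subseteq> events" using Wm by auto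
    show "decseq (\<lambda>n. \<Union>m\<in>{n..}. W m)" by (intro decseq_SucI UN_mono) auto
  qed
  also have "(\<Inter>n. \<Union>m\<in>{n..}. W m) = {}"
  proof -
    have "\<omega> \<notin> (\<Inter>n. \<Union>m\<in>{n..}. W m)" for \<omega>
    proof
      assume *: "\<omega> \<in> (\<Inter>n. \<Union>m\<in>{n..}. W m)"
      then have "\<omega> \<in> space P" by (auto simp: W_def)
      from ev[OF this] obtain n0 where "\<forall>n\<ge>n0. \<omega> \<notin> W n" ..
      then show False using INT_D[OF *, of n0] by auto
    qed
    then show ?thesis by blast
  qed
  finally have "(\<lambda>n. prob (\<Union>m\<in>{n..}. W m)) \<longlonglongrightarrow> 0" by simp
  then have "\<forall>\<^sub>F n in sequentially. prob (\<Union>m\<in>{n..}. W m) < (1 / 2) ^ j" by (rule order_tendstoD) simp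
  then obtain n where n: "prob (\<Union>m\<in>{n..}. W m) < (1 / 2) ^ j"
    by (meson eventually_happens trivial_limit_sequentially)
  have "prob (W n) \<le> prob (\<Union>m\<in>{n..}. W m)" using Wm by (intro finite_measure_mono) auto
  then have "prob (W n) < (1 / 2) ^ j" using n by linarith
  moreover have "\<forall>t \<omega>. (t, \<omega>) \<in> D \<longrightarrow> E n \<omega> \<le> t \<and> (0 < t \<longrightarrow> E n \<omega> < t)"
    using E(3)[of n] LD by blast
  ultimately show ?thesis
    using E(1)[of n] E(2)[of n] Wm[of n] unfolding W_def stops_before_def by (intro exI[of _ "E n"] conjI)
qed

lemma stop_time_INF:
  fixes S :: "nat \<Rightarrow> 'a \<Rightarrow> ennreal"
  assumes "\<And>j. stop_time F (S j)"
  shows "stop_time F (\<lambda>\<omega>. INF j\<in>J. S j \<omega>)"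
proof (rule stop_ltI)
  fix t :: real assume t: "0 < t"
  have "{\<omega>\<in>space P. (INF j\<in>J. S j \<omega>) < ennreal t} = (\<Union>j\<in>J. {\<omega>\<in>space P. S j \<omega> < ennreal t})"
    by (auto simp: INF_less_iff)
  also have "\<dots> \<in> sets (F t)" using stop_lt[OF assms t] by (intro sets.countable_UN') auto
  finally show "{\<omega>\<in>space P. (INF j\<in>J. S j \<omega>) < ennreal t} \<in> sets (F t)" .
qed

lemma stop_time_AE_cong:
  assumes "stop_time F \<tau>" "AE \<omega> in P. \<tau> \<omega> = \<rho> \<omega>"
  shows "stop_time F \<rho>"
  unfolding stop_iff
proof (intro allI impI)
  fix t :: real assume t: "0 \<le> t"
  show "{\<omega> \<in> space P. \<rho> \<omega> \<le> ennreal t} \<in> sets (F t)"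
    by (rule F_AE_eq_set[OF t stop_le[OF assms(1) t]]) (use assms(2) in auto)
qed

text \<open>
  A random time whose graph is a predictable set is announced by an increasing sequence of
  stopping times.  The graph is exhausted, up to a null set, by countable intersections \<open>D j\<close> of
  simple closed sets; stopping times just before \<open>D j\<close> are turned into an increasing sequence by
  taking tail infima, which Borel-Cantelli controls.
\<close>

lemma announcing_sequence_exists:
  assumes \<tau>: "\<tau> \<in> borel_measurable P" and C: "C \<in> sets (predictable_sigma F)"
    and graph: "\<And>t \<omega>. 0 \<le> t \<Longrightarrow> \<omega> \<in> space P \<Longrightarrow> (t, \<omega>) \<in> C \<longleftrightarrow> \<tau> \<omega> = ennreal t"
  shows "\<exists>\<tau>s. announcing_sequence F \<tau> \<tau>s"
proof -
  have Csub: "C \<subseteq> {0..} \<times> space P" using sets.sets_into_space[OF C] by (simp add: space_predictable)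
  have "\<forall>j. \<exists>D. closed_delta D \<and> D \<subseteq> C \<and> prob (on_graph \<tau> C - on_graph \<tau> D) \<le> (1 / 2) ^ j"
    using inner_approx_predictable[OF \<tau> C] unfolding inner_approx_def by simp
  from choice[OF this] obtain D :: "nat \<Rightarrow> (real \<times> 'a) set"
    where D0: "\<forall>j. closed_delta (D j) \<and> D j \<subseteq> C \<and> prob (on_graph \<tau> C - on_graph \<tau> (D j)) \<le> (1 / 2) ^ j" ..
  have D: "closed_delta (D j)" "D j \<subseteq> C" "prob (on_graph \<tau> C - on_graph \<tau> (D j)) \<le> (1 / 2) ^ j" for j
    using D0 by simp_all
  have grD: "\<tau> \<omega> = ennreal t" if "(t, \<omega>) \<in> D j" for t \<omega> j
  proof -
    have "(t, \<omega>) \<in> C" using that D(2) by blast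
    then show ?thesis using graph[of t \<omega>] Csub by blast
  qed
  have all_graph: "on_graph \<tau> C = {\<omega>\<in>space P. \<tau> \<omega> \<noteq> \<top>}"
    using graph by (auto simp: on_graph_def less_top)
  define d where "d j \<omega> = (if \<omega> \<in> on_graph \<tau> (D j) then min (real j) (enn2real (\<tau> \<omega>)) else real j)" for j \<omega>
  have "\<forall>j. \<exists>E :: 'a \<Rightarrow> real. stops_before (D j) E \<and>
    {\<omega>\<in>space P. E \<omega> < d j \<omega> - 1 / real (Suc j)} \<in> events \<and>
    prob {\<omega>\<in>space P. E \<omega> < d j \<omega> - 1 / real (Suc j)} < (1 / 2) ^ j"
    unfolding d_def by (intro allI announce_step \<tau> D(1) grD)
  from choice[OF this] obtain E :: "nat \<Rightarrow> 'a \<Rightarrow> real" where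
    E0: "\<forall>j. stops_before (D j) (E j) \<and>
    {\<omega>\<in>space P. E j \<omega> < d j \<omega> - 1 / real (Suc j)} \<in> events \<and>
    prob {\<omega>\<in>space P. E j \<omega> < d j \<omega> - 1 / real (Suc j)} < (1 / 2) ^ j" ..
  have E: "\<And>x. 0 \<le> x \<Longrightarrow> {\<omega>\<in>space P. E j \<omega> \<le> x} \<in> sets (F x)" "\<And>\<omega>. 0 \<le> E j \<omega>"
    "\<And>t \<omega>. (t, \<omega>) \<in> D j \<Longrightarrow> E j \<omega> \<le> t \<and> (0 < t \<longrightarrow> E j \<omega> < t)"
    "{\<omega>\<in>space P. E j \<omega> < d j \<omega> - 1 / real (Suc j)} \<in> events"
    "prob {\<omega>\<in>space P. E j \<omega> < d j \<omega> - 1 / real (Suc j)} < (1 / 2) ^ j" for j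
    using spec[OF E0, of j] unfolding stops_before_def by simp_all
  define B where "B j = {\<omega>\<in>space P. E j \<omega> < d j \<omega> - 1 / real (Suc j)} \<union> (on_graph \<tau> C - on_graph \<tau> (D j))" for j
  have CD: "on_graph \<tau> C - on_graph \<tau> (D j) \<in> events" for j
    by (intro sets.Diff on_graph_sets[OF \<tau>] C closed_delta_predictable D(1))
  have Bs: "B j \<in> events" for j unfolding B_def by (intro sets.Un E(4) CD)
  have "prob (B j) \<le> 2 * (1 / 2) ^ j" for j
  proof -
    have "prob (B j) \<le> prob {\<omega>\<in>space P. E j \<omega> < d j \<omega> - 1 / real (Suc j)} + prob (on_graph \<tau> C - on_graph \<tau> (D j))"
      unfolding B_def by (intro measure_Un_le E(4) CD)
    then show ?thesis using E(5)[of j] D(3)[of j] by linarith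
  qed
  then have "summable (\<lambda>j. prob (B j))"
    by (intro summable_comparison_test[OF _ summable_mult[OF summable_geometric[of "1/2::real"], of 2]]) auto
  then have good: "AE \<omega> in P. eventually (\<lambda>j. \<omega> \<in> space P - B j) sequentially"
    by (intro borel_cantelli_AE1[OF Bs]) (simp_all add: emeasure_eq_measure)
  define S where "S n \<omega> = (INF j\<in>{n..}. ennreal (E j \<omega>))" for n \<omega>
  have Sstop: "stop_time F (S n)" for n
  proof -
    have "stop_time F (\<lambda>\<omega>. ennreal (E j \<omega>))" for j
      unfolding stop_iff using E(1)[of _ j] by simp
    then show ?thesis unfolding S_def[abs_def] by (rule stop_time_INF)
  qed
  define is_ann :: "'a \<Rightarrow> (nat \<Rightarrow> ennreal) \<Rightarrow> bool" where "is_ann \<omega> f \<longleftrightarrow>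
    incseq f \<and> f \<longlonglongrightarrow> \<tau> \<omega> \<and> (0 < \<tau> \<omega> \<longrightarrow> (\<forall>n. f n < \<tau> \<omega>)) \<and> (\<tau> \<omega> = 0 \<longrightarrow> (\<forall>n. f n = 0))" for \<omega> f
  have inc: "incseq (\<lambda>n. S n \<omega>)" for \<omega> unfolding S_def by (intro incseq_SucI INF_superset_mono) auto
  have annS: "is_ann \<omega> (\<lambda>n. S n \<omega>)" if w: "\<omega> \<in> space P" and ev: "eventually (\<lambda>j. \<omega> \<in> space P - B j) sequentially" for \<omega>
  proof -
    from ev obtain J where J: "\<And>j. j \<ge> J \<Longrightarrow> \<omega> \<notin> B j" by (auto simp: eventually_sequentially)
    have low: "d j \<omega> - 1 / real (Suc j) \<le> E j \<omega>" if "j \<ge> J" for j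
      using J[OF that] w by (auto simp: B_def)
    have S_ge: "ennreal x \<le> S n \<omega>" if "\<And>j. j \<ge> n \<Longrightarrow> x \<le> E j \<omega>" for x n
      unfolding S_def by (rule INF_greatest) (use that in \<open>auto intro!: ennreal_leI\<close>)
    show ?thesis
    proof (cases "\<tau> \<omega>")
      case (real r)
      then have inD: "\<omega> \<in> on_graph \<tau> (D j)" if "j \<ge> J" for j
        using J[OF that] w all_graph by (auto simp: B_def)
      have rD: "(r, \<omega>) \<in> D j" if "j \<ge> J" for j using inD[OF that] real by (auto simp: on_graph_def)
      have S_le: "S n \<omega> \<le> ennreal (E (max n J) \<omega>)" for n unfolding S_def by (rule INF_lower) simp
      have lt: "S n \<omega> < \<tau> \<omega>" if "0 < \<tau> \<omega>" for n
      proof -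
        have "0 < r" using that real by simp
        then have "E (max n J) \<omega> < r" using E(3)[OF rD[of "max n J"]] by simp
        then have "ennreal (E (max n J) \<omega>) < ennreal r" using E(2) by (simp add: ennreal_less_iff)
        then show ?thesis using S_le[of n] real by simp
      qed
      have zero: "S n \<omega> = 0" if "\<tau> \<omega> = 0" for n
      proof -
        have "r = 0" using that real by simp
        then have "E (max n J) \<omega> \<le> 0" using E(3)[OF rD[of "max n J"]] by simp
        then show ?thesis using S_le[of n] by (simp add: ennreal_neg)
      qed
      have le: "S n \<omega> \<le> ennreal r" for n
        using lt[of n] zero[of n] real by (cases "r = 0") (auto simp: less_imp_le)
      have "(\<lambda>n. S n \<omega>) \<longlonglongrightarrow> ennreal r"
      proof (rule tendsto_sandwich)
        have "(\<lambda>n. r - 1 / real (Suc n)) \<longlonglongrightarrow> r - 0"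
          by (intro tendsto_diff tendsto_const LIMSEQ_Suc lim_const_over_n)
        then show "(\<lambda>n. ennreal (r - 1 / real (Suc n))) \<longlonglongrightarrow> ennreal r" by (intro tendsto_ennrealI) simp
        obtain m where m: "r \<le> real m" using real_arch_simple by blast
        show "\<forall>\<^sub>F n in sequentially. ennreal (r - 1 / real (Suc n)) \<le> S n \<omega>"
        proof (rule eventually_sequentiallyI[of "max m J"], rule S_ge)
          fix n j assume n: "max m J \<le> n" "n \<le> j"
          have "d j \<omega> = r" using inD[of j] n m real by (simp add: d_def)
          then have "r - 1 / real (Suc j) \<le> E j \<omega>" using low[of j] n by simp
          moreover have "1 / real (Suc j) \<le> 1 / real (Suc n)" using n by (intro divide_left_mono) auto
          ultimately show "r - 1 / real (Suc n) \<le> E j \<omega>" by linarith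
        qed
      qed (use le in auto)
      then show ?thesis using inc lt zero real unfolding is_ann_def by simp
    next
      case top
      then have "\<omega> \<notin> on_graph \<tau> (D j)" for j by (simp add: on_graph_def)
      then have dj: "d j \<omega> = real j" for j by (simp add: d_def)
      have "S n \<omega> < \<top>" for n unfolding S_def by (auto simp: INF_less_iff intro!: bexI[of _ n])
      moreover have "(\<lambda>n. S n \<omega>) \<longlonglongrightarrow> \<top>"
      proof (rule tendsto_sandwich)
        show "(\<lambda>n. ennreal (real n - 1)) \<longlonglongrightarrow> \<top>"
          by (rule LIMSEQ_imp_Suc) (simp add: of_nat_tendsto_top_ennreal flip: ennreal_of_nat_eq_real_of_nat)
        show "\<forall>\<^sub>F n in sequentially. ennreal (real n - 1) \<le> S n \<omega>"
        proof (rule eventually_sequentiallyI[of J], rule S_ge)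
          fix n j assume n: "J \<le> n" "n \<le> j"
          have "1 / real (Suc j) \<le> 1" by simp
          moreover have "real j - 1 / real (Suc j) \<le> E j \<omega>" using low[of j] dj[of j] n by simp
          moreover have "real n \<le> real j" using n by simp
          ultimately show "real n - 1 \<le> E j \<omega>" by linarith
        qed
      qed auto
      ultimately show ?thesis using inc top unfolding is_ann_def by simp
    qed
  qed
  have "\<forall>\<omega>. \<exists>f. is_ann \<omega> f"
    unfolding is_ann_def by (rule allI) (metis announcing_constants)
  from choice[OF this] obtain g where g: "\<forall>\<omega>. is_ann \<omega> (g \<omega>)" ..
  \<comment> \<open>on the exceptional null set any announcing constants will do\<close>
  define \<tau>s where "\<tau>s n \<omega> = (if eventually (\<lambda>j. \<omega> \<in> space P - B j) sequentially then S n \<omega> else g \<omega> n)" for n \<omega>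
  have ann: "is_ann \<omega> (\<lambda>n. \<tau>s n \<omega>)" if "\<omega> \<in> space P" for \<omega>
  proof (cases "eventually (\<lambda>j. \<omega> \<in> space P - B j) sequentially")
    case True
    then show ?thesis using annS[OF that True] unfolding \<tau>s_def by (simp only: if_True)
  next
    case False
    then show ?thesis using g unfolding \<tau>s_def by (simp only: if_False)
  qed
  have stop: "stop_time F (\<tau>s n)" for n
    using Sstop
  proof (rule stop_time_AE_cong)
    show "AE \<omega> in P. S n \<omega> = \<tau>s n \<omega>" using good by eventually_elim (simp add: \<tau>s_def)
  qed
  show ?thesis
    unfolding announcing_sequence_def
    by (intro exI[of _ \<tau>s] conjI allI ballI stop) (use ann in \<open>auto simp: is_ann_def space_F\<close>)
qed

text \<open>
  The graph of the hitting time is \<open>{H \<ge> b}\<close> without the points strictly after the hitting time, and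
  both sets are predictable.
\<close>

lemma hit_H_announcing_exists:
  assumes H: "predictable_process F H"
    "\<And>\<omega>. \<omega> \<in> space P \<Longrightarrow> right_continuous_path (\<lambda>t. H t \<omega>) \<and> mono_on {0..} (\<lambda>t. H t \<omega>)"
  shows "\<exists>\<tau>s. announcing_sequence F (hit_H H b) \<tau>s"
proof -
  have ad: "adapted F H" by (rule predictable_imp_adapted[OF H(1)])
  have st: "stop_time F (hit_H H b)" by (rule hit_H_stop[OF ad H(2)])
  define C1 where "C1 = (\<lambda>(t, \<omega>). H t \<omega>) -` {b..} \<inter> space (predictable_sigma F)"
  define C2 where "C2 = (\<Union>q\<in>\<rat> \<inter> {0..}. {q<..} \<times> {\<omega>\<in>space P. hit_H H b \<omega> \<le> ennreal q})"
  have "C1 \<in> sets (predictable_sigma F)"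
    unfolding C1_def using H(1) unfolding predictable_process_def by (rule measurable_sets) simp
  moreover have "C2 \<in> sets (predictable_sigma F)"
    unfolding C2_def
  proof (rule sets.countable_UN'')
    show "countable (\<rat> \<inter> {0::real..})" by (simp add: countable_rat)
  qed (auto intro!: predictable_Ioi stop_le[OF st])
  ultimately have C: "C1 - C2 \<in> sets (predictable_sigma F)" by (rule sets.Diff)
  show ?thesis
  proof (rule announcing_sequence_exists[OF stop_measurable[OF st] C])
    fix t \<omega> assume t: "(0::real) \<le> t" and w: "\<omega> \<in> space P"
    have 1: "(t, \<omega>) \<in> C1 \<longleftrightarrow> hit_H H b \<omega> \<le> ennreal t"
      using t w H(2)[OF w] by (simp add: C1_def space_predictable hit_H_le_iff)
    have 2: "(t, \<omega>) \<in> C2 \<longleftrightarrow> hit_H H b \<omega> < ennreal t"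
    proof
      assume "(t, \<omega>) \<in> C2"
      then obtain q where q: "0 \<le> q" "q < t" "hit_H H b \<omega> \<le> ennreal q" by (auto simp: C2_def)
      then show "hit_H H b \<omega> < ennreal t" by (auto intro: le_less_trans ennreal_lessI)
    next
      assume "hit_H H b \<omega> < ennreal t"
      then obtain r where r: "0 \<le> r" "hit_H H b \<omega> = ennreal r" "r < t"
        by (cases "hit_H H b \<omega>") (auto simp: ennreal_less_iff)
      then obtain q where "q \<in> \<rat>" "r < q" "q < t" using Rats_dense_in_real by blast
      then show "(t, \<omega>) \<in> C2" using r w by (auto simp: C2_def intro!: bexI[of _ q] ennreal_leI)
    qed
    show "(t, \<omega>) \<in> C1 - C2 \<longleftrightarrow> hit_H H b \<omega> = ennreal t"
      using 1 2 by (auto simp: not_less)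
  qed
qed

end

section \<open>Upcrossings and limits along the rationals\<close>

text \<open>
  The flag tells whether a unit is held: it is bought at the first value \<open>\<le> a\<close> and sold at the next
  value \<open>\<ge> b\<close>; sales are counted.
\<close>

fun upcrossings :: "real \<Rightarrow> real \<Rightarrow> bool \<Rightarrow> real list \<Rightarrow> nat" where
  "upcrossings a b h [] = 0"
| "upcrossings a b False (y # ys) = (if y \<le> a then upcrossings a b True ys else upcrossings a b False ys)"
| "upcrossings a b True (y # ys) = (if b \<le> y then Suc (upcrossings a b False ys) else upcrossings a b True ys)"

text \<open>
  Holding a unit from the start is worth at most one additional sale.  This makes the greedy count
  monotone under inserting further values.
\<close>

lemma upcrossings_flip:
  "a < b \<Longrightarrow> upcrossings a b False ys \<le> upcrossings a b True ys
    \<and> upcrossings a b True ys \<le> Suc (upcrossings a b False ys)"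
  by (induction ys) auto

lemma upcrossings_Cons_mono: "a < b \<Longrightarrow> upcrossings a b h ys \<le> upcrossings a b h (y # ys)"
  using upcrossings_flip[of a b ys] by (cases h) auto

lemma upcrossings_subseq: "subseq xs ys \<Longrightarrow> a < b \<Longrightarrow> upcrossings a b h xs \<le> upcrossings a b h ys"
proof (induction arbitrary: h rule: list_emb.induct)
  case (list_emb_Cons xs ys y)
  then show ?case using upcrossings_Cons_mono[of a b h ys y] order_trans by blast
next
  case (list_emb_Cons2 x y xs ys)
  then show ?case by (cases h) auto
qed simp

lemma subseq_sorted_list_of_set:
  fixes A B :: "real set"
  assumes "finite B" "A \<subseteq> B"
  shows "subseq (sorted_list_of_set A) (sorted_list_of_set B)"
proof -
  have fin: "finite A" using assms finite_subset by blast
  have "sorted_list_of_set A = filter (\<lambda>x. x \<in> A) (sorted_list_of_set B)"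
    by (rule sorted_distinct_set_unique) (use assms fin in \<open>auto intro: sorted_wrt_filter\<close>)
  then show ?thesis by simp
qed

lemma oscillation_if_no_limit:
  fixes f :: "'b \<Rightarrow> real"
  assumes "F \<noteq> bot" "eventually (\<lambda>x. 0 \<le> f x \<and> f x \<le> C) F" "\<not> (\<exists>l. (f \<longlongrightarrow> l) F)"
  obtains a b where "a \<in> \<rat>" "b \<in> \<rat>" "0 < a" "a < b" "frequently (\<lambda>x. f x \<le> a) F" "frequently (\<lambda>x. b \<le> f x) F"
proof -
  let ?L = "Liminf F (\<lambda>x. ereal (f x))" and ?U = "Limsup F (\<lambda>x. ereal (f x))"
  have L: "0 \<le> ?L" using assms(2) by (intro Liminf_bounded) (auto elim: eventually_mono)
  have U: "?U \<le> ereal C" using assms(2) by (intro Limsup_bounded) (auto elim: eventually_mono)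
  have LU: "?L \<le> ?U" by (rule Liminf_le_Limsup[OF assms(1)])
  have "?L \<noteq> ?U"
  proof
    assume eq: "?L = ?U"
    have real: "\<exists>l. x = ereal l" if "0 \<le> x" "x \<le> ereal C" for x using that by (cases x) auto
    obtain l where l: "?L = ereal l" using real[OF L] U eq by auto
    have "((\<lambda>x. ereal (f x)) \<longlongrightarrow> ereal l) F"
      using assms(1) eq l by (simp add: tendsto_iff_Liminf_eq_Limsup)
    then show False using assms(3) by (auto simp: lim_ereal)
  qed
  then have lt: "?L < ?U" using LU by simp
  then obtain x where x: "?L < ereal x" "ereal x < ?U" using ereal_dense2 by blast
  then obtain y where y: "ereal x < ereal y" "ereal y < ?U" using ereal_dense2 by blast
  \<comment> \<open>two rational levels strictly between the limit inferior and the limit superior\<close>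
  obtain a b where ab: "a \<in> \<rat>" "x < a" "a < (x + y) / 2" "b \<in> \<rat>" "(x + y) / 2 < b" "b < y"
    using Rats_dense_in_real[of x "(x + y) / 2"] Rats_dense_in_real[of "(x + y) / 2" y] y by auto
  have "?L < ereal a" using x ab by (meson ereal_less_eq(3) less_le_trans less_imp_le)
  moreover have "ereal b < ?U" using y ab by (meson ereal_less_eq(3) le_less_trans less_imp_le)
  moreover have "0 < a"
  proof -
    have "0 < ereal a" using L \<open>?L < ereal a\<close> by (rule le_less_trans)
    then show ?thesis by simp
  qed
  moreover have "frequently (\<lambda>x. f x \<le> a) F"
  proof (rule ccontr)
    assume "\<not> frequently (\<lambda>x. f x \<le> a) F"
    then have "eventually (\<lambda>x. ereal a \<le> ereal (f x)) F" by (auto simp: not_frequently elim: eventually_mono)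
    then have "ereal a \<le> ?L" by (rule Liminf_bounded)
    then show False using \<open>?L < ereal a\<close> by simp
  qed
  moreover have "frequently (\<lambda>x. b \<le> f x) F"
  proof (rule ccontr)
    assume "\<not> frequently (\<lambda>x. b \<le> f x) F"
    then have "eventually (\<lambda>x. ereal (f x) \<le> ereal b) F" by (auto simp: not_frequently elim: eventually_mono)
    then have "?U \<le> ereal b" by (rule Limsup_bounded)
    then show False using \<open>ereal b < ?U\<close> by simp
  qed
  ultimately show ?thesis using that ab by auto
qed

abbreviation rat_times :: "real set" where "rat_times \<equiv> \<rat> \<inter> {0..}"

lemma rat_times_right_nontrivial: "0 \<le> t \<Longrightarrow> at t within (rat_times \<inter> {t<..}) \<noteq> bot"
proof -
  assume t: "0 \<le> t"
  have "t islimpt (rat_times \<inter> {t<..})"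
    unfolding islimpt_approachable
  proof (intro allI impI)
    fix e :: real assume "0 < e"
    then obtain q where "q \<in> \<rat>" "t < q" "q < t + e" using Rats_dense_in_real[of t "t + e"] by auto
    then show "\<exists>x'\<in>rat_times \<inter> {t<..}. x' \<noteq> t \<and> dist x' t < e"
      using t by (intro bexI[of _ q]) (auto simp: dist_real_def)
  qed
  then show ?thesis by (simp add: trivial_limit_within)
qed

lemma rat_times_left_nontrivial: "0 < t \<Longrightarrow> at t within (rat_times \<inter> {..<t}) \<noteq> bot"
proof -
  assume t: "0 < t"
  have "t islimpt (rat_times \<inter> {..<t})"
    unfolding islimpt_approachable
  proof (intro allI impI)
    fix e :: real assume "0 < e"
    then obtain q where "q \<in> \<rat>" "max 0 (t - e) < q" "q < t" using Rats_dense_in_real[of "max 0 (t - e)" t] t by auto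
    then show "\<exists>x'\<in>rat_times \<inter> {..<t}. x' \<noteq> t \<and> dist x' t < e"
      using t by (intro bexI[of _ q]) (auto simp: dist_real_def)
  qed
  then show ?thesis by (simp add: trivial_limit_within)
qed

lemma frequently_right:
  assumes "frequently Q (at t within (rat_times \<inter> {t<..}))" "t < r"
  obtains q where "q \<in> rat_times" "t < q" "q < r" "Q q"
proof -
  have "eventually (\<lambda>q. q \<in> rat_times \<and> t < q \<and> q < r) (at t within (rat_times \<inter> {t<..}))"
    using assms(2) unfolding eventually_at by (intro exI[of _ "r - t"]) (auto simp: dist_real_def)
  from frequently_eventually_conj[OF assms(1) this] show ?thesis
    using that by (auto dest!: frequently_ex)
qed

lemma frequently_left:
  assumes "frequently Q (at t within (rat_times \<inter> {..<t}))" "r < t"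
  obtains q where "q \<in> rat_times" "r < q" "q < t" "Q q"
proof -
  have "eventually (\<lambda>q. q \<in> rat_times \<and> r < q \<and> q < t) (at t within (rat_times \<inter> {..<t}))"
    using assms(2) unfolding eventually_at by (intro exI[of _ "t - r"]) (auto simp: dist_real_def)
  from frequently_eventually_conj[OF assms(1) this] show ?thesis
    using that by (auto dest!: frequently_ex)
qed

text \<open>
  Oscillation at \<open>t\<close> from the right yields arbitrarily many upcrossings: each new one is found closer
  to \<open>t\<close>, hence earlier than the previous ones.
\<close>

lemma many_upcrossings_right:
  assumes "frequently (\<lambda>x. f x \<le> a) (at t within (rat_times \<inter> {t<..}))"
    "frequently (\<lambda>x. b \<le> f x) (at t within (rat_times \<inter> {t<..}))" "a < b" "t < r"
  shows "\<exists>xs. sorted_wrt (<) xs \<and> set xs \<subseteq> rat_times \<inter> {t<..<r} \<and> n \<le> upcrossings a b False (map f xs)"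
proof (induction n)
  case 0
  show ?case by (intro exI[of _ "[]"]) simp
next
  case (Suc n)
  then obtain xs where xs: "sorted_wrt (<) xs" "set xs \<subseteq> rat_times \<inter> {t<..<r}" "n \<le> upcrossings a b False (map f xs)" by blast
  define r' where "r' = (if xs = [] then r else hd xs)"
  have "t < r'" "r' \<le> r" using assms(4) xs(2) by (cases xs; auto simp: r'_def)+
  moreover have le: "r' \<le> x" if "x \<in> set xs" for x using xs(1) that by (cases xs) (auto simp: r'_def)
  ultimately obtain q where q: "q \<in> rat_times" "t < q" "q < r'" "b \<le> f q" using frequently_right[OF assms(2)] by blast
  obtain p where p: "p \<in> rat_times" "t < p" "p < q" "f p \<le> a" using frequently_right[OF assms(1) q(2)] by blast
  show ?case
  proof (intro exI[of _ "p # q # xs"] conjI)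
    show "sorted_wrt (<) (p # q # xs)" using xs(1) le p(3) q(3) by fastforce
    show "set (p # q # xs) \<subseteq> rat_times \<inter> {t<..<r}" using xs(2) p q \<open>r' \<le> r\<close> by auto
    show "Suc n \<le> upcrossings a b False (map f (p # q # xs))" using xs(3) p(4) q(4) by simp
  qed
qed

lemma many_upcrossings_left:
  assumes "frequently (\<lambda>x. f x \<le> a) (at t within (rat_times \<inter> {..<t}))"
    "frequently (\<lambda>x. b \<le> f x) (at t within (rat_times \<inter> {..<t}))" "a < b" "r < t"
  shows "\<exists>xs. sorted_wrt (<) xs \<and> set xs \<subseteq> rat_times \<inter> {r<..<t} \<and> n \<le> upcrossings a b False (map f xs)"
  using assms(4)
proof (induction n arbitrary: r)
  case 0
  show ?case by (intro exI[of _ "[]"]) simp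
next
  case (Suc n)
  obtain p where p: "p \<in> rat_times" "r < p" "p < t" "f p \<le> a" using frequently_left[OF assms(1) Suc.prems] by blast
  obtain q where q: "q \<in> rat_times" "p < q" "q < t" "b \<le> f q" using frequently_left[OF assms(2) p(3)] by blast
  from Suc.IH[OF q(3)] obtain xs where xs: "sorted_wrt (<) xs" "set xs \<subseteq> rat_times \<inter> {q<..<t}"
    "n \<le> upcrossings a b False (map f xs)" by blast
  show ?case
  proof (intro exI[of _ "p # q # xs"] conjI)
    show "sorted_wrt (<) (p # q # xs)" using xs(1,2) q(2) by fastforce
    show "set (p # q # xs) \<subseteq> rat_times \<inter> {r<..<t}" using xs(2) p q by auto
    show "Suc n \<le> upcrossings a b False (map f (p # q # xs))" using xs(3) p(4) q(4) by simp
  qed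
qed

lemma limits_along_rationals:
  assumes bound: "\<And>q. q \<in> rat_times \<Longrightarrow> 0 \<le> f q \<and> f q \<le> C"
    and ups: "\<And>a b. a \<in> \<rat> \<Longrightarrow> b \<in> \<rat> \<Longrightarrow> 0 < a \<Longrightarrow> a < b \<Longrightarrow>
      \<exists>k. \<forall>xs. sorted_wrt (<) xs \<longrightarrow> set xs \<subseteq> rat_times \<longrightarrow> upcrossings a b False (map f xs) \<le> k"
  shows "0 \<le> t \<Longrightarrow> \<exists>l. (f \<longlongrightarrow> l) (at t within (rat_times \<inter> {t<..}))"
    and "0 < t \<Longrightarrow> \<exists>l. (f \<longlongrightarrow> l) (at t within (rat_times \<inter> {..<t}))"
proof -
  have bd: "eventually (\<lambda>q. 0 \<le> f q \<and> f q \<le> C) (at t within (rat_times \<inter> S))" for S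
    using bound unfolding eventually_at_topological by (intro exI[of _ UNIV]) auto
  show "\<exists>l. (f \<longlongrightarrow> l) (at t within (rat_times \<inter> {t<..}))" if t: "0 \<le> t"
  proof (rule ccontr)
    assume "\<nexists>l. (f \<longlongrightarrow> l) (at t within (rat_times \<inter> {t<..}))"
    from oscillation_if_no_limit[OF rat_times_right_nontrivial[OF t] bd this]
    obtain a b where ab: "a \<in> \<rat>" "b \<in> \<rat>" "0 < a" "a < b"
      and fr: "frequently (\<lambda>x. f x \<le> a) (at t within (rat_times \<inter> {t<..}))"
        "frequently (\<lambda>x. b \<le> f x) (at t within (rat_times \<inter> {t<..}))" .
    from ups[OF ab] obtain k where k: "\<And>xs. sorted_wrt (<) xs \<Longrightarrow> set xs \<subseteq> rat_times \<Longrightarrow> upcrossings a b False (map f xs) \<le> k" by blast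
    from many_upcrossings_right[OF fr ab(4), of "t + 1" "Suc k"] obtain xs where
      "sorted_wrt (<) xs" "set xs \<subseteq> rat_times" "Suc k \<le> upcrossings a b False (map f xs)" by auto
    then show False using k[of xs] by simp
  qed
  show "\<exists>l. (f \<longlongrightarrow> l) (at t within (rat_times \<inter> {..<t}))" if t: "0 < t"
  proof (rule ccontr)
    assume "\<nexists>l. (f \<longlongrightarrow> l) (at t within (rat_times \<inter> {..<t}))"
    from oscillation_if_no_limit[OF rat_times_left_nontrivial[OF t] bd this]
    obtain a b where ab: "a \<in> \<rat>" "b \<in> \<rat>" "0 < a" "a < b"
      and fr: "frequently (\<lambda>x. f x \<le> a) (at t within (rat_times \<inter> {..<t}))"
        "frequently (\<lambda>x. b \<le> f x) (at t within (rat_times \<inter> {..<t}))" .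
    from ups[OF ab] obtain k where k: "\<And>xs. sorted_wrt (<) xs \<Longrightarrow> set xs \<subseteq> rat_times \<Longrightarrow> upcrossings a b False (map f xs) \<le> k" by blast
    from many_upcrossings_left[OF fr ab(4), of "t - 1" "Suc k"] obtain xs where
      "sorted_wrt (<) xs" "set xs \<subseteq> rat_times" "Suc k \<le> upcrossings a b False (map f xs)" by auto
    then show False using k[of xs] by simp
  qed
qed

lemma right_limits_near:
  assumes g: "\<And>t. 0 \<le> t \<Longrightarrow> (f \<longlongrightarrow> g t) (at t within (rat_times \<inter> {t<..}))"
    and near: "\<And>q. q \<in> rat_times \<Longrightarrow> u < q \<Longrightarrow> q < v \<Longrightarrow> dist (f q) l < \<epsilon>"
    and s: "0 \<le> s" "u \<le> s" "s < v"
  shows "dist (g s) l \<le> \<epsilon>"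
proof -
  have "eventually (\<lambda>q. f q \<in> cball l \<epsilon>) (at s within (rat_times \<inter> {s<..}))"
    unfolding eventually_at
  proof (intro exI[of _ "v - s"] conjI ballI impI)
    fix q assume q: "q \<in> rat_times \<inter> {s<..}" "q \<noteq> s \<and> dist q s < v - s"
    then have "dist (f q) l < \<epsilon>" using s by (intro near) (auto simp: dist_real_def)
    then show "f q \<in> cball l \<epsilon>" by (simp add: dist_commute)
  qed (use s in simp)
  then have "g s \<in> cball l \<epsilon>"
    by (rule Lim_in_closed_set[OF closed_cball _ rat_times_right_nontrivial[OF s(1)] g[OF s(1)]])
  then show ?thesis by (simp add: dist_commute)
qed

text \<open>
  Passing to right limits along the rationals regularises a function that has one-sided limits along
  the rationals.
\<close>

lemma cadlag_right_limits:
  assumes g: "\<And>t. 0 \<le> t \<Longrightarrow> (f \<longlongrightarrow> g t) (at t within (rat_times \<inter> {t<..}))"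
    and l: "\<And>t. 0 < t \<Longrightarrow> \<exists>l. (f \<longlongrightarrow> l) (at t within (rat_times \<inter> {..<t}))"
  shows "cadlag g"
proof -
  have "(g \<longlongrightarrow> g t) (at_right t)" if t: "0 \<le> t" for t
  proof (rule tendstoI)
    fix e :: real assume e: "0 < e"
    from tendstoD[OF g[OF t], of "e / 2"] e obtain d where d: "0 < d"
      "\<And>q. q \<in> rat_times \<Longrightarrow> t < q \<Longrightarrow> q < t + d \<Longrightarrow> dist (f q) (g t) < e / 2"
      unfolding eventually_at by (auto simp: dist_real_def)
    have "eventually (\<lambda>s. s \<in> {t<..<t + d}) (at_right t)" using d(1) by (intro eventually_at_right_real) simp
    then show "eventually (\<lambda>s. dist (g s) (g t) < e) (at_right t)"
    proof eventually_elim
      case (elim s)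
      have "dist (g s) (g t) \<le> e / 2" by (rule right_limits_near[OF g d(2)]) (use elim t in auto)
      then show ?case using e by simp
    qed
  qed
  moreover have "\<exists>l. (g \<longlongrightarrow> l) (at_left t)" if t: "0 < t" for t
  proof -
    from l[OF t] obtain l where l: "(f \<longlongrightarrow> l) (at t within (rat_times \<inter> {..<t}))" ..
    have "(g \<longlongrightarrow> l) (at_left t)"
    proof (rule tendstoI)
      fix e :: real assume e: "0 < e"
      from tendstoD[OF l, of "e / 2"] e obtain d where d: "0 < d"
        "\<And>q. q \<in> rat_times \<Longrightarrow> t - d < q \<Longrightarrow> q < t \<Longrightarrow> dist (f q) l < e / 2"
        unfolding eventually_at by (auto simp: dist_real_def)
      have "eventually (\<lambda>s. s \<in> {max 0 (t - d)<..<t}) (at_left t)" using d(1) t by (intro eventually_at_left_real) simp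
      then show "eventually (\<lambda>s. dist (g s) l < e) (at_left t)"
      proof eventually_elim
        case (elim s)
        have "dist (g s) l \<le> e / 2" by (rule right_limits_near[OF g d(2)]) (use elim t in auto)
        then show ?case using e by simp
      qed
    qed
    then show ?thesis ..
  qed
  ultimately show ?thesis by (simp add: cadlag_def right_continuous_path_def continuous_within has_left_limits_def)
qed

section \<open>The upcrossing inequality\<close>

abbreviation crossings :: "(real \<Rightarrow> 'a \<Rightarrow> real) \<Rightarrow> real \<Rightarrow> real \<Rightarrow> bool \<Rightarrow> real list \<Rightarrow> 'a \<Rightarrow> ennreal" where
  "crossings Y a b h ts \<omega> \<equiv> of_nat (upcrossings a b h (map (\<lambda>t. Y t \<omega>) ts))"

context usual_filtered_prob_space
begin

lemma cond_exp_nn_integral: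
  assumes \<xi>: "integrable P \<xi>" "\<And>\<omega>. \<omega> \<in> space P \<Longrightarrow> 0 \<le> \<xi> \<omega>" and B: "B \<in> sets (F t)"
  shows "(\<integral>\<^sup>+\<omega>. ennreal (max 0 (real_cond_exp P (F t) \<xi> \<omega>)) * indicator B \<omega> \<partial>P) = (\<integral>\<^sup>+\<omega>. ennreal (\<xi> \<omega>) * indicator B \<omega> \<partial>P)"
proof -
  interpret C: sigma_finite_subalgebra P "F t" by (rule F_sigma_finite_subalgebra)
  note [measurable] = F_sub[OF B] borel_measurable_integrable[OF \<xi>(1)]
  have pos: "AE \<omega> in P. 0 \<le> real_cond_exp P (F t) \<xi> \<omega>"
    using \<xi>(2) by (intro C.real_cond_exp_pos AE_I2) auto
  have int: "integrable P (real_cond_exp P (F t) \<xi>)" by (rule C.real_cond_exp_int(1)[OF \<xi>(1)])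
  have i1: "integrable P (\<lambda>\<omega>. indicator B \<omega> * real_cond_exp P (F t) \<xi> \<omega>)" "integrable P (\<lambda>\<omega>. indicator B \<omega> * \<xi> \<omega>)"
    using integrable_mult_indicator[OF F_sub[OF B] int] integrable_mult_indicator[OF F_sub[OF B] \<xi>(1)] by simp_all
  have "(\<integral>\<^sup>+\<omega>. ennreal (max 0 (real_cond_exp P (F t) \<xi> \<omega>)) * indicator B \<omega> \<partial>P)
      = (\<integral>\<^sup>+\<omega>. ennreal (indicator B \<omega> * real_cond_exp P (F t) \<xi> \<omega>) \<partial>P)"
    using pos by (intro nn_integral_cong_AE) (auto simp: indicator_def max_def elim!: eventually_mono)
  also have "\<dots> = ennreal (integral_on P B (real_cond_exp P (F t) \<xi>))"
    by (rule nn_integral_eq_integral[OF i1(1)]) (use pos in \<open>auto elim!: eventually_mono\<close>)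
  also have "integral_on P B (real_cond_exp P (F t) \<xi>) = integral_on P B \<xi>"
    using C.real_cond_exp_intA[OF \<xi>(1) B] by (simp add: set_lebesgue_integral_def)
  also have "ennreal (integral_on P B \<xi>) = (\<integral>\<^sup>+\<omega>. ennreal (indicator B \<omega> * \<xi> \<omega>) \<partial>P)"
    by (rule nn_integral_eq_integral[OF i1(2), symmetric]) (use \<xi>(2) in auto)
  also have "\<dots> = (\<integral>\<^sup>+\<omega>. ennreal (\<xi> \<omega>) * indicator B \<omega> \<partial>P)"
    by (intro nn_integral_cong) (auto simp: indicator_def)
  finally show ?thesis .
qed

lemma upcrossings_measurable:
  assumes "\<And>t. t \<in> set ts \<Longrightarrow> Y t \<in> borel_measurable P"
  shows "(\<lambda>\<omega>. crossings Y a b h ts \<omega>) \<in> borel_measurable P"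
  using assms
proof (induction ts arbitrary: h)
  case (Cons t ts)
  have [measurable]: "Y t \<in> borel_measurable P" using Cons.prems by simp
  have [measurable]: "(\<lambda>\<omega>. crossings Y a b h ts \<omega>) \<in> borel_measurable P" for h
    using Cons.prems by (intro Cons.IH) simp
  show ?case
  proof (cases h)
    case True
    have "(\<lambda>\<omega>. if b \<le> Y t \<omega> then 1 + crossings Y a b False ts \<omega> else crossings Y a b True ts \<omega>)
      \<in> borel_measurable P" by measurable
    then show ?thesis using True by (simp add: if_distrib cong: if_cong)
  next
    case False
    have "(\<lambda>\<omega>. if Y t \<omega> \<le> a then crossings Y a b True ts \<omega> else crossings Y a b False ts \<omega>)
      \<in> borel_measurable P" by measurable
    then show ?thesis using False by (simp add: if_distrib cong: if_cong)
  qed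
qed simp

text \<open>
  Both bounds come from one induction over the times.  A unit that is held at time \<open>s\<close> is worth
  \<open>\<xi>\<close> on average, and a purchase costs at most \<open>a\<close>.  A sale at \<open>t\<close> brings at least \<open>b = (b - a) + a\<close>: one
  counted upcrossing and the price \<open>a\<close> of the next purchase.  An unsold unit
  still has a non-negative value, since the integrals are taken in \<open>[0, \<infinity>]\<close>.
\<close>

lemma upcrossing_inequality:
  fixes Y :: "real \<Rightarrow> 'a \<Rightarrow> real"
  assumes ab: "0 \<le> a" "a < b"
    and Y: "\<And>t. 0 \<le> t \<Longrightarrow> Y t \<in> borel_measurable (F t)"
    and int: "\<And>t B. 0 \<le> t \<Longrightarrow> B \<in> sets (F t) \<Longrightarrow>
      (\<integral>\<^sup>+\<omega>. ennreal (Y t \<omega>) * indicator B \<omega> \<partial>P) = (\<integral>\<^sup>+\<omega>. ennreal (\<xi> \<omega>) * indicator B \<omega> \<partial>P)"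
    and ts: "0 \<le> s" "sorted ts" "\<And>t. t \<in> set ts \<Longrightarrow> s \<le> t" and B: "B \<in> sets (F s)"
  shows "ennreal (b - a) * (\<integral>\<^sup>+\<omega>. crossings Y a b False ts \<omega> * indicator B \<omega> \<partial>P)
        \<le> ennreal a * emeasure P B \<and>
      ennreal (b - a) * (\<integral>\<^sup>+\<omega>. crossings Y a b True ts \<omega> * indicator B \<omega> \<partial>P)
        \<le> (\<integral>\<^sup>+\<omega>. ennreal (\<xi> \<omega>) * indicator B \<omega> \<partial>P)"
  using ts B
proof (induction ts arbitrary: s B)
  case (Cons t ts)
  then have t: "0 \<le> t" "s \<le> t" and B: "B \<in> sets (F t)" by (auto intro: F_mono[of s t] order_trans)
  have ts: "sorted ts" "\<And>r. r \<in> set ts \<Longrightarrow> t \<le> r" using Cons.prems(2) by auto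
  have [measurable]: "Y t \<in> borel_measurable (F t)" by (rule Y[OF t(1)])
  have [measurable]: "Y t \<in> borel_measurable P" by (rule measurable_F_P[OF Y[OF t(1)]])
  have Bsub: "B \<subseteq> space P" using sets.sets_into_space[OF B] by (simp add: space_F)
  have Ym: "Y r \<in> borel_measurable P" if "r \<in> set ts" for r
    using measurable_F_P[OF Y] t(1) ts(2)[OF that] by auto
  have up [measurable]: "(\<lambda>\<omega>. crossings Y a b h ts \<omega>) \<in> borel_measurable P" for h
    by (rule upcrossings_measurable[OF Ym])
  let ?U = "\<lambda>h \<omega>. crossings Y a b h ts \<omega>"
  have IH: "ennreal (b - a) * (\<integral>\<^sup>+\<omega>. ?U False \<omega> * indicator A \<omega> \<partial>P) \<le> ennreal a * emeasure P A"
    "ennreal (b - a) * (\<integral>\<^sup>+\<omega>. ?U True \<omega> * indicator A \<omega> \<partial>P) \<le> (\<integral>\<^sup>+\<omega>. ennreal (\<xi> \<omega>) * indicator A \<omega> \<partial>P)"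
    if "A \<in> sets (F t)" for A
    using Cons.IH[OF t(1) ts that] by auto
  have splitF: "(\<integral>\<^sup>+\<omega>. ennreal (\<xi> \<omega>) * indicator B \<omega> \<partial>P)
      = (\<integral>\<^sup>+\<omega>. ennreal (Y t \<omega>) * indicator A \<omega> \<partial>P) + (\<integral>\<^sup>+\<omega>. ennreal (\<xi> \<omega>) * indicator (B - A) \<omega> \<partial>P)"
    if A: "A \<in> sets (F t)" "A \<subseteq> B" for A
  proof -
    have BA: "B - A \<in> sets (F t)" using B A by auto
    note [measurable] = F_sub[OF A(1)] F_sub[OF BA]
    have "(\<integral>\<^sup>+\<omega>. ennreal (Y t \<omega>) * indicator B \<omega> \<partial>P)
        = (\<integral>\<^sup>+\<omega>. ennreal (Y t \<omega>) * indicator A \<omega> + ennreal (Y t \<omega>) * indicator (B - A) \<omega> \<partial>P)"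
      using A(2) by (intro nn_integral_cong) (auto simp: indicator_def)
    also have "\<dots> = (\<integral>\<^sup>+\<omega>. ennreal (Y t \<omega>) * indicator A \<omega> \<partial>P) + (\<integral>\<^sup>+\<omega>. ennreal (Y t \<omega>) * indicator (B - A) \<omega> \<partial>P)"
      by (intro nn_integral_add) measurable
    finally show ?thesis using int[OF t(1) B] int[OF t(1) BA] by simp
  qed
  show ?case
  proof
    define B1 where "B1 = B \<inter> {\<omega>\<in>space (F t). Y t \<omega> \<le> a}"
    have B1: "B1 \<in> sets (F t)" "B1 \<subseteq> B" unfolding B1_def using B by auto
    then have B2: "B - B1 \<in> sets (F t)" using B by auto
    note [measurable] = F_sub[OF B1(1)] F_sub[OF B2]
    have "(\<integral>\<^sup>+\<omega>. crossings Y a b False (t # ts) \<omega> * indicator B \<omega> \<partial>P)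
        = (\<integral>\<^sup>+\<omega>. ?U True \<omega> * indicator B1 \<omega> + ?U False \<omega> * indicator (B - B1) \<omega> \<partial>P)"
      using Bsub by (intro nn_integral_cong) (auto simp: indicator_def B1_def space_F)
    also have "\<dots> = (\<integral>\<^sup>+\<omega>. ?U True \<omega> * indicator B1 \<omega> \<partial>P) + (\<integral>\<^sup>+\<omega>. ?U False \<omega> * indicator (B - B1) \<omega> \<partial>P)"
      by (intro nn_integral_add) measurable
    finally have "ennreal (b - a) * (\<integral>\<^sup>+\<omega>. crossings Y a b False (t # ts) \<omega> * indicator B \<omega> \<partial>P)
        \<le> (\<integral>\<^sup>+\<omega>. ennreal (\<xi> \<omega>) * indicator B1 \<omega> \<partial>P) + ennreal a * emeasure P (B - B1)"
      using IH(2)[OF B1(1)] IH(1)[OF B2] by (simp only: distrib_left add_mono)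
    also have "(\<integral>\<^sup>+\<omega>. ennreal (\<xi> \<omega>) * indicator B1 \<omega> \<partial>P) = (\<integral>\<^sup>+\<omega>. ennreal (Y t \<omega>) * indicator B1 \<omega> \<partial>P)"
      by (rule int[OF t(1) B1(1), symmetric])
    also have "\<dots> \<le> (\<integral>\<^sup>+\<omega>. ennreal a * indicator B1 \<omega> \<partial>P)"
      by (intro nn_integral_mono) (auto simp: indicator_def B1_def intro!: ennreal_leI)
    also have "\<dots> = ennreal a * emeasure P B1" by (simp add: nn_integral_cmult)
    also have "ennreal a * emeasure P B1 + ennreal a * emeasure P (B - B1) = ennreal a * emeasure P B"
    proof -
      have "emeasure P B1 + emeasure P (B - B1) = emeasure P (B1 \<union> (B - B1))" by (rule plus_emeasure) auto
      also have "B1 \<union> (B - B1) = B" using B1(2) by blast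
      finally show ?thesis by (simp flip: distrib_left)
    qed
    finally show "ennreal (b - a) * (\<integral>\<^sup>+\<omega>. crossings Y a b False (t # ts) \<omega> * indicator B \<omega> \<partial>P)
        \<le> ennreal a * emeasure P B" by (simp add: add_right_mono)
  next
    define B1 where "B1 = B \<inter> {\<omega>\<in>space (F t). b \<le> Y t \<omega>}"
    have B1: "B1 \<in> sets (F t)" "B1 \<subseteq> B" unfolding B1_def using B by auto
    then have B2: "B - B1 \<in> sets (F t)" using B by auto
    note [measurable] = F_sub[OF B1(1)] F_sub[OF B2]
    have "(\<integral>\<^sup>+\<omega>. crossings Y a b True (t # ts) \<omega> * indicator B \<omega> \<partial>P)
        = (\<integral>\<^sup>+\<omega>. (indicator B1 \<omega> + ?U False \<omega> * indicator B1 \<omega>) + ?U True \<omega> * indicator (B - B1) \<omega> \<partial>P)"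
      using Bsub by (intro nn_integral_cong) (auto simp: indicator_def B1_def space_F)
    also have "\<dots> = (\<integral>\<^sup>+\<omega>. indicator B1 \<omega> + ?U False \<omega> * indicator B1 \<omega> \<partial>P) + (\<integral>\<^sup>+\<omega>. ?U True \<omega> * indicator (B - B1) \<omega> \<partial>P)"
      by (intro nn_integral_add) measurable
    also have "(\<integral>\<^sup>+\<omega>. indicator B1 \<omega> + ?U False \<omega> * indicator B1 \<omega> \<partial>P) = emeasure P B1 + (\<integral>\<^sup>+\<omega>. ?U False \<omega> * indicator B1 \<omega> \<partial>P)"
      by (subst nn_integral_add) simp_all
    finally have "ennreal (b - a) * (\<integral>\<^sup>+\<omega>. crossings Y a b True (t # ts) \<omega> * indicator B \<omega> \<partial>P)
        \<le> (ennreal (b - a) * emeasure P B1 + ennreal a * emeasure P B1) + (\<integral>\<^sup>+\<omega>. ennreal (\<xi> \<omega>) * indicator (B - B1) \<omega> \<partial>P)"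
      using IH(1)[OF B1(1)] IH(2)[OF B2] by (simp only: distrib_left add_mono order_refl)
    also have "ennreal (b - a) * emeasure P B1 + ennreal a * emeasure P B1 = ennreal b * emeasure P B1"
      using ab by (simp flip: distrib_right ennreal_plus)
    also have "\<dots> = (\<integral>\<^sup>+\<omega>. ennreal b * indicator B1 \<omega> \<partial>P)" by (simp add: nn_integral_cmult)
    also have "\<dots> \<le> (\<integral>\<^sup>+\<omega>. ennreal (Y t \<omega>) * indicator B1 \<omega> \<partial>P)"
      by (intro nn_integral_mono) (auto simp: indicator_def B1_def intro!: ennreal_leI)
    finally show "ennreal (b - a) * (\<integral>\<^sup>+\<omega>. crossings Y a b True (t # ts) \<omega> * indicator B \<omega> \<partial>P)
        \<le> (\<integral>\<^sup>+\<omega>. ennreal (\<xi> \<omega>) * indicator B \<omega> \<partial>P)"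
      unfolding splitF[OF B1] by (simp add: add_right_mono)
  qed
qed simp

text \<open>Sorted finite sets of times that exhaust the non-negative rationals.\<close>

definition rat_grid :: "nat \<Rightarrow> real list" where
  "rat_grid n = sorted_list_of_set (from_nat_into rat_times ` {..<n})"

lemma rat_grid_subset: "set (rat_grid n) \<subseteq> rat_times"
proof -
  have "rat_times \<noteq> {}" by (auto intro: exI[of _ 0])
  then show ?thesis unfolding rat_grid_def using from_nat_into[of rat_times] by auto
qed

lemma rat_grid_mono: "m \<le> n \<Longrightarrow> subseq (rat_grid m) (rat_grid n)"
  unfolding rat_grid_def by (intro subseq_sorted_list_of_set) auto

lemma rat_grid_covers:
  assumes "sorted_wrt (<) xs" "set xs \<subseteq> rat_times"
  shows "\<exists>n. subseq xs (rat_grid n)"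
proof -
  have cnt: "countable rat_times" by (simp add: countable_rat)
  define m where "m = Max (insert 0 (to_nat_on rat_times ` set xs))"
  have "set xs \<subseteq> from_nat_into rat_times ` {..<Suc m}"
  proof
    fix x assume x: "x \<in> set xs"
    then have "to_nat_on rat_times x \<le> m" unfolding m_def by (intro Max_ge) auto
    moreover have "from_nat_into rat_times (to_nat_on rat_times x) = x"
      using cnt x assms(2) by (intro from_nat_into_to_nat_on) auto
    ultimately show "x \<in> from_nat_into rat_times ` {..<Suc m}" by (intro rev_image_eqI[of "to_nat_on rat_times x"]) auto
  qed
  then have "subseq (sorted_list_of_set (set xs)) (rat_grid (Suc m))"
    unfolding rat_grid_def by (intro subseq_sorted_list_of_set) auto
  moreover have "sorted_list_of_set (set xs) = xs"
    using assms(1) by (simp add: sorted_list_of_set.idem_if_sorted_distinct strict_sorted_iff)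
  ultimately show ?thesis by auto
qed

lemma upcrossings_all_rationals:
  fixes Y :: "real \<Rightarrow> 'a \<Rightarrow> real"
  assumes ab: "0 \<le> a" "a < b"
    and Y: "\<And>t. 0 \<le> t \<Longrightarrow> Y t \<in> borel_measurable (F t)"
    and int: "\<And>t B. 0 \<le> t \<Longrightarrow> B \<in> sets (F t) \<Longrightarrow>
      (\<integral>\<^sup>+\<omega>. ennreal (Y t \<omega>) * indicator B \<omega> \<partial>P) = (\<integral>\<^sup>+\<omega>. ennreal (\<xi> \<omega>) * indicator B \<omega> \<partial>P)"
  defines "U \<equiv> \<lambda>\<omega>. SUP n. crossings Y a b False (rat_grid n) \<omega>"
  shows "U \<in> borel_measurable P" "ennreal (b - a) * (\<integral>\<^sup>+\<omega>. U \<omega> \<partial>P) \<le> ennreal a"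
    and "sorted_wrt (<) xs \<Longrightarrow> set xs \<subseteq> rat_times \<Longrightarrow> crossings Y a b False xs \<omega> \<le> U \<omega>"
proof -
  have m [measurable]: "(\<lambda>\<omega>. crossings Y a b False (rat_grid n) \<omega>) \<in> borel_measurable P" for n
    using rat_grid_subset[of n] by (intro upcrossings_measurable measurable_F_P[OF Y]) auto
  show "U \<in> borel_measurable P" unfolding U_def by measurable
  have inc: "incseq (\<lambda>n \<omega>. crossings Y a b False (rat_grid n) \<omega>)"
    using ab(2) by (auto intro!: incseq_SucI le_funI upcrossings_subseq subseq_map rat_grid_mono)
  have "ennreal (b - a) * (\<integral>\<^sup>+\<omega>. U \<omega> \<partial>P)
      = (SUP n. ennreal (b - a) * (\<integral>\<^sup>+\<omega>. crossings Y a b False (rat_grid n) \<omega> \<partial>P))"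
    unfolding U_def by (subst nn_integral_monotone_convergence_SUP[OF inc m]) (simp add: SUP_mult_left_ennreal)
  also have "\<dots> \<le> ennreal a"
  proof (rule SUP_least)
    fix n
    have "ennreal (b - a) * (\<integral>\<^sup>+\<omega>. crossings Y a b False (rat_grid n) \<omega> * indicator (space P) \<omega> \<partial>P)
      \<le> ennreal a * emeasure P (space P)"
    proof (rule conjunct1, rule upcrossing_inequality[OF ab])
      show "Y t \<in> borel_measurable (F t)" if "0 \<le> t" for t by (rule Y[OF that])
      show "(\<integral>\<^sup>+\<omega>. ennreal (Y t \<omega>) * indicator B \<omega> \<partial>P) = (\<integral>\<^sup>+\<omega>. ennreal (\<xi> \<omega>) * indicator B \<omega> \<partial>P)"
        if "0 \<le> t" "B \<in> sets (F t)" for t B by (rule int[OF that])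
      show "sorted (rat_grid n)" by (simp add: rat_grid_def)
      show "0 \<le> t" if "t \<in> set (rat_grid n)" for t using rat_grid_subset[of n] that by auto
      show "space P \<in> sets (F 0)" using sets.top[of "F 0"] by (simp only: space_F)
    qed (rule order_refl)
    also have "(\<integral>\<^sup>+\<omega>. crossings Y a b False (rat_grid n) \<omega> * indicator (space P) \<omega> \<partial>P)
      = (\<integral>\<^sup>+\<omega>. crossings Y a b False (rat_grid n) \<omega> \<partial>P)"
      by (intro nn_integral_cong) simp
    finally show "ennreal (b - a) * (\<integral>\<^sup>+\<omega>. crossings Y a b False (rat_grid n) \<omega> \<partial>P) \<le> ennreal a"
      by (simp add: emeasure_space_1)
  qed
  finally show "ennreal (b - a) * (\<integral>\<^sup>+\<omega>. U \<omega> \<partial>P) \<le> ennreal a" .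
  assume "sorted_wrt (<) xs" "set xs \<subseteq> rat_times"
  from rat_grid_covers[OF this] obtain n where "subseq xs (rat_grid n)" ..
  then have "upcrossings a b False (map (\<lambda>t. Y t \<omega>) xs) \<le> upcrossings a b False (map (\<lambda>t. Y t \<omega>) (rat_grid n))"
    by (intro upcrossings_subseq subseq_map ab(2))
  then show "crossings Y a b False xs \<omega> \<le> U \<omega>"
    unfolding U_def by (intro SUP_upper2[of n]) (auto intro: of_nat_mono)
qed

end

section \<open>Cadlag versions of conditional expectations\<close>

context usual_filtered_prob_space
begin

text \<open>
  Boundedness is also a consequence of the upcrossing inequality: starting below \<open>n\<close>, a path that
  reaches \<open>b > n\<close> makes an upcrossing of \<open>[n, b]\<close>, and the expected number of these tends to \<open>0\<close> as \<open>b\<close>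
  grows.
\<close>

lemma finite_upcrossings_and_bounded:
  fixes Y :: "real \<Rightarrow> 'a \<Rightarrow> real"
  assumes Y: "\<And>t. 0 \<le> t \<Longrightarrow> Y t \<in> borel_measurable (F t)" and pos: "\<And>t \<omega>. 0 \<le> Y t \<omega>"
    and int: "\<And>t B. 0 \<le> t \<Longrightarrow> B \<in> sets (F t) \<Longrightarrow>
      (\<integral>\<^sup>+\<omega>. ennreal (Y t \<omega>) * indicator B \<omega> \<partial>P) = (\<integral>\<^sup>+\<omega>. ennreal (\<xi> \<omega>) * indicator B \<omega> \<partial>P)"
  shows "AE \<omega> in P. (\<forall>a\<in>\<rat>. \<forall>b\<in>\<rat>. 0 < a \<longrightarrow> a < b \<longrightarrow>
      (\<exists>k. \<forall>xs. sorted_wrt (<) xs \<longrightarrow> set xs \<subseteq> rat_times \<longrightarrow> upcrossings a b False (map (\<lambda>t. Y t \<omega>) xs) \<le> k))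
    \<and> (\<exists>C. \<forall>q\<in>rat_times. Y q \<omega> \<le> C)"
proof -
  define U where "U a b \<omega> = (SUP n. crossings Y a b False (rat_grid n) \<omega>)" for a b \<omega>
  have Um: "U a b \<in> borel_measurable P" if "0 \<le> a" "a < b" for a b
    unfolding U_def[abs_def] by (rule upcrossings_all_rationals(1)[OF that Y int])
  have UE: "ennreal (b - a) * (\<integral>\<^sup>+\<omega>. U a b \<omega> \<partial>P) \<le> ennreal a" if "0 \<le> a" "a < b" for a b
    unfolding U_def[abs_def] by (rule upcrossings_all_rationals(2)[OF that Y int])
  have Uge: "crossings Y a b False xs \<omega> \<le> U a b \<omega>"
    if "0 \<le> a" "a < b" "sorted_wrt (<) xs" "set xs \<subseteq> rat_times" for a b \<omega> xs
    unfolding U_def[abs_def] by (rule upcrossings_all_rationals(3)[OF that(1,2) Y int that(3,4)])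
  have UE': "(\<integral>\<^sup>+\<omega>. U a b \<omega> \<partial>P) \<le> ennreal (a / (b - a))" if "0 \<le> a" "a < b" for a b
  proof -
    have "ennreal (1 / (b - a)) * (ennreal (b - a) * (\<integral>\<^sup>+\<omega>. U a b \<omega> \<partial>P)) \<le> ennreal (1 / (b - a)) * ennreal a"
      by (rule mult_left_mono[OF UE[OF that]]) simp
    also have "ennreal (1 / (b - a)) * (ennreal (b - a) * (\<integral>\<^sup>+\<omega>. U a b \<omega> \<partial>P)) = (\<integral>\<^sup>+\<omega>. U a b \<omega> \<partial>P)"
      using that by (simp add: mult.assoc[symmetric] ennreal_mult[symmetric])
    also have "ennreal (1 / (b - a)) * ennreal a = ennreal (a / (b - a))"
      using that by (simp add: ennreal_mult[symmetric])
    finally show ?thesis .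
  qed
  have fin: "AE \<omega> in P. U a b \<omega> \<noteq> \<infinity>" if "0 \<le> a" "a < b" for a b
    using UE'[OF that] by (intro nn_integral_PInf_AE Um that) (auto simp: top_unique)
  have "AE \<omega> in P. \<forall>p\<in>{(a, b) | a b. a \<in> \<rat> \<and> b \<in> \<rat> \<and> 0 < a \<and> a < b}. U (fst p) (snd p) \<omega> \<noteq> \<infinity>"
  proof (rule AE_ball_countable')
    have "countable (\<rat> \<times> \<rat> :: (real \<times> real) set)" by (intro countable_SIGMA countable_rat)
    then show "countable {(a :: real, b :: real) | a b. a \<in> \<rat> \<and> b \<in> \<rat> \<and> 0 < a \<and> a < b}"
      by (rule countable_subset[rotated]) auto
  qed (use fin in auto)
  moreover have "AE \<omega> in P. \<forall>n::nat. \<exists>m::nat. U (real n) (real (n + Suc m)) \<omega> < 1"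
  proof (subst AE_all_countable, rule allI)
    fix n :: nat
    define W where "W \<omega> = (INF m. U (real n) (real (n + Suc m)) \<omega>)" for \<omega>
    have Wm [measurable]: "W \<in> borel_measurable P"
      unfolding W_def[abs_def] by (intro borel_measurable_INF Um) auto
    have "(\<integral>\<^sup>+\<omega>. W \<omega> \<partial>P) \<le> ennreal (real n / real (Suc m))" for m
    proof -
      have "(\<integral>\<^sup>+\<omega>. W \<omega> \<partial>P) \<le> (\<integral>\<^sup>+\<omega>. U (real n) (real (n + Suc m)) \<omega> \<partial>P)"
        unfolding W_def by (intro nn_integral_mono INF_lower) simp
      also have "\<dots> \<le> ennreal (real n / (real (n + Suc m) - real n))" by (rule UE') auto
      finally show ?thesis by simp
    qed
    moreover have "(\<lambda>m. ennreal (real n / real (Suc m))) \<longlonglongrightarrow> ennreal 0"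
      by (intro tendsto_ennrealI LIMSEQ_Suc lim_const_over_n)
    ultimately have "(\<integral>\<^sup>+\<omega>. W \<omega> \<partial>P) \<le> ennreal 0" by (intro LIMSEQ_le_const) auto
    then have "AE \<omega> in P. W \<omega> = 0" by (simp add: nn_integral_0_iff_AE)
    then show "AE \<omega> in P. \<exists>m::nat. U (real n) (real (n + Suc m)) \<omega> < 1"
    proof eventually_elim
      case (elim \<omega>)
      then have "W \<omega> < 1" by simp
      then show ?case unfolding W_def by (auto simp: INF_less_iff)
    qed
  qed
  ultimately show ?thesis
  proof eventually_elim
    case (elim \<omega>)
    show ?case
    proof (intro conjI ballI impI)
      fix a b :: real assume ab: "a \<in> \<rat>" "b \<in> \<rat>" "0 < a" "a < b"
      then have "U a b \<omega> \<noteq> \<infinity>" using elim(1) by auto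
      then obtain k where k: "U a b \<omega> < of_nat k" using ennreal_Ex_less_of_nat[of "U a b \<omega>"] by (auto simp: less_top)
      have "upcrossings a b False (map (\<lambda>t. Y t \<omega>) xs) \<le> k" if "sorted_wrt (<) xs" "set xs \<subseteq> rat_times" for xs
      proof -
        have "crossings Y a b False xs \<omega> < (of_nat k :: ennreal)"
          using ab by (intro le_less_trans[OF Uge[OF _ _ that] k]) auto
        then show ?thesis by simp
      qed
      then show "\<exists>k. \<forall>xs. sorted_wrt (<) xs \<longrightarrow> set xs \<subseteq> rat_times \<longrightarrow> upcrossings a b False (map (\<lambda>t. Y t \<omega>) xs) \<le> k" by blast
    next
      obtain n where n: "Y 0 \<omega> \<le> real n" using real_arch_simple by blast
      from elim(2) obtain m where m: "U (real n) (real (n + Suc m)) \<omega> < 1" by blast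
      have "Y q \<omega> \<le> real (n + Suc m)" if q: "q \<in> rat_times" for q
      proof (rule ccontr)
        assume *: "\<not> Y q \<omega> \<le> real (n + Suc m)"
        then have "q \<noteq> 0" using n by auto
        then have "0 < q" using q by auto
        then have "of_nat (upcrossings (real n) (real (n + Suc m)) False (map (\<lambda>t. Y t \<omega>) [0, q])) \<le> U (real n) (real (n + Suc m)) \<omega>"
          using q by (intro Uge) auto
        also note m
        finally show False using * n by simp
      qed
      then show "\<exists>C. \<forall>q\<in>rat_times. Y q \<omega> \<le> C" by blast
    qed
  qed
qed

text \<open>
  The martingale \<open>E[\<xi> | F\<^sub>t]\<close> has a version with cadlag paths: finitely many upcrossings give
  one-sided limits along the rationals, and since the filtration is right-continuous and the
  conditional expectations of \<open>\<xi>\<close> are uniformly integrable, the right limit at \<open>t\<close> is again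
  \<open>E[\<xi> | F\<^sub>t]\<close>.
\<close>

lemma cadlag_conditional_expectations:
  assumes \<xi>: "integrable P \<xi>" "\<And>\<omega>. \<omega> \<in> space P \<Longrightarrow> 0 \<le> \<xi> \<omega>"
  shows "\<exists>K. (\<forall>\<omega>\<in>space P. cadlag (\<lambda>t. K t \<omega>)) \<and> (\<forall>t\<ge>0. AE \<omega> in P. K t \<omega> = real_cond_exp P (F t) \<xi> \<omega>)"
proof -
  define Y where "Y t \<omega> = max 0 (real_cond_exp P (F t) \<xi> \<omega>)" for t \<omega>
  have Ym: "Y t \<in> borel_measurable (F t)" for t unfolding Y_def[abs_def] by measurable
  have YmP [measurable]: "Y t \<in> borel_measurable P" for t by (rule measurable_F_P[OF Ym])
  have Ypos: "0 \<le> Y t \<omega>" for t \<omega> by (simp add: Y_def)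
  have Yae: "AE \<omega> in P. Y t \<omega> = real_cond_exp P (F t) \<xi> \<omega>" for t
  proof -
    interpret C: sigma_finite_subalgebra P "F t" by (rule F_sigma_finite_subalgebra)
    have "AE \<omega> in P. 0 \<le> real_cond_exp P (F t) \<xi> \<omega>"
      using \<xi> by (intro C.real_cond_exp_pos AE_I2) auto
    then show ?thesis by eventually_elim (simp add: Y_def)
  qed
  have Yint: "integrable P (Y t)" for t
  proof -
    interpret C: sigma_finite_subalgebra P "F t" by (rule F_sigma_finite_subalgebra)
    show ?thesis using C.real_cond_exp_int(1)[OF \<xi>(1)] unfolding Y_def[abs_def] by (intro integrable_max) auto
  qed
  have YA: "integral_on P A (Y t) = integral_on P A \<xi>" if A: "A \<in> sets (F t)" for A t
  proof -
    interpret C: sigma_finite_subalgebra P "F t" by (rule F_sigma_finite_subalgebra)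
    note [measurable] = F_sub[OF A]
    have "integral_on P A (Y t) = integral_on P A (real_cond_exp P (F t) \<xi>)"
      using Yae[of t] by (intro integral_cong_AE) auto
    then show ?thesis using C.real_cond_exp_intA[OF \<xi>(1) A] by (simp add: set_lebesgue_integral_def)
  qed
  have "AE \<omega> in P. (\<forall>a\<in>\<rat>. \<forall>b\<in>\<rat>. 0 < a \<longrightarrow> a < b \<longrightarrow>
      (\<exists>k. \<forall>xs. sorted_wrt (<) xs \<longrightarrow> set xs \<subseteq> rat_times \<longrightarrow> upcrossings a b False (map (\<lambda>t. Y t \<omega>) xs) \<le> k))
    \<and> (\<exists>C. \<forall>q\<in>rat_times. Y q \<omega> \<le> C)"
    by (rule finite_upcrossings_and_bounded[where \<xi>=\<xi>])
      (simp_all only: Ym Ypos, simp only: Y_def cond_exp_nn_integral[OF \<xi>])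
  then obtain N where N: "N \<in> null_sets P" and reg: "\<And>\<omega>. \<omega> \<in> space P - N \<Longrightarrow>
      (\<forall>a\<in>\<rat>. \<forall>b\<in>\<rat>. 0 < a \<longrightarrow> a < b \<longrightarrow>
      (\<exists>k. \<forall>xs. sorted_wrt (<) xs \<longrightarrow> set xs \<subseteq> rat_times \<longrightarrow> upcrossings a b False (map (\<lambda>t. Y t \<omega>) xs) \<le> k))
    \<and> (\<exists>C. \<forall>q\<in>rat_times. Y q \<omega> \<le> C)"
    by (rule AE_E3) blast
  define K where "K t \<omega> = (if \<omega> \<in> N then 0 else Lim (at t within (rat_times \<inter> {t<..})) (\<lambda>q. Y q \<omega>))" for t \<omega>
  have lims: "0 \<le> t \<Longrightarrow> ((\<lambda>q. Y q \<omega>) \<longlongrightarrow> K t \<omega>) (at t within (rat_times \<inter> {t<..}))"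
    "0 < t \<Longrightarrow> \<exists>l. ((\<lambda>q. Y q \<omega>) \<longlongrightarrow> l) (at t within (rat_times \<inter> {..<t}))"
    if w: "\<omega> \<in> space P" "\<omega> \<notin> N" for t \<omega>
  proof -
    from reg[of \<omega>] w obtain C where C: "\<And>q. q \<in> rat_times \<Longrightarrow> 0 \<le> Y q \<omega> \<and> Y q \<omega> \<le> C" using Ypos by blast
    have ups: "\<exists>k. \<forall>xs. sorted_wrt (<) xs \<longrightarrow> set xs \<subseteq> rat_times \<longrightarrow> upcrossings a b False (map (\<lambda>t. Y t \<omega>) xs) \<le> k"
      if "a \<in> \<rat>" "b \<in> \<rat>" "0 < a" "a < b" for a b using reg[of \<omega>] w that by blast
    note L = limits_along_rationals[of "\<lambda>q. Y q \<omega>", OF C ups]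
    show "((\<lambda>q. Y q \<omega>) \<longlongrightarrow> K t \<omega>) (at t within (rat_times \<inter> {t<..}))" if "0 \<le> t"
    proof -
      from L(1)[OF _ _ _ _ _ that] obtain l where l: "((\<lambda>q. Y q \<omega>) \<longlongrightarrow> l) (at t within (rat_times \<inter> {t<..}))" by auto
      moreover have "K t \<omega> = l" using w(2) tendsto_Lim[OF rat_times_right_nontrivial[OF that] l] by (simp add: K_def)
      ultimately show ?thesis by simp
    qed
    show "\<exists>l. ((\<lambda>q. Y q \<omega>) \<longlongrightarrow> l) (at t within (rat_times \<inter> {..<t}))" if "0 < t"
      using L(2)[OF _ _ _ _ _ that] by simp
  qed
  have cad: "cadlag (\<lambda>t. K t \<omega>)" if w: "\<omega> \<in> space P" for \<omega>
  proof (cases "\<omega> \<in> N")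
    case True
    then show ?thesis
      by (auto simp: K_def cadlag_def right_continuous_path_def has_left_limits_def intro: tendsto_const)
  next
    case False
    show ?thesis
      by (rule cadlag_right_limits[of "\<lambda>q. Y q \<omega>"]) (use lims[OF w False] in auto)
  qed
  have "AE \<omega> in P. K t \<omega> = real_cond_exp P (F t) \<xi> \<omega>" if t: "0 \<le> t" for t
  proof -
    interpret C: sigma_finite_subalgebra P "F t" by (rule F_sigma_finite_subalgebra)
    obtain q where q: "\<And>n. q n \<in> \<rat>" "\<And>n. t < q n" "\<And>n. q n < t + 1" and qlim: "q \<longlonglongrightarrow> t"
      by (rule rationals_decreasing_to[of t "t + 1"]) auto
    have Klim: "(\<lambda>n. Y (q n) \<omega>) \<longlonglongrightarrow> K t \<omega>" if w: "\<omega> \<in> space P" "\<omega> \<notin> N" for \<omega>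
    proof -
      have "filterlim q (at t within (rat_times \<inter> {t<..})) sequentially"
        unfolding filterlim_at using qlim q(1,2) t by (auto intro!: always_eventually simp: less_imp_neq[THEN not_sym] order_trans[OF t less_imp_le])
      then show ?thesis by (rule filterlim_compose[OF lims(1)[OF w t]])
    qed
    have ae: "AE \<omega> in P. (\<lambda>n. Y (q n) \<omega>) \<longlonglongrightarrow> K t \<omega>"
      using Klim by (intro AE_I'[OF N]) auto
    have Km: "K t \<in> borel_measurable (F t)"
    proof (rule measurable_F_right[OF t])
      fix s assume s: "t < s"
      have "\<forall>\<^sub>F n in sequentially. q n < s" using qlim s by (rule order_tendstoD)
      then obtain n0 where n0: "\<And>n. n \<ge> n0 \<Longrightarrow> q n < s" by (auto simp: eventually_sequentially)
      have Ns: "N \<in> sets (F s)" by (rule null_sets_F[OF _ N]) (use s t in simp)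
      show "K t \<in> borel_measurable (F s)"
      proof (rule borel_measurable_LIMSEQ_metric)
        show "(\<lambda>\<omega>. if \<omega> \<in> N then 0 else Y (q (n + n0)) \<omega>) \<in> borel_measurable (F s)" for n
        proof -
          have [measurable]: "Y (q (n + n0)) \<in> borel_measurable (F s)"
            by (rule measurable_F_mono[OF _ Ym]) (use n0[of "n + n0"] in simp)
          note [measurable] = Ns
          show ?thesis by measurable
        qed
        fix \<omega> assume "\<omega> \<in> space (F s)"
        then have w: "\<omega> \<in> space P" by (simp add: space_F)
        show "(\<lambda>n. if \<omega> \<in> N then 0 else Y (q (n + n0)) \<omega>) \<longlonglongrightarrow> K t \<omega>"
        proof (cases "\<omega> \<in> N")
          case False
          then show ?thesis using LIMSEQ_ignore_initial_segment[OF Klim[OF w False], of n0] by simp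
        qed (simp add: K_def)
      qed
    qed
    have unif: "\<exists>c\<ge>0. \<forall>n. excess P c (Y (q n)) \<le> \<epsilon>" if \<epsilon>: "0 < \<epsilon>" for \<epsilon>
    proof -
      obtain c where c: "0 \<le> c" "excess P c \<xi> \<le> \<epsilon>" using excess_tendsto_zero[OF \<xi>(1) \<epsilon>] by blast
      have "excess P c (Y (q n)) \<le> excess P c \<xi>" for n
      proof (rule excess_bound[OF Yint \<xi>(1) c(1) _ _ finite_measure_axioms])
        have [measurable]: "Y (q n) \<in> borel_measurable (F (q n))" by (rule Ym)
        have "{\<omega>\<in>space (F (q n)). c < Y (q n) \<omega>} \<in> sets (F (q n))" "{\<omega>\<in>space (F (q n)). Y (q n) \<omega> < - c} \<in> sets (F (q n))"
          by measurable
        then show "integral_on P {\<omega>\<in>space P. c < Y (q n) \<omega>} (Y (q n))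
            = integral_on P {\<omega>\<in>space P. c < Y (q n) \<omega>} \<xi>"
          "integral_on P {\<omega>\<in>space P. Y (q n) \<omega> < - c} (Y (q n))
            = integral_on P {\<omega>\<in>space P. Y (q n) \<omega> < - c} \<xi>"
          by (simp_all only: space_F YA)
      qed
      then show ?thesis using c by (meson order_trans)
    qed
    note L = uniform_excess_limit[OF finite_measure_axioms Yint measurable_F_P[OF Km] ae unif]
    have "AE \<omega> in P. real_cond_exp P (F t) \<xi> \<omega> = K t \<omega>"
    proof (rule C.real_cond_exp_charact)
      fix A assume A: "A \<in> sets (F t)"
      have "integral_on P A (Y (q n)) = integral_on P A \<xi>" for n
        by (rule YA[OF F_mono[OF _ A]]) (use q(2)[of n] in simp)
      with L(2)[OF _ F_sub[OF A]] have "(\<lambda>n::nat. integral_on P A \<xi>) \<longlonglongrightarrow> integral_on P A (K t)" by simp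
      then show "(\<integral>\<omega>\<in>A. \<xi> \<omega> \<partial>P) = (\<integral>\<omega>\<in>A. K t \<omega> \<partial>P)"
        by (simp add: set_lebesgue_integral_def LIMSEQ_const_iff)
    next
      show "integrable P (K t)" using L(1) by simp
    qed (use \<xi>(1) Km in auto)
    then show ?thesis by eventually_elim simp
  qed
  then show ?thesis using cad by blast
qed

lemma martingale_cond_exp:
  assumes "integrable P \<xi>"
  shows "martingale P F (\<lambda>t. real_cond_exp P (F t) \<xi>)"
proof (rule martingaleI)
  fix s t A assume st: "0 \<le> s" "s \<le> t" and A: "A \<in> sets (F s)"
  interpret S: sigma_finite_subalgebra P "F s" by (rule F_sigma_finite_subalgebra)
  interpret T: sigma_finite_subalgebra P "F t" by (rule F_sigma_finite_subalgebra)
  show "integral_on P A (real_cond_exp P (F t) \<xi>) = integral_on P A (real_cond_exp P (F s) \<xi>)"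
    using S.real_cond_exp_intA[OF assms A] T.real_cond_exp_intA[OF assms F_mono[OF st(2) A]]
    by (simp add: set_lebesgue_integral_def)
next
  fix t :: real
  interpret T: sigma_finite_subalgebra P "F t" by (rule F_sigma_finite_subalgebra)
  show "integrable P (real_cond_exp P (F t) \<xi>)" by (rule T.real_cond_exp_int(1)[OF assms])
qed (simp add: adapted_def)

end

section \<open>Stieltjes integrals of adapted integrands\<close>

lemma right_continuous_extension:
  assumes "right_continuous_path a" "mono_on {0..} a"
  shows "r \<le> s \<Longrightarrow> a (max 0 r) \<le> a (max 0 s)" "continuous (at_right r) (\<lambda>r. a (max 0 r))"
proof -
  show "r \<le> s \<Longrightarrow> a (max 0 r) \<le> a (max 0 s)" by (rule mono_onD[OF assms(2)]) auto
  show "continuous (at_right r) (\<lambda>r. a (max 0 r))"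
  proof (cases "0 \<le> r")
    case True
    have "(a \<longlongrightarrow> a r) (at_right r)" using assms(1) True by (simp add: right_continuous_path_def continuous_within)
    moreover have "\<forall>\<^sub>F s in at_right r. a s = a (max 0 s)"
      using eventually_at_right_less[of r] by eventually_elim (use True in \<open>simp add: max_absorb2\<close>)
    ultimately have "((\<lambda>s. a (max 0 s)) \<longlongrightarrow> a r) (at_right r)" by (rule Lim_transform_eventually)
    then show ?thesis using True by (simp add: continuous_within max_absorb2)
  next
    case False
    have "\<forall>\<^sub>F s in at_right r. a (max 0 s) = a (max 0 r)"
      using eventually_at_right_real[of r 0] False by (auto elim!: eventually_mono simp: max_absorb1)
    then show ?thesis by (simp add: continuous_within tendsto_eventually)
  qed
qed

lemma emeasure_stieltjes_Ioc:
  assumes "right_continuous_path a" "mono_on {0..} a" "0 \<le> s" "s \<le> t"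
  shows "emeasure (interval_measure (\<lambda>r. a (max 0 r))) {s<..t} = ennreal (a t - a s)"
  using emeasure_interval_measure_Ioc[OF assms(4), of "\<lambda>r. a (max 0 r)"] right_continuous_extension[OF assms(1,2)] assms(3,4)
  by (simp add: max_absorb2)

lemma stieltjes_le:
  assumes a: "right_continuous_path a" "mono_on {0..} a" and t: "0 \<le> t"
    and f: "\<And>s. 0 < s \<Longrightarrow> s \<le> t \<Longrightarrow> f s \<le> ennreal K" and K: "0 \<le> K"
  shows "stieltjes a f t \<le> ennreal (K * (a t - a 0))"
proof -
  have "a 0 \<le> a t" using t by (intro mono_onD[OF a(2)]) auto
  have "stieltjes a f t \<le> (\<integral>\<^sup>+s. ennreal K * indicator {0<..t} s \<partial>interval_measure (\<lambda>r. a (max 0 r)))"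
    unfolding stieltjes_def by (intro nn_integral_mono) (auto simp: indicator_def f)
  also have "\<dots> = ennreal K * ennreal (a t - a 0)"
    using emeasure_stieltjes_Ioc[OF a order_refl t] by (simp add: nn_integral_cmult)
  finally show ?thesis using K \<open>a 0 \<le> a t\<close> by (simp add: ennreal_mult)
qed

lemma stieltjes_mono: "s \<le> t \<Longrightarrow> stieltjes a f s \<le> stieltjes a f t"
  unfolding stieltjes_def by (intro nn_integral_mono) (auto simp: indicator_def)

lemma stieltjes_cong: "(\<And>s. 0 < s \<Longrightarrow> s \<le> t \<Longrightarrow> f s = g s) \<Longrightarrow> stieltjes a f t = stieltjes a g t"
  unfolding stieltjes_def by (intro nn_integral_cong) (auto simp: indicator_def)

lemma sup_before_ge: "0 \<le> r \<Longrightarrow> r < s \<Longrightarrow> ereal (x r) \<le> sup_before x s"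
  unfolding sup_before_def by (auto intro!: SUP_upper)

lemma sup_before_le_iff: "0 < s \<Longrightarrow> sup_before x s \<le> ereal u \<longleftrightarrow> (\<forall>r\<in>{0..<s}. x r \<le> u)"
  unfolding sup_before_def by (auto simp: SUP_le_iff)

lemma left_lim_tendsto: "has_left_limits x \<Longrightarrow> 0 < s \<Longrightarrow> (x \<longlongrightarrow> left_lim x s) (at_left s)"
proof -
  assume "has_left_limits x" "0 < s"
  then obtain l where l: "(x \<longlongrightarrow> l) (at_left s)" by (auto simp: has_left_limits_def)
  then have "left_lim x s = l" unfolding left_lim_def by (intro tendsto_Lim) simp_all
  then show ?thesis using l by simp
qed

lemma left_lim_bounds:
  assumes "has_left_limits x" "0 < s" "\<And>r. 0 \<le> r \<Longrightarrow> r < s \<Longrightarrow> c \<le> x r \<and> x r \<le> C"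
  shows "c \<le> left_lim x s" "left_lim x s \<le> C"
proof -
  have ev: "\<forall>\<^sub>F r in at_left s. c \<le> x r \<and> x r \<le> C"
    using eventually_at_left_real[OF assms(2)] by eventually_elim (auto intro!: assms(3))
  note lim = left_lim_tendsto[OF assms(1,2)]
  show "c \<le> left_lim x s" by (rule tendsto_lowerbound[OF lim]) (use ev in \<open>auto elim: eventually_mono\<close>)
  show "left_lim x s \<le> C" by (rule tendsto_upperbound[OF lim]) (use ev in \<open>auto elim: eventually_mono\<close>)
qed

lemma eta_integrand_le:
  assumes \<eta>: "mono_on {c0..} \<eta>" and x: "\<And>s. 0 \<le> s \<Longrightarrow> c0 \<le> x s"
    and ll: "r = No_Sup_Regime \<Longrightarrow> has_left_limits x"
    and s: "0 < s" "\<And>q. 0 \<le> q \<Longrightarrow> q < s \<Longrightarrow> x q \<le> C"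
  shows "eta_integrand r c0 \<eta> x s \<le> ennreal (\<eta> C)"
proof -
  have C: "c0 \<le> C" using x[of 0] s(2)[of 0] s(1) by simp
  show ?thesis
  proof (cases r)
    case Sup_Regime
    have "sup_before x s \<le> ereal C" using s by (simp add: sup_before_le_iff)
    moreover have "ereal c0 \<le> sup_before x s" using x[of 0] sup_before_ge[of 0 s x] s(1) by (auto intro: order_trans[rotated])
    ultimately obtain y where y: "sup_before x s = ereal y" "c0 \<le> y" "y \<le> C" by (cases "sup_before x s") auto
    then have "\<eta> y \<le> \<eta> C" using C by (intro mono_onD[OF \<eta>]) auto
    then show ?thesis using Sup_Regime y by (simp add: eta_ext_def ennreal_leI)
  next
    case No_Sup_Regime
    have "c0 \<le> left_lim x s" "left_lim x s \<le> C" using left_lim_bounds[OF ll[OF No_Sup_Regime] s(1), of c0 C] x s(2) by auto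
    then have "\<eta> (left_lim x s) \<le> \<eta> C" using C by (intro mono_onD[OF \<eta>]) auto
    then show ?thesis using No_Sup_Regime by (simp add: ennreal_leI)
  qed
qed

context usual_filtered_prob_space
begin

text \<open>
  Measurability of a Stieltjes integral in its parameter: after normalisation the Stieltjes measures
  on \<open>(0, t]\<close> form a sub-probability kernel.
\<close>

lemma stieltjes_measurable:
  fixes A :: "real \<Rightarrow> 'a \<Rightarrow> real" and f :: "'a \<Rightarrow> real \<Rightarrow> ennreal"
  assumes A: "adapted F A" "\<And>\<omega>. \<omega> \<in> space P \<Longrightarrow> right_continuous_path (\<lambda>t. A t \<omega>) \<and> mono_on {0..} (\<lambda>t. A t \<omega>)"
    and t: "0 \<le> t"
    and f: "(\<lambda>(\<omega>, s). f \<omega> s * indicator {0<..t} s) \<in> borel_measurable (F t \<Otimes>\<^sub>M borel)"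
  shows "(\<lambda>\<omega>. stieltjes (\<lambda>s. A s \<omega>) (f \<omega>) t) \<in> borel_measurable (F t)"
proof -
  define \<mu> where "\<mu> \<omega> = interval_measure (\<lambda>r. A (max 0 r) \<omega>)" for \<omega>
  \<comment> \<open>the summand \<open>1\<close> keeps the normalisation finite where \<open>A\<close> does not grow\<close>
  define c where "c \<omega> = 1 + A t \<omega> - A 0 \<omega>" for \<omega>
  define L where "L \<omega> = density (\<mu> \<omega>) (\<lambda>s. ennreal (1 / c \<omega>) * indicator {0<..t} s)" for \<omega>
  have sets_\<mu> [measurable_cong, simp]: "sets (\<mu> \<omega>) = sets borel" for \<omega> by (simp add: \<mu>_def)
  have Am: "A s \<in> borel_measurable (F t)" if "0 \<le> s" "s \<le> t" for s
    using A(1) that by (intro measurable_F_mono[OF that(2)]) (simp add: adapted_def)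
  have [measurable]: "A t \<in> borel_measurable (F t)" "A 0 \<in> borel_measurable (F t)" using Am t by auto
  have [measurable]: "c \<in> borel_measurable (F t)" unfolding c_def[abs_def] by measurable
  have mono: "A 0 \<omega> \<le> A t \<omega>" if "\<omega> \<in> space P" for \<omega>
    using A(2)[OF that] t by (auto intro: mono_onD[of "{0..}" "\<lambda>t. A t \<omega>"])
  have cpos: "1 \<le> c \<omega>" if "\<omega> \<in> space P" for \<omega> using mono[OF that] by (simp add: c_def)
  have EL: "emeasure (L \<omega>) B = ennreal (1 / c \<omega>) * emeasure (\<mu> \<omega>) ({0<..t} \<inter> B)" if [measurable]: "B \<in> sets borel" for \<omega> B
  proof -
    have "emeasure (L \<omega>) B = (\<integral>\<^sup>+s. ennreal (1 / c \<omega>) * indicator {0<..t} s * indicator B s \<partial>\<mu> \<omega>)"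
      unfolding L_def by (rule emeasure_density) (auto simp: \<mu>_def)
    also have "\<dots> = (\<integral>\<^sup>+s. ennreal (1 / c \<omega>) * indicator ({0<..t} \<inter> B) s \<partial>\<mu> \<omega>)"
      by (intro nn_integral_cong) (auto simp: indicator_def)
    also have "\<dots> = ennreal (1 / c \<omega>) * emeasure (\<mu> \<omega>) ({0<..t} \<inter> B)"
      by (rule nn_integral_cmult_indicator) simp
    finally show ?thesis .
  qed
  have E\<mu>: "emeasure (\<mu> \<omega>) {0<..x} = ennreal (A x \<omega> - A 0 \<omega>)" if "\<omega> \<in> space P" "0 \<le> x" for \<omega> x
    using emeasure_stieltjes_Ioc[of "\<lambda>t. A t \<omega>" 0 x] A(2)[OF that(1)] that(2) by (simp add: \<mu>_def)
  have ELtop: "emeasure (L \<omega>) UNIV = ennreal (1 / c \<omega>) * ennreal (A t \<omega> - A 0 \<omega>)" if "\<omega> \<in> space P" for \<omega>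
    using EL[of UNIV \<omega>] E\<mu>[OF that t] by simp
  have "L \<in> measurable (F t) (subprob_algebra borel)"
  proof (rule measurable_subprob_algebra_generated[where G="range (\<lambda>x::real. {..x})" and \<Omega>=UNIV])
    show "sets borel = sigma_sets UNIV (range (\<lambda>x::real. {..x}))" by (subst borel_eq_atMost) (simp add: sets_measure_of)
    show "Int_stable (range (\<lambda>x::real. {..x}))"
    proof (rule Int_stableI, elim rangeE, hypsubst)
      fix x y :: real
      have "{..x} \<inter> {..y} = {..min x y}" by auto
      then show "{..x} \<inter> {..y} \<in> range (\<lambda>x. {..x})" by blast
    qed
    fix \<omega> assume "\<omega> \<in> space (F t)"
    then have w: "\<omega> \<in> space P" by (simp add: space_F)
    show "sets (L \<omega>) = sets borel" by (simp add: L_def)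
    show "subprob_space (L \<omega>)"
    proof
      have "emeasure (L \<omega>) (space (L \<omega>)) = emeasure (L \<omega>) UNIV" by (simp add: L_def \<mu>_def)
      also have "\<dots> = ennreal ((A t \<omega> - A 0 \<omega>) / c \<omega>)"
        using ELtop[OF w] mono[OF w] cpos[OF w] by (simp flip: ennreal_mult)
      also have "\<dots> \<le> ennreal 1" using cpos[OF w] by (intro ennreal_leI) (simp add: c_def)
      finally show "emeasure (L \<omega>) (space (L \<omega>)) \<le> 1" by simp
      show "space (L \<omega>) \<noteq> {}" by (simp add: L_def \<mu>_def)
    qed
  next
    fix B :: "real set" assume "B \<in> range (\<lambda>x. {..x})"
    then obtain x where B: "B = {..x}" by blast
    have "emeasure (L \<omega>) B = (if 0 \<le> x then ennreal (1 / c \<omega>) * ennreal (A (min t x) \<omega> - A 0 \<omega>) else 0)"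
      if "\<omega> \<in> space (F t)" for \<omega>
    proof -
      have w: "\<omega> \<in> space P" using that by (simp add: space_F)
      have "{0<..t} \<inter> {..x} = {0<..min t x}" by auto
      moreover have "{0<..min t x} = {}" if "\<not> 0 \<le> x" using that by auto
      ultimately show ?thesis unfolding B using EL[of "{..x}" \<omega>] E\<mu>[OF w, of "min t x"] t by (auto simp del: greaterThanAtMost_empty_iff)
    qed
    moreover have "(\<lambda>\<omega>. if 0 \<le> x then ennreal (1 / c \<omega>) * ennreal (A (min t x) \<omega> - A 0 \<omega>) else 0) \<in> borel_measurable (F t)"
    proof (cases "0 \<le> x")
      case True
      have [measurable]: "A (min t x) \<in> borel_measurable (F t)" using True t by (intro Am) auto
      show ?thesis by measurable
    qed simp
    ultimately show "(\<lambda>\<omega>. emeasure (L \<omega>) B) \<in> borel_measurable (F t)"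
      by (subst measurable_cong) auto
  next
    have "(\<lambda>\<omega>. ennreal (1 / c \<omega>) * ennreal (A t \<omega> - A 0 \<omega>)) \<in> borel_measurable (F t)" by measurable
    then show "(\<lambda>\<omega>. emeasure (L \<omega>) UNIV) \<in> borel_measurable (F t)"
      by (rule measurable_cong[THEN iffD1, rotated]) (simp add: ELtop space_F)
  qed auto
  from nn_integral_measurable_subprob_algebra2[OF f this]
  have "(\<lambda>\<omega>. ennreal (c \<omega>) * (\<integral>\<^sup>+s. f \<omega> s * indicator {0<..t} s \<partial>L \<omega>)) \<in> borel_measurable (F t)" by measurable
  also have "?this \<longleftrightarrow> ?thesis"
  proof (rule measurable_cong)
    fix \<omega> assume wt: "\<omega> \<in> space (F t)"
    then have w: "\<omega> \<in> space P" by (simp add: space_F)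
    have [measurable]: "(\<lambda>s. f \<omega> s * indicator {0<..t} s) \<in> borel_measurable borel"
      using measurable_Pair2[OF f wt] by simp
    have "(\<integral>\<^sup>+s. f \<omega> s * indicator {0<..t} s \<partial>L \<omega>)
        = (\<integral>\<^sup>+s. ennreal (1 / c \<omega>) * indicator {0<..t} s * (f \<omega> s * indicator {0<..t} s) \<partial>\<mu> \<omega>)"
      unfolding L_def by (rule nn_integral_density) auto
    also have "\<dots> = (\<integral>\<^sup>+s. ennreal (1 / c \<omega>) * (f \<omega> s * indicator {0<..t} s) \<partial>\<mu> \<omega>)"
      by (intro nn_integral_cong) (auto simp: indicator_def)
    also have "\<dots> = ennreal (1 / c \<omega>) * (\<integral>\<^sup>+s. f \<omega> s * indicator {0<..t} s \<partial>\<mu> \<omega>)"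
      by (rule nn_integral_cmult) auto
    finally have "ennreal (c \<omega>) * (\<integral>\<^sup>+s. f \<omega> s * indicator {0<..t} s \<partial>L \<omega>)
        = (ennreal (c \<omega>) * ennreal (1 / c \<omega>)) * (\<integral>\<^sup>+s. f \<omega> s * indicator {0<..t} s \<partial>\<mu> \<omega>)"
      by (simp only: mult.assoc)
    also have "ennreal (c \<omega>) * ennreal (1 / c \<omega>) = 1" using cpos[OF w] by (simp flip: ennreal_mult)
    finally show "ennreal (c \<omega>) * (\<integral>\<^sup>+s. f \<omega> s * indicator {0<..t} s \<partial>L \<omega>) = stieltjes (\<lambda>s. A s \<omega>) (f \<omega>) t"
      by (simp add: stieltjes_def \<mu>_def)
  qed
  finally show ?thesis .
qed

text \<open>
  By right-continuity the supremum over \<open>[0, s)\<close> may be taken over rational times.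
\<close>

lemma sup_before_measurable:
  assumes X: "adapted F X" "\<And>\<omega>. \<omega> \<in> space P \<Longrightarrow> right_continuous_path (\<lambda>t. X t \<omega>)" and t: "0 \<le> t"
  obtains G where "(\<lambda>(\<omega>, s). G \<omega> s :: ereal) \<in> borel_measurable (F t \<Otimes>\<^sub>M borel)"
    "\<And>\<omega> s. \<omega> \<in> space P \<Longrightarrow> 0 < s \<Longrightarrow> s \<le> t \<Longrightarrow> sup_before (\<lambda>q. X q \<omega>) s = G \<omega> s"
proof
  let ?G = "\<lambda>\<omega> s. SUP q\<in>\<rat> \<inter> {0..t}. if q < s then ereal (X q \<omega>) else - \<infinity>"
  have "(\<lambda>p. SUP q\<in>\<rat> \<inter> {0..t}. if q < snd p then ereal (X q (fst p)) else - \<infinity>) \<in> borel_measurable (F t \<Otimes>\<^sub>M borel)"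
  proof (rule borel_measurable_SUP)
    show "countable (\<rat> \<inter> {0..t})" by (simp add: countable_rat)
    fix q assume "q \<in> \<rat> \<inter> {0..t}"
    then have [measurable]: "X q \<in> borel_measurable (F t)"
      using X(1) by (intro measurable_F_mono[of q t]) (auto simp: adapted_def)
    show "(\<lambda>p. if q < snd p then ereal (X q (fst p)) else - \<infinity>) \<in> borel_measurable (F t \<Otimes>\<^sub>M borel)" by measurable
  qed
  then show "(\<lambda>(\<omega>, s). ?G \<omega> s) \<in> borel_measurable (F t \<Otimes>\<^sub>M borel)" by (simp add: case_prod_beta)
  fix \<omega> s assume w: "\<omega> \<in> space P" and s: "0 < s" "s \<le> t"
  show "sup_before (\<lambda>q. X q \<omega>) s = ?G \<omega> s"
  proof (rule antisym)
    have "ereal (X r \<omega>) \<le> ?G \<omega> s" if r: "0 \<le> r" "r < s" for r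
    proof (rule ccontr)
      assume "\<not> ereal (X r \<omega>) \<le> ?G \<omega> s"
      then obtain y where y: "?G \<omega> s < ereal y" "ereal y < ereal (X r \<omega>)" using ereal_dense2[of "?G \<omega> s" "ereal (X r \<omega>)"] by (auto simp: not_le)
      obtain q where q: "q \<in> \<rat>" "r < q" "q < s" "y < X q \<omega>"
        using rational_between_right[of y "\<lambda>t. X t \<omega>" r s] y(2) X(2)[OF w] r
        by (auto simp: right_continuous_path_def continuous_within)
      have "ereal (X q \<omega>) \<le> ?G \<omega> s" using q r s by (intro SUP_upper2[of q]) auto
      then have "ereal (X q \<omega>) < ereal y" using y(1) by (rule le_less_trans)
      then show False using q(4) by simp
    qed
    then show "sup_before (\<lambda>q. X q \<omega>) s \<le> ?G \<omega> s" using s by (auto simp: sup_before_def intro!: SUP_least)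
    show "?G \<omega> s \<le> sup_before (\<lambda>q. X q \<omega>) s"
      by (rule SUP_least) (auto intro: sup_before_ge)
  qed
qed

text \<open>
  The left limit at \<open>s\<close> is approached along the grid point one step below the rounded-up time, which lies
  strictly before \<open>s\<close>; for fixed mesh this is a countable case distinction.
\<close>

lemma left_lim_measurable:
  assumes X: "adapted F X" "\<And>\<omega>. \<omega> \<in> space P \<Longrightarrow> has_left_limits (\<lambda>t. X t \<omega>)" and t: "0 \<le> t"
  shows "(\<lambda>(\<omega>, s). left_lim (\<lambda>q. X q \<omega>) s * indicator {0<..t} s) \<in> borel_measurable (F t \<Otimes>\<^sub>M borel)"
proof (rule borel_measurable_LIMSEQ_metric)
  define pt where "pt n i = min t (max 0 ((real_of_int i - 1) / real (Suc n)))" for n i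
  show "(\<lambda>p. X (pt n \<lceil>real (Suc n) * snd p\<rceil>) (fst p) * indicator {0<..t} (snd p)) \<in> borel_measurable (F t \<Otimes>\<^sub>M borel)" for n
  proof -
    have [measurable]: "X (pt n i) \<in> borel_measurable (F t)" for i
      using X(1) t by (intro measurable_F_mono[of "pt n i" t]) (auto simp: adapted_def pt_def)
    have "(\<lambda>p. (\<lambda>i p. X (pt n i) (fst p)) \<lceil>real (Suc n) * snd p\<rceil> p) \<in> borel_measurable (F t \<Otimes>\<^sub>M borel)"
      by (rule measurable_compose_countable) measurable
    then show ?thesis by measurable
  qed
  fix p assume "p \<in> space (F t \<Otimes>\<^sub>M (borel :: real measure))"
  then obtain \<omega> s where p: "p = (\<omega>, s)" and w: "\<omega> \<in> space P" by (auto simp: space_pair_measure space_F)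
  show "(\<lambda>n. X (pt n \<lceil>real (Suc n) * snd p\<rceil>) (fst p) * indicator {0<..t} (snd p))
      \<longlonglongrightarrow> (case p of (\<omega>, s) \<Rightarrow> left_lim (\<lambda>q. X q \<omega>) s * indicator {0<..t} s)"
  proof (cases "0 < s \<and> s \<le> t")
    case True
    have lt: "pt n \<lceil>real (Suc n) * s\<rceil> < s" for n
    proof -
      have "real_of_int \<lceil>real (Suc n) * s\<rceil> - 1 < real (Suc n) * s" by linarith
      then have "(real_of_int \<lceil>real (Suc n) * s\<rceil> - 1) / real (Suc n) < s" by (simp add: divide_less_eq mult.commute)
      then show ?thesis using True by (simp add: pt_def)
    qed
    have "(\<lambda>n. min t (max 0 (\<lceil>real (Suc n) * s\<rceil> / real (Suc n) - 1 / real (Suc n)))) \<longlonglongrightarrow> min t (max 0 (s - 0))"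
      by (intro tendsto_min tendsto_max tendsto_const tendsto_diff LIMSEQ_ceiling_grid LIMSEQ_Suc lim_const_over_n)
    then have "(\<lambda>n. pt n \<lceil>real (Suc n) * s\<rceil>) \<longlonglongrightarrow> s" using True by (simp add: pt_def diff_divide_distrib)
    then have "filterlim (\<lambda>n. pt n \<lceil>real (Suc n) * s\<rceil>) (at_left s) sequentially"
      unfolding filterlim_at using lt by (auto intro!: always_eventually simp: less_imp_neq)
    then have "(\<lambda>n. X (pt n \<lceil>real (Suc n) * s\<rceil>) \<omega>) \<longlonglongrightarrow> left_lim (\<lambda>q. X q \<omega>) s"
      by (rule filterlim_compose[OF left_lim_tendsto[OF X(2)[OF w] conjunct1[OF True]]])
    then show ?thesis using True p by simp
  qed (auto simp: p)
qed

lemma eta_integrand_measurable: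
  assumes X: "adapted F X" "\<And>\<omega>. \<omega> \<in> space P \<Longrightarrow> right_continuous_path (\<lambda>t. X t \<omega>)"
      "\<And>\<omega>. \<omega> \<in> space P \<Longrightarrow> r = No_Sup_Regime \<Longrightarrow> has_left_limits (\<lambda>t. X t \<omega>)"
      "\<And>\<omega> t. \<omega> \<in> space P \<Longrightarrow> 0 \<le> t \<Longrightarrow> c0 \<le> X t \<omega>"
    and \<eta>: "continuous_on {c0..} \<eta>" and t: "0 \<le> t"
  shows "(\<lambda>(\<omega>, s). eta_integrand r c0 \<eta> (\<lambda>q. X q \<omega>) s * indicator {0<..t} s) \<in> borel_measurable (F t \<Otimes>\<^sub>M borel)"
    and "(\<lambda>(\<omega>, s). eta_integrand r c0 \<eta> (\<lambda>q. X q \<omega>) s * of_bool (sup_before (\<lambda>q. X q \<omega>) s \<le> ereal u) * indicator {0<..t} s)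
      \<in> borel_measurable (F t \<Otimes>\<^sub>M borel)"
proof -
  obtain G where G [measurable]: "(\<lambda>(\<omega>, s). G \<omega> s :: ereal) \<in> borel_measurable (F t \<Otimes>\<^sub>M borel)"
    and G_eq: "\<And>\<omega> s. \<omega> \<in> space P \<Longrightarrow> 0 < s \<Longrightarrow> s \<le> t \<Longrightarrow> sup_before (\<lambda>q. X q \<omega>) s = G \<omega> s"
    using sup_before_measurable[OF X(1,2) t] by blast
  have "continuous_on UNIV (\<lambda>x. \<eta> (max c0 x))"
    by (rule continuous_on_compose2[OF \<eta>]) (auto intro!: continuous_intros)
  then have \<eta>m [measurable]: "(\<lambda>x. \<eta> (max c0 x)) \<in> borel_measurable borel" by (rule borel_measurable_continuous_onI)
  have main: "(\<lambda>(\<omega>, s). eta_integrand r c0 \<eta> (\<lambda>q. X q \<omega>) s * indicator {0<..t} s) \<in> borel_measurable (F t \<Otimes>\<^sub>M borel)"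
  proof (cases r)
    case Sup_Regime
    define e where "e x = (if x = \<infinity> then SUP r\<in>{c0..}. ennreal (\<eta> r) else ennreal (\<eta> (max c0 (real_of_ereal x))))" for x
    have [measurable]: "e \<in> borel_measurable borel" unfolding e_def[abs_def] by measurable
    have "(\<lambda>(\<omega>, s). e (G \<omega> s) * indicator {0<..t} s) \<in> borel_measurable (F t \<Otimes>\<^sub>M borel)"
      by measurable
    also have "?this \<longleftrightarrow> ?thesis"
    proof (rule measurable_cong)
      fix p assume "p \<in> space (F t \<Otimes>\<^sub>M (borel :: real measure))"
      then obtain \<omega> s where p: "p = (\<omega>, s)" and w: "\<omega> \<in> space P" by (auto simp: space_pair_measure space_F)
      have "e (G \<omega> s) = eta_ext c0 \<eta> (sup_before (\<lambda>q. X q \<omega>) s)" if s: "0 < s" "s \<le> t"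
      proof -
        have "ereal c0 \<le> ereal (X 0 \<omega>)" using X(4)[OF w order_refl] by simp
        also have "\<dots> \<le> sup_before (\<lambda>q. X q \<omega>) s" using s by (intro sup_before_ge) auto
        finally have "ereal c0 \<le> G \<omega> s" using G_eq[OF w s] by simp
        then have "G \<omega> s = \<infinity> \<or> max c0 (real_of_ereal (G \<omega> s)) = real_of_ereal (G \<omega> s)" by (cases "G \<omega> s") auto
        then show ?thesis unfolding G_eq[OF w s] e_def eta_ext_def by auto
      qed
      then show "(case p of (\<omega>, s) \<Rightarrow> e (G \<omega> s) * indicator {0<..t} s)
          = (case p of (\<omega>, s) \<Rightarrow> eta_integrand r c0 \<eta> (\<lambda>q. X q \<omega>) s * indicator {0<..t} s)"
        using Sup_Regime by (simp add: p indicator_def)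
    qed
    finally show ?thesis .
  next
    case No_Sup_Regime
    have [measurable]: "(\<lambda>(\<omega>, s). left_lim (\<lambda>q. X q \<omega>) s * indicator {0<..t} s) \<in> borel_measurable (F t \<Otimes>\<^sub>M borel)"
      using X(3) No_Sup_Regime by (intro left_lim_measurable X(1) t) auto
    have "(\<lambda>p. (\<lambda>x. \<eta> (max c0 x)) (case p of (\<omega>, s) \<Rightarrow> left_lim (\<lambda>q. X q \<omega>) s * indicator {0<..t} s)) \<in> borel_measurable (F t \<Otimes>\<^sub>M borel)"
      by (rule measurable_compose[OF _ \<eta>m]) measurable
    then have "(\<lambda>p. ennreal (\<eta> (max c0 (case p of (\<omega>, s) \<Rightarrow> left_lim (\<lambda>q. X q \<omega>) s * indicator {0<..t} s))) * indicator {0<..t} (snd p))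
      \<in> borel_measurable (F t \<Otimes>\<^sub>M borel)" by measurable
    also have "?this \<longleftrightarrow> ?thesis"
    proof (rule measurable_cong)
      fix p assume "p \<in> space (F t \<Otimes>\<^sub>M (borel :: real measure))"
      then obtain \<omega> s where p: "p = (\<omega>, s)" and w: "\<omega> \<in> space P" by (auto simp: space_pair_measure space_F)
      have "c0 \<le> left_lim (\<lambda>q. X q \<omega>) s" if "0 < s"
      proof -
        have ev: "\<forall>\<^sub>F r in at_left s. c0 \<le> X r \<omega>"
          using eventually_at_left_real[OF that] by eventually_elim (auto intro!: X(4)[OF w])
        show ?thesis
          by (rule tendsto_lowerbound[OF left_lim_tendsto[OF X(3)[OF w No_Sup_Regime] that] ev]) simp
      qed
      then show "ennreal (\<eta> (max c0 (case p of (\<omega>, s) \<Rightarrow> left_lim (\<lambda>q. X q \<omega>) s * indicator {0<..t} s))) * indicator {0<..t} (snd p)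
          = (case p of (\<omega>, s) \<Rightarrow> eta_integrand r c0 \<eta> (\<lambda>q. X q \<omega>) s * indicator {0<..t} s)"
        using No_Sup_Regime by (auto simp: p indicator_def max_absorb2)
    qed
    finally show ?thesis .
  qed
  then show "(\<lambda>(\<omega>, s). eta_integrand r c0 \<eta> (\<lambda>q. X q \<omega>) s * indicator {0<..t} s) \<in> borel_measurable (F t \<Otimes>\<^sub>M borel)" .
  have "(\<lambda>p. (case p of (\<omega>, s) \<Rightarrow> eta_integrand r c0 \<eta> (\<lambda>q. X q \<omega>) s * indicator {0<..t} s)
      * (if (case p of (\<omega>, s) \<Rightarrow> G \<omega> s) \<le> ereal u then 1 else 0)) \<in> borel_measurable (F t \<Otimes>\<^sub>M borel)"
    by (intro borel_measurable_times_ennreal main) measurable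
  also have "?this \<longleftrightarrow> (\<lambda>(\<omega>, s). eta_integrand r c0 \<eta> (\<lambda>q. X q \<omega>) s * of_bool (sup_before (\<lambda>q. X q \<omega>) s \<le> ereal u) * indicator {0<..t} s)
      \<in> borel_measurable (F t \<Otimes>\<^sub>M borel)"
  proof (rule measurable_cong)
    fix p assume "p \<in> space (F t \<Otimes>\<^sub>M (borel :: real measure))"
    then obtain \<omega> s where p: "p = (\<omega>, s)" and w: "\<omega> \<in> space P" by (auto simp: space_pair_measure space_F)
    show "(case p of (\<omega>, s) \<Rightarrow> eta_integrand r c0 \<eta> (\<lambda>q. X q \<omega>) s * indicator {0<..t} s)
      * (if (case p of (\<omega>, s) \<Rightarrow> G \<omega> s) \<le> ereal u then 1 else 0)
      = (case p of (\<omega>, s) \<Rightarrow> eta_integrand r c0 \<eta> (\<lambda>q. X q \<omega>) s * of_bool (sup_before (\<lambda>q. X q \<omega>) s \<le> ereal u) * indicator {0<..t} s)"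
      using G_eq[OF w, of s] by (auto simp: p indicator_def)
  qed
  finally show "(\<lambda>(\<omega>, s). eta_integrand r c0 \<eta> (\<lambda>q. X q \<omega>) s * of_bool (sup_before (\<lambda>q. X q \<omega>) s \<le> ereal u) * indicator {0<..t} s)
      \<in> borel_measurable (F t \<Otimes>\<^sub>M borel)" .
qed

end

section \<open>The integral inequality up to the exit time\<close>

locale gronwall_setting = usual_filtered_prob_space P F
  for P :: "'a measure" and F :: "real \<Rightarrow> 'a measure" +
  fixes r :: regime and c0 :: real and \<eta> :: "real \<Rightarrow> real"
    and X A H M :: "real \<Rightarrow> 'a \<Rightarrow> real" and u :: real
  assumes gronwall: "gronwall_assumption r P F c0 \<eta> X A H M" and u_pos: "0 < u"
begin

lemma c0_nonneg: "0 \<le> c0"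
  and X_adapted: "adapted F X"
  and X_right_continuous: "\<And>\<omega>. \<omega> \<in> space P \<Longrightarrow> right_continuous_path (\<lambda>t. X t \<omega>)"
  and X_ge: "\<And>\<omega> t. \<omega> \<in> space P \<Longrightarrow> 0 \<le> t \<Longrightarrow> c0 \<le> X t \<omega>"
  and X_left_limits: "\<And>\<omega>. \<omega> \<in> space P \<Longrightarrow> r = No_Sup_Regime \<Longrightarrow> has_left_limits (\<lambda>t. X t \<omega>)"
  and A_path: "\<And>\<omega>. \<omega> \<in> space P \<Longrightarrow> right_continuous_path (\<lambda>t. A t \<omega>) \<and> mono_on {0..} (\<lambda>t. A t \<omega>)"
  and H_adapted: "adapted F H"
  and H_path: "\<And>\<omega>. \<omega> \<in> space P \<Longrightarrow> right_continuous_path (\<lambda>t. H t \<omega>) \<and> mono_on {0..} (\<lambda>t. H t \<omega>)"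
  and H_nonneg: "\<And>\<omega> t. \<omega> \<in> space P \<Longrightarrow> 0 \<le> t \<Longrightarrow> 0 \<le> H t \<omega>"
  and M_local_martingale: "cadlag_local_martingale_from_0 P F M"
  and eta_continuous: "continuous_on {c0..} \<eta>" and eta_mono: "mono_on {c0..} \<eta>"
  and eta_nonneg: "\<And>x. c0 \<le> x \<Longrightarrow> 0 \<le> \<eta> x"
  and integral_inequality: "\<And>t. 0 \<le> t \<Longrightarrow> AE \<omega> in P.
        ereal (X t \<omega>) \<le> enn2ereal (stieltjes (\<lambda>s. A s \<omega>) (eta_integrand r c0 \<eta> (\<lambda>s. X s \<omega>)) t)
          + ereal (M t \<omega> + H t \<omega>)"
  using gronwall unfolding gronwall_assumption_def cadlag_def by blast+

lemma A_adapted: "adapted F A"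
  using gronwall unfolding gronwall_assumption_def by (intro predictable_imp_adapted) blast

lemma H_mono: "\<omega> \<in> space P \<Longrightarrow> 0 \<le> s \<Longrightarrow> s \<le> t \<Longrightarrow> H s \<omega> \<le> H t \<omega>"
  using H_path[of \<omega>] by (auto intro: mono_onD[of "{0..}" "\<lambda>t. H t \<omega>"])

lemma M_path: "\<omega> \<in> space P \<Longrightarrow> cadlag (\<lambda>t. M t \<omega>)"
  and M_zero: "AE \<omega> in P. M 0 \<omega> = 0"
  using M_local_martingale by (auto simp: cadlag_local_martingale_from_0_def)

abbreviation (input) "integrand \<omega> \<equiv> eta_integrand r c0 \<eta> (\<lambda>q. X q \<omega>)"
abbreviation (input) "cut_integrand \<omega> \<equiv> \<lambda>s. integrand \<omega> s * of_bool (sup_before (\<lambda>q. X q \<omega>) s \<le> ereal u)"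
abbreviation "I \<equiv> I_L r c0 \<eta> X A u"

lemma integrand_le:
  assumes "\<omega> \<in> space P" "0 < s" "\<And>q. 0 \<le> q \<Longrightarrow> q < s \<Longrightarrow> X q \<omega> \<le> C"
  shows "integrand \<omega> s \<le> ennreal (\<eta> C)"
  by (rule eta_integrand_le[OF eta_mono]) (use assms X_ge X_left_limits in auto)

lemma cut_integrand_bound:
  assumes w: "\<omega> \<in> space P" and t: "0 \<le> t"
  shows "stieltjes (\<lambda>s. A s \<omega>) (cut_integrand \<omega>) t < \<top>"
proof -
  let ?K = "max 0 (\<eta> u)"
  have "stieltjes (\<lambda>s. A s \<omega>) (cut_integrand \<omega>) t \<le> ennreal (?K * (A t \<omega> - A 0 \<omega>))"
  proof (rule stieltjes_le)
    fix s assume s: "0 < s" "s \<le> t"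
    show "cut_integrand \<omega> s \<le> ennreal ?K"
    proof (cases "sup_before (\<lambda>q. X q \<omega>) s \<le> ereal u")
      case True
      then have "integrand \<omega> s \<le> ennreal (\<eta> u)" using s by (intro integrand_le w) (auto simp: sup_before_le_iff)
      also have "\<dots> \<le> ennreal ?K" by (rule ennreal_leI) simp
      finally show ?thesis using True by simp
    qed simp
  qed (use A_path[OF w] t in auto)
  also have "\<dots> < \<top>" by simp
  finally show ?thesis .
qed

lemma I_nonneg: "0 \<le> I t \<omega>"
  by (simp add: I_L_def)

lemma I_mono: "\<omega> \<in> space P \<Longrightarrow> 0 \<le> s \<Longrightarrow> s \<le> t \<Longrightarrow> I s \<omega> \<le> I t \<omega>"
  unfolding I_L_def by (intro enn2real_mono stieltjes_mono cut_integrand_bound) auto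

lemma I_nondecreasing: "nondecreasing_process F I"
proof -
  have "I t \<in> borel_measurable (F t)" if t: "0 \<le> t" for t
  proof -
    have "(\<lambda>\<omega>. stieltjes (\<lambda>s. A s \<omega>) (cut_integrand \<omega>) t) \<in> borel_measurable (F t)"
      by (rule stieltjes_measurable[OF A_adapted A_path t eta_integrand_measurable(2)])
        (use X_adapted X_right_continuous X_left_limits X_ge eta_continuous t in auto)
    then show ?thesis unfolding I_L_def[abs_def] by measurable
  qed
  then show ?thesis
    unfolding nondecreasing_process_def adapted_def by (auto intro!: mono_onI I_mono simp: space_F)
qed

text \<open>
  The integral inequality, assumed at each time up to a null set, holds simultaneously for all times
  up to which \<open>X\<close> has stayed below \<open>u\<close>: let rational times decrease to \<open>t\<close>.  By right-continuity \<open>X\<close>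
  is bounded shortly after \<open>t\<close>, so the integral over that short interval is small.
\<close>

lemma integral_inequality_path:
  assumes w: "\<omega> \<in> space P" and t: "0 \<le> t" and below: "\<And>s. 0 \<le> s \<Longrightarrow> s < t \<Longrightarrow> X s \<omega> \<le> u"
    and ineq: "\<And>q. q \<in> \<rat> \<Longrightarrow> 0 \<le> q \<Longrightarrow>
        ereal (X q \<omega>) \<le> enn2ereal (stieltjes (\<lambda>s. A s \<omega>) (integrand \<omega>) q) + ereal (M q \<omega> + H q \<omega>)"
  shows "X t \<omega> \<le> I t \<omega> + M t \<omega> + H t \<omega>"
proof -
  note a = conjunct1[OF A_path[OF w]] conjunct2[OF A_path[OF w]]
  let ?S = "stieltjes (\<lambda>s. A s \<omega>) (integrand \<omega>)"
  have St: "?S t = stieltjes (\<lambda>s. A s \<omega>) (cut_integrand \<omega>) t"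
    by (rule stieltjes_cong) (use below in \<open>auto simp: sup_before_le_iff\<close>)
  then have St_real: "?S t = ennreal (I t \<omega>)"
    using cut_integrand_bound[OF w t] by (simp add: I_L_def)
  have Xrc: "((\<lambda>s. X s \<omega>) \<longlongrightarrow> X t \<omega>) (at_right t)"
    using X_right_continuous[OF w] t by (simp add: right_continuous_path_def continuous_within)
  then have "\<forall>\<^sub>F s in at_right t. X s \<omega> < X t \<omega> + 1" by (rule order_tendstoD) simp
  then obtain b where b: "t < b" "\<And>s. t < s \<Longrightarrow> s < b \<Longrightarrow> X s \<omega> < X t \<omega> + 1"
    by (auto simp: eventually_at_right_field)
  \<comment> \<open>a bound for \<open>X\<close> on \<open>[0, b)\<close>, slightly past \<open>t\<close>\<close>
  define C where "C = max u (X t \<omega> + 1)"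
  have XC: "X s \<omega> \<le> C" if "0 \<le> s" "s < b" for s
    using that below[of s] b(2)[of s] by (cases "s < t"; cases "s = t") (auto simp: C_def)
  have C: "c0 \<le> C" using X_ge[OF w t] by (simp add: C_def)
  have step: "X q \<omega> \<le> I t \<omega> + \<eta> C * (A q \<omega> - A t \<omega>) + M q \<omega> + H q \<omega>" if q: "q \<in> \<rat>" "t < q" "q < b" for q
  proof -
    have q0: "0 \<le> q" using q t by simp
    have Aq: "A t \<omega> \<le> A q \<omega>" using q t by (intro mono_onD[OF a(2)]) auto
    have "(\<lambda>s. (case (\<omega>, s) of (\<omega>, s) \<Rightarrow> integrand \<omega> s * indicator {0<..q} s)) \<in> borel_measurable borel"
      by (rule measurable_Pair2[OF eta_integrand_measurable(1)[of X r c0 \<eta> q]])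
        (use X_adapted X_right_continuous X_left_limits X_ge eta_continuous q0 w in \<open>auto simp: space_F\<close>)
    then have m: "(\<lambda>s. integrand \<omega> s * indicator {0<..q} s) \<in> borel_measurable borel" by simp
    let ?\<mu> = "interval_measure (\<lambda>r. A (max 0 r) \<omega>)"
    have "?S q \<le> (\<integral>\<^sup>+s. integrand \<omega> s * indicator {0<..q} s * indicator {0<..t} s + ennreal (\<eta> C) * indicator {t<..q} s \<partial>?\<mu>)"
      unfolding stieltjes_def
    proof (rule nn_integral_mono)
      fix s
      show "integrand \<omega> s * indicator {0<..q} s
          \<le> integrand \<omega> s * indicator {0<..q} s * indicator {0<..t} s + ennreal (\<eta> C) * indicator {t<..q} s"
      proof (cases "t < s \<and> s \<le> q")
        case True
        then have "integrand \<omega> s \<le> ennreal (\<eta> C)" using t q by (intro integrand_le[OF w] XC) auto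
        then show ?thesis using True t by (simp add: indicator_def)
      qed (auto simp: indicator_def)
    qed
    also have "\<dots> = (\<integral>\<^sup>+s. integrand \<omega> s * indicator {0<..q} s * indicator {0<..t} s \<partial>?\<mu>)
        + (\<integral>\<^sup>+s. ennreal (\<eta> C) * indicator {t<..q} s \<partial>?\<mu>)"
    proof (rule nn_integral_add)
      have "(\<lambda>s. integrand \<omega> s * indicator {0<..q} s) \<in> borel_measurable ?\<mu>"
        using m by (simp only: measurable_cong_sets[OF sets_interval_measure refl])
      then show "(\<lambda>s. integrand \<omega> s * indicator {0<..q} s * indicator {0<..t} s) \<in> borel_measurable ?\<mu>"
        by (rule borel_measurable_times_ennreal) simp
    qed simp
    also have "(\<integral>\<^sup>+s. integrand \<omega> s * indicator {0<..q} s * indicator {0<..t} s \<partial>?\<mu>) = ?S t"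
      unfolding stieltjes_def using q by (intro nn_integral_cong) (auto simp: indicator_def)
    also have "(\<integral>\<^sup>+s. ennreal (\<eta> C) * indicator {t<..q} s \<partial>?\<mu>) = ennreal (\<eta> C) * ennreal (A q \<omega> - A t \<omega>)"
      using emeasure_stieltjes_Ioc[OF a t, of q] q by (simp add: nn_integral_cmult)
    also have "?S t + ennreal (\<eta> C) * ennreal (A q \<omega> - A t \<omega>) = ennreal (I t \<omega> + \<eta> C * (A q \<omega> - A t \<omega>))"
      unfolding St_real using I_nonneg eta_nonneg[OF C] Aq by (simp add: ennreal_mult ennreal_plus)
    finally have "enn2ereal (?S q) \<le> enn2ereal (ennreal (I t \<omega> + \<eta> C * (A q \<omega> - A t \<omega>)))"
      by (simp only: less_eq_ennreal.rep_eq)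
    also have "\<dots> = ereal (I t \<omega> + \<eta> C * (A q \<omega> - A t \<omega>))"
      using I_nonneg[of t \<omega>] eta_nonneg[OF C] Aq by (intro enn2ereal_ennreal add_nonneg_nonneg mult_nonneg_nonneg) auto
    finally have "ereal (X q \<omega>) \<le> ereal (I t \<omega> + \<eta> C * (A q \<omega> - A t \<omega>)) + ereal (M q \<omega> + H q \<omega>)"
      using ineq[OF q(1) q0] add_right_mono order_trans by blast
    then show ?thesis by simp
  qed
  obtain q where q: "\<And>n. q n \<in> \<rat>" "\<And>n. t < q n" "\<And>n. q n < b" and qlim: "q \<longlonglongrightarrow> t"
    by (rule rationals_decreasing_to[OF b(1)]) auto
  have rc: "(\<lambda>n. f (q n)) \<longlonglongrightarrow> f t" if "right_continuous_path f" for f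
    by (rule right_continuous_path_LIMSEQ[OF that t qlim]) (use q(2) in \<open>auto intro: less_imp_le\<close>)
  have "(\<lambda>n. I t \<omega> + \<eta> C * (A (q n) \<omega> - A t \<omega>) + M (q n) \<omega> + H (q n) \<omega>) \<longlonglongrightarrow> I t \<omega> + \<eta> C * (A t \<omega> - A t \<omega>) + M t \<omega> + H t \<omega>"
    by (intro tendsto_add tendsto_mult tendsto_diff tendsto_const rc[of "\<lambda>t. A t \<omega>"] rc[of "\<lambda>t. M t \<omega>"] rc[of "\<lambda>t. H t \<omega>"])
      (use a(1) M_path[OF w] H_path[OF w] in \<open>auto simp: cadlag_def\<close>)
  then have "X t \<omega> \<le> I t \<omega> + \<eta> C * (A t \<omega> - A t \<omega>) + M t \<omega> + H t \<omega>"
  proof (rule LIMSEQ_le[OF rc[OF X_right_continuous[OF w]]])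
    have "X (q n) \<omega> \<le> I t \<omega> + \<eta> C * (A (q n) \<omega> - A t \<omega>) + M (q n) \<omega> + H (q n) \<omega>" for n
      by (intro step q)
    then show "\<exists>N. \<forall>n\<ge>N. X (q n) \<omega> \<le> I t \<omega> + \<eta> C * (A (q n) \<omega> - A t \<omega>) + M (q n) \<omega> + H (q n) \<omega>" by blast
  qed
  then show ?thesis by simp
qed

lemma integral_inequality_below:
  "AE \<omega> in P. \<forall>t\<ge>0. (\<forall>s\<in>{0..<t}. X s \<omega> \<le> u) \<longrightarrow> X t \<omega> \<le> I t \<omega> + M t \<omega> + H t \<omega>"
proof -
  have "AE \<omega> in P. \<forall>q\<in>\<rat> \<inter> {0..}. ereal (X q \<omega>)
      \<le> enn2ereal (stieltjes (\<lambda>s. A s \<omega>) (integrand \<omega>) q) + ereal (M q \<omega> + H q \<omega>)"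
    using integral_inequality by (intro AE_ball_countable') (auto simp: countable_rat)
  then show ?thesis
    using AE_space
  proof eventually_elim
    case (elim \<omega>)
    then show ?case by (auto intro!: integral_inequality_path)
  qed
qed

abbreviation "\<sigma> \<equiv> exit_X X u"

lemma exit_stop: "stop_time F \<sigma>"
  by (rule exit_X_stop[OF X_adapted X_right_continuous])

lemma below_before_exit: "0 \<le> s \<Longrightarrow> ennreal s < \<sigma> \<omega> \<Longrightarrow> X s \<omega> \<le> u"
proof (rule ccontr)
  assume s: "0 \<le> s" "ennreal s < \<sigma> \<omega>" and "\<not> X s \<omega> \<le> u"
  then have "\<sigma> \<omega> \<le> ennreal s" unfolding exit_X_def by (intro INF_lower) auto
  then show False using s by simp
qed

lemma below_before_tmin_exit: "0 \<le> t \<Longrightarrow> 0 \<le> s \<Longrightarrow> s < tmin t (\<sigma> \<omega>) \<Longrightarrow> X s \<omega> \<le> u"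
proof (rule below_before_exit)
  assume t: "0 \<le> t" "0 \<le> s" "s < tmin t (\<sigma> \<omega>)"
  then have "ennreal s < ennreal (tmin t (\<sigma> \<omega>))" by (simp add: ennreal_less_iff)
  also have "\<dots> \<le> \<sigma> \<omega>" using t by (simp add: ennreal_tmin)
  finally show "ennreal s < \<sigma> \<omega>" .
qed

text \<open>
  At the exit time \<open>X\<close> need not exceed \<open>u\<close>, but by right-continuity it is at least \<open>u\<close>.
\<close>

lemma X_at_exit:
  assumes w: "\<omega> \<in> space P" and t: "0 \<le> t" and sup: "ereal u < sup_upto (\<lambda>s. X s \<omega>) t"
  shows "u \<le> X (tmin t (\<sigma> \<omega>)) \<omega>"
proof -
  obtain s where s: "0 \<le> s" "s \<le> t" "u < X s \<omega>" using sup by (auto simp: sup_upto_def less_SUP_iff)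
  then have "\<sigma> \<omega> \<le> ennreal s" unfolding exit_X_def by (intro INF_lower) auto
  then obtain \<rho> where \<rho>: "0 \<le> \<rho>" "\<sigma> \<omega> = ennreal \<rho>" "\<rho> \<le> s" using s(1) by (cases "\<sigma> \<omega>") (auto simp: top_unique)
  then have eq: "tmin t (\<sigma> \<omega>) = \<rho>" using t s(2) by (simp add: tmin_real min_absorb2)
  show ?thesis
  proof (rule ccontr)
    assume "\<not> u \<le> X (tmin t (\<sigma> \<omega>)) \<omega>"
    then have lt: "X \<rho> \<omega> < u" by (simp add: eq)
    have "((\<lambda>s. X s \<omega>) \<longlongrightarrow> X \<rho> \<omega>) (at_right \<rho>)"
      using X_right_continuous[OF w] \<rho>(1) by (simp add: right_continuous_path_def continuous_within)
    then have "\<forall>\<^sub>F s in at_right \<rho>. X s \<omega> < u" using lt by (rule order_tendstoD)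
    then obtain b where b: "\<rho> < b" "\<And>s. \<rho> < s \<Longrightarrow> s < b \<Longrightarrow> X s \<omega> < u" by (auto simp: eventually_at_right_field)
    then have "\<sigma> \<omega> < ennreal b" using \<rho> by (simp add: ennreal_less_iff)
    then obtain q where q: "0 \<le> q" "u < X q \<omega>" "ennreal q < ennreal b" by (auto simp: exit_X_def INF_less_iff)
    have "\<sigma> \<omega> \<le> ennreal q" unfolding exit_X_def using q by (intro INF_lower) auto
    then have "\<rho> \<le> q" using \<rho> q(1) by simp
    moreover have "q < b" using q by (simp add: ennreal_less_iff)
    ultimately show False using b(2)[of q] lt q(2) by (cases "q = \<rho>") auto
  qed
qed

lemma indicator_le_X_exit:
  assumes "\<omega> \<in> space P" "0 \<le> t"
  shows "of_bool (sup_upto (\<lambda>s. X s \<omega>) t > ereal u) * u \<le> min (X (tmin t (\<sigma> \<omega>)) \<omega>) u"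
  using X_at_exit[OF assms] X_ge[OF assms(1), of "tmin t (\<sigma> \<omega>)"] c0_nonneg u_pos by (auto simp: of_bool_def)

lemma L_estimateI:
  assumes "AE \<omega> in P. \<forall>t\<in>{0..T}. min (X (tmin t (\<sigma> \<omega>)) \<omega>) u \<le> I t \<omega> + ML t \<omega> + HL t \<omega>"
  shows "L_estimate P T u X I ML HL"
  unfolding L_estimate_def
proof (intro ballI)
  fix t assume t: "t \<in> {0..T}"
  from assms AE_space show "AE \<omega> in P.
        of_bool (sup_upto (\<lambda>s. X s \<omega>) t > ereal u) * u \<le> min (X (tmin t (\<sigma> \<omega>)) \<omega>) u \<and>
        min (X (tmin t (\<sigma> \<omega>)) \<omega>) u \<le> I t \<omega> + ML t \<omega> + HL t \<omega>"
  proof eventually_elim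
    case (elim \<omega>)
    then show ?case using t indicator_le_X_exit[of \<omega> t] by auto
  qed
qed

end

section \<open>Local martingales stopped at or before a time\<close>

lemma cadlag_cong:
  assumes "\<And>t. 0 \<le> t \<Longrightarrow> f t = g t" and "cadlag f"
  shows "cadlag g"
proof -
  have "(g \<longlongrightarrow> g t) (at_right t)" if t: "0 \<le> t" for t
  proof -
    have "(f \<longlongrightarrow> f t) (at_right t)" using assms(2) t by (simp add: cadlag_def right_continuous_path_def continuous_within)
    moreover have "\<forall>\<^sub>F s in at_right t. f s = g s"
      using eventually_at_right_less[of t] by eventually_elim (use t assms(1) in auto)
    ultimately show ?thesis using assms(1)[OF t] by (metis Lim_transform_eventually)
  qed
  moreover have "\<exists>l. (g \<longlongrightarrow> l) (at_left t)" if t: "0 < t" for t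
  proof -
    obtain l where "(f \<longlongrightarrow> l) (at_left t)" using assms(2) t by (auto simp: cadlag_def has_left_limits_def)
    moreover have "\<forall>\<^sub>F s in at_left t. f s = g s"
      using eventually_at_left_real[OF t] by eventually_elim (use assms(1) in auto)
    ultimately have "(g \<longlongrightarrow> l) (at_left t)" by (rule Lim_transform_eventually)
    then show ?thesis ..
  qed
  ultimately show ?thesis by (simp add: cadlag_def right_continuous_path_def continuous_within has_left_limits_def)
qed

lemma cadlag_combine:
  assumes "cadlag f" "cadlag g"
  shows "cadlag (\<lambda>t. f t + g t * c)"
proof -
  have "\<exists>l. ((\<lambda>t. f t + g t * c) \<longlongrightarrow> l) (at_left t)" if t: "0 < t" for t
  proof -
    obtain k where "(f \<longlongrightarrow> k) (at_left t)" using assms(1) t by (auto simp: cadlag_def has_left_limits_def)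
    moreover obtain l where "(g \<longlongrightarrow> l) (at_left t)" using assms(2) t by (auto simp: cadlag_def has_left_limits_def)
    ultimately have "((\<lambda>t. f t + g t * c) \<longlongrightarrow> k + l * c) (at_left t)" by (intro tendsto_intros)
    then show ?thesis ..
  qed
  moreover have "((\<lambda>t. f t + g t * c) \<longlongrightarrow> f t + g t * c) (at_right t)" if t: "0 \<le> t" for t
    using assms t by (intro tendsto_intros) (simp_all add: cadlag_def right_continuous_path_def continuous_within)
  ultimately show ?thesis by (simp add: cadlag_def right_continuous_path_def continuous_within has_left_limits_def)
qed

lemma cadlag_const: "cadlag (\<lambda>t. c)"
  by (auto simp: cadlag_def right_continuous_path_def has_left_limits_def intro: tendsto_const)

lemma cadlag_jump_removed:
  assumes "cadlag f" "0 < \<rho>"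
  shows "cadlag (\<lambda>t. if t < \<rho> then f t else c)"
proof -
  let ?g = "\<lambda>t. if t < \<rho> then f t else c"
  have "(?g \<longlongrightarrow> ?g t) (at_right t)" if t: "0 \<le> t" for t
  proof (cases "t < \<rho>")
    case True
    have "(f \<longlongrightarrow> f t) (at_right t)" using assms(1) t by (simp add: cadlag_def right_continuous_path_def continuous_within)
    moreover have "\<forall>\<^sub>F s in at_right t. f s = ?g s"
      using eventually_at_right_real[OF True] by eventually_elim auto
    ultimately have "(?g \<longlongrightarrow> f t) (at_right t)" by (rule Lim_transform_eventually)
    then show ?thesis using True by simp
  next
    case False
    have "\<forall>\<^sub>F s in at_right t. ?g s = ?g t"
      using eventually_at_right_less[of t] by eventually_elim (use False in auto)
    then show ?thesis by (rule tendsto_eventually)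
  qed
  moreover have "\<exists>l. (?g \<longlongrightarrow> l) (at_left t)" if t: "0 < t" for t
  proof (cases "t \<le> \<rho>")
    case True
    obtain l where "(f \<longlongrightarrow> l) (at_left t)" using assms(1) t by (auto simp: cadlag_def has_left_limits_def)
    moreover have "\<forall>\<^sub>F s in at_left t. f s = ?g s"
      using eventually_at_left_real[OF t] by eventually_elim (use True in auto)
    ultimately have "(?g \<longlongrightarrow> l) (at_left t)" by (rule Lim_transform_eventually)
    then show ?thesis ..
  next
    case False
    then have "\<rho> < t" by simp
    then have "\<forall>\<^sub>F s in at_left t. ?g s = c"
      using eventually_at_left_real[of \<rho> t] by (auto elim!: eventually_mono)
    then show ?thesis by (intro exI tendsto_eventually)
  qed
  ultimately show ?thesis by (simp add: cadlag_def right_continuous_path_def continuous_within has_left_limits_def)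
qed

lemma stopped_commute:
  "0 \<le> t \<Longrightarrow> f (tmin (tmin t a) b) = f (tmin (tmin t b) a)"
  by (simp add: tmin_tmin min.commute)

context usual_filtered_prob_space
begin

lemma local_martingaleI:
  assumes "adapted F N" "\<And>\<omega>. \<omega> \<in> space P \<Longrightarrow> cadlag (\<lambda>t. N t \<omega>)" "AE \<omega> in P. N 0 \<omega> = 0"
    and "\<And>n. stop_time F (S n)" "AE \<omega> in P. incseq (\<lambda>n. S n \<omega>) \<and> (\<lambda>n. S n \<omega>) \<longlonglongrightarrow> \<infinity>"
    and "\<And>n. martingale P F (\<lambda>t \<omega>. N (tmin t (S n \<omega>)) \<omega> - N 0 \<omega>)"
  shows "cadlag_local_martingale_from_0 P F N"
  unfolding cadlag_local_martingale_from_0_def local_martingale_def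
  by (intro conjI ballI exI[of _ S] allI assms)

lemma local_martingaleE:
  assumes "cadlag_local_martingale_from_0 P F N"
  obtains S :: "nat \<Rightarrow> 'a \<Rightarrow> ennreal" where "\<forall>n. stop_time F (S n)"
    "AE \<omega> in P. incseq (\<lambda>n. S n \<omega>) \<and> (\<lambda>n. S n \<omega>) \<longlonglongrightarrow> \<infinity>"
    "\<forall>n. martingale P F (\<lambda>t \<omega>. N (tmin t (S n \<omega>)) \<omega> - N 0 \<omega>)"
    "adapted F N" "\<forall>\<omega>\<in>space P. cadlag (\<lambda>t. N t \<omega>)" "AE \<omega> in P. N 0 \<omega> = 0"
  using assms unfolding cadlag_local_martingale_from_0_def local_martingale_def
  by (elim exE conjE) (rule that)

lemma right_continuous_localized:
  assumes "cadlag f"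
  shows "right_continuous_path (\<lambda>t. f (tmin t a) - c)"
  using cadlag_combine[OF stopped_cadlag[OF assms, of a] cadlag_const[of 1], of "- c"] by (simp add: cadlag_def)

lemma stopped_local_martingale:
  assumes N: "cadlag_local_martingale_from_0 P F N" and \<rho>: "stop_time F \<rho>"
  shows "cadlag_local_martingale_from_0 P F (\<lambda>t \<omega>. N (tmin t (\<rho> \<omega>)) \<omega>)"
proof -
  obtain S :: "nat \<Rightarrow> 'a \<Rightarrow> ennreal" where S: "\<forall>n. stop_time F (S n)"
    "AE \<omega> in P. incseq (\<lambda>n. S n \<omega>) \<and> (\<lambda>n. S n \<omega>) \<longlonglongrightarrow> \<infinity>"
    "\<forall>n. martingale P F (\<lambda>t \<omega>. N (tmin t (S n \<omega>)) \<omega> - N 0 \<omega>)"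
    "adapted F N" "\<forall>\<omega>\<in>space P. cadlag (\<lambda>t. N t \<omega>)" "AE \<omega> in P. N 0 \<omega> = 0"
    using N by (rule local_martingaleE)
  show ?thesis
  proof (rule local_martingaleI[where S=S])
    show "adapted F (\<lambda>t \<omega>. N (tmin t (\<rho> \<omega>)) \<omega>)"
      by (rule adapted_stopped[OF S(4) _ \<rho>]) (use S(5) in \<open>auto simp: cadlag_def\<close>)
    show "cadlag (\<lambda>t. N (tmin t (\<rho> \<omega>)) \<omega>)" if "\<omega> \<in> space P" for \<omega>
      using stopped_cadlag[OF S(5)[rule_format, OF that]] .
    fix n
    define Y where "Y t \<omega> = N (tmin t (S n \<omega>)) \<omega> - N 0 \<omega>" for t \<omega>
    have Y: "martingale P F Y" unfolding Y_def[abs_def] using S(3) by blast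
    have Yrc: "right_continuous_path (\<lambda>t. Y t \<omega>)" if "\<omega> \<in> space P" for \<omega>
      unfolding Y_def using right_continuous_localized[of "\<lambda>t. N t \<omega>"] S(5) that by blast
    show "martingale P F (\<lambda>t \<omega>. N (tmin (tmin t (S n \<omega>)) (\<rho> \<omega>)) \<omega> - N (tmin 0 (\<rho> \<omega>)) \<omega>)"
    proof (rule martingale_AE_cong[OF stopped_martingale[OF Y Yrc \<rho>]])
      show "AE \<omega> in P. Y (tmin t (\<rho> \<omega>)) \<omega> = N (tmin (tmin t (S n \<omega>)) (\<rho> \<omega>)) \<omega> - N (tmin 0 (\<rho> \<omega>)) \<omega>"
        if "0 \<le> t" for t
        using stopped_commute[OF that, of "\<lambda>t. N t _"] by (intro AE_I2) (simp only: Y_def tmin_zero)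
    qed
  qed (use S in auto)
qed

lemma martingale_stopped_const:
  assumes Y: "martingale P F Y" and T: "0 \<le> T"
  shows "martingale P F (\<lambda>t. Y (min t T))"
proof (rule martingaleI)
  show "adapted F (\<lambda>t. Y (min t T))"
    unfolding adapted_def
  proof (intro allI impI)
    fix t :: real assume "0 \<le> t"
    then show "Y (min t T) \<in> borel_measurable (F t)"
      using Y T by (intro measurable_F_mono[of "min t T" t]) (auto simp: martingale_def adapted_def)
  qed
  show "integrable P (Y (min t T))" if "0 \<le> t" for t using Y T that by (auto simp: martingale_def)
  fix s t A assume s: "0 \<le> s" "s \<le> t" and A: "A \<in> sets (F s)"
  show "integral_on P A (Y (min t T)) = integral_on P A (Y (min s T))"
  proof (cases "s \<le> T")
    case True
    then show ?thesis using martingale_int[OF Y s(1) _ A, of "min t T"] s by (simp add: min_absorb1)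
  next
    case False
    then show ?thesis using s by (simp add: min_absorb2)
  qed
qed

text \<open>
  Stopping along the announcing sequence removes the jump at \<open>\<tau>\<close>: if \<open>\<tau>\<close> occurs by time \<open>t \<and> \<rho>\<close>, the
  values approach the left limit at \<open>\<tau>\<close>, and otherwise \<open>\<tau>\<^sub>n\<close> eventually has no influence.
\<close>

lemma announced_stop_limit:
  fixes \<rho> :: "'a \<Rightarrow> ennreal"
  assumes ann: "announcing_sequence F \<tau> \<tau>s" and w: "\<omega> \<in> space P" and c: "cadlag f" and t: "0 \<le> t"
  defines "v \<equiv> tmin t (\<rho> \<omega>)"
  shows "(\<lambda>n. f (tmin t (min (\<tau>s n \<omega>) (\<rho> \<omega>)))) \<longlonglongrightarrow>
    (if ennreal v < \<tau> \<omega> then f v else if \<tau> \<omega> = 0 then f 0 else left_lim f (enn2real (\<tau> \<omega>)))"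
proof -
  have A: "(\<lambda>n. \<tau>s n \<omega>) \<longlonglongrightarrow> \<tau> \<omega>" "\<And>n. 0 < \<tau> \<omega> \<Longrightarrow> \<tau>s n \<omega> < \<tau> \<omega>" "\<And>n. \<tau> \<omega> = 0 \<Longrightarrow> \<tau>s n \<omega> = 0"
    using ann w by (auto simp: announcing_sequence_def space_F)
  have eq: "tmin t (min (\<tau>s n \<omega>) (\<rho> \<omega>)) = tmin v (\<tau>s n \<omega>)" for n
    using tmin_tmin[OF t, of "\<rho> \<omega>" "\<tau>s n \<omega>"] by (simp add: v_def min.commute)
  have v: "0 \<le> v" by (simp add: v_def)
  consider "ennreal v < \<tau> \<omega>" | "\<tau> \<omega> = 0" | "\<not> ennreal v < \<tau> \<omega>" "\<tau> \<omega> \<noteq> 0" by blast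
  then show ?thesis
  proof cases
    case 1
    have "\<forall>\<^sub>F n in sequentially. ennreal v < \<tau>s n \<omega>" using A(1) 1 by (rule order_tendstoD)
    then have "\<forall>\<^sub>F n in sequentially. f (tmin v (\<tau>s n \<omega>)) = f v"
      by eventually_elim (simp add: tmin_eq v less_imp_le)
    then show ?thesis unfolding eq using 1 by (simp add: tendsto_eventually)
  next
    case 2
    then have "tmin v (\<tau>s n \<omega>) = 0" for n using A(3) by (simp add: tmin_def)
    then show ?thesis unfolding eq using 2 by simp
  next
    case 3
    then have pos: "0 < \<tau> \<omega>" by (simp add: zero_less_iff_neq_zero)
    have fin: "\<tau> \<omega> \<noteq> \<top>" using 3 by (auto simp: not_less top_unique)
    define q where "q n = enn2real (\<tau>s n \<omega>)" for n
    have le: "\<tau>s n \<omega> \<le> ennreal v" for n using A(2)[OF pos, of n] 3 by (auto simp: not_less)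
    have tq: "tmin v (\<tau>s n \<omega>) = q n" for n using le[of n] by (simp add: tmin_def q_def min_absorb2)
    have lt: "q n < enn2real (\<tau> \<omega>)" for n
    proof -
      have "\<tau>s n \<omega> < \<top>" using A(2)[OF pos, of n] by (rule less_le_trans) simp
      then have "ennreal (q n) < ennreal (enn2real (\<tau> \<omega>))" using A(2)[OF pos, of n] fin by (simp add: q_def less_top)
      then show ?thesis by (simp add: ennreal_less_iff q_def)
    qed
    have "q \<longlonglongrightarrow> enn2real (\<tau> \<omega>)" unfolding q_def[abs_def] using A(1) fin by (intro tendsto_enn2real) (simp_all add: less_top)
    then have "filterlim q (at_left (enn2real (\<tau> \<omega>))) sequentially"
      unfolding filterlim_at using lt by (auto intro!: always_eventually simp: less_imp_neq)
    moreover have "(f \<longlongrightarrow> left_lim f (enn2real (\<tau> \<omega>))) (at_left (enn2real (\<tau> \<omega>)))"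
      using c pos fin by (intro left_lim_tendsto) (auto simp: cadlag_def enn2real_positive_iff less_top)
    ultimately have "(\<lambda>n. f (q n)) \<longlonglongrightarrow> left_lim f (enn2real (\<tau> \<omega>))" by (rule filterlim_compose[rotated])
    then show ?thesis unfolding eq tq using 3 by simp
  qed
qed

lemma announced_stop_cadlag:
  fixes x y :: ennreal
  assumes c: "cadlag f"
  shows "cadlag (\<lambda>t. if ennreal (tmin t (y)) < x then f (tmin t (y))
      else if x = 0 then f 0 else left_lim f (enn2real (x)))" (is "cadlag ?g")
proof -
  have "\<exists>s. 0 < s \<and> x = ennreal s \<and> x \<le> y" if x: "x \<noteq> 0" "\<not> y < x" "x \<noteq> \<top>"
  proof -
    obtain s where s: "0 \<le> s" "x = ennreal s" using x(3) by (cases x) auto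
    moreover have "s \<noteq> 0" using x(1) s(2) by auto
    moreover have "x \<le> y" using x(2) by simp
    ultimately show ?thesis by (intro exI[of _ s]) simp
  qed
  then consider "x = 0" | "y < x" | "x = \<top>" | s where "0 < s" "x = ennreal s" "x \<le> y"
    by blast
  then show ?thesis
  proof cases
    case 1
    then show ?thesis by (simp add: cadlag_const)
  next
    case 2
    have "ennreal (tmin t (y)) < x" if "0 \<le> t" for t using that 2 by (simp add: ennreal_tmin min_less_iff_disj)
    then show ?thesis by (intro cadlag_cong[OF _ stopped_cadlag[OF c, of "y"]]) simp
  next
    case 3
    then show ?thesis by (intro cadlag_cong[OF _ stopped_cadlag[OF c, of "y"]]) simp
  next
    case (4 s)
    show ?thesis
    proof (rule cadlag_cong[OF _ cadlag_jump_removed[OF c 4(1), of "left_lim f s"]])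
      fix t :: real assume t: "0 \<le> t"
      show "(if t < s then f t else left_lim f s) = ?g t"
      proof (cases "t < s")
        case True
        then have "ennreal t < x" using 4 t by (simp add: ennreal_less_iff)
        moreover from this have "tmin t (y) = t" using 4(3) t by (auto simp: tmin_eq)
        ultimately show ?thesis using True by simp
      next
        case False
        then have "x \<le> min (ennreal t) (y)" using 4 t by (auto simp: ennreal_leI)
        then have "\<not> ennreal (tmin t (y)) < x" using t by (simp add: ennreal_tmin not_less)
        then show ?thesis using False 4 by simp
      qed
    qed
  qed
qed

text \<open>
  A localising sequence of \<open>N\<close> still works after removing the jump at \<open>\<tau>\<close>: for a martingale, the values at
  the stopping times \<open>\<tau>\<^sub>n \<and> \<rho> \<and> t\<close> have uniformly small excess, so the martingale property passes to the
  limit.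
\<close>

lemma announced_stop_local_martingale:
  assumes N: "cadlag_local_martingale_from_0 P F N" and ann: "announcing_sequence F \<tau> \<tau>s" and \<rho>: "stop_time F \<rho>"
  defines "L \<equiv> \<lambda>t \<omega>. lim (\<lambda>n. N (tmin t (min (\<tau>s n \<omega>) (\<rho> \<omega>))) \<omega>)"
  shows "cadlag_local_martingale_from_0 P F L"
proof -
  obtain S :: "nat \<Rightarrow> 'a \<Rightarrow> ennreal" where S: "\<forall>n. stop_time F (S n)"
    "AE \<omega> in P. incseq (\<lambda>n. S n \<omega>) \<and> (\<lambda>n. S n \<omega>) \<longlonglongrightarrow> \<infinity>"
    "\<forall>n. martingale P F (\<lambda>t \<omega>. N (tmin t (S n \<omega>)) \<omega> - N 0 \<omega>)"
    "adapted F N" "\<forall>\<omega>\<in>space P. cadlag (\<lambda>t. N t \<omega>)" "AE \<omega> in P. N 0 \<omega> = 0"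
    using N by (rule local_martingaleE)
  have stop: "stop_time F (\<lambda>\<omega>. min (\<tau>s n \<omega>) (\<rho> \<omega>))" for n
    using ann by (intro stop_min \<rho>) (simp add: announcing_sequence_def)
  have conv: "(\<lambda>n. N (tmin t (min (\<tau>s n \<omega>) (\<rho> \<omega>))) \<omega>) \<longlonglongrightarrow> (if ennreal (tmin t (\<rho> \<omega>)) < \<tau> \<omega> then N (tmin t (\<rho> \<omega>)) \<omega>
      else if \<tau> \<omega> = 0 then N 0 \<omega> else left_lim (\<lambda>t. N t \<omega>) (enn2real (\<tau> \<omega>)))"
    if "0 \<le> t" "\<omega> \<in> space P" for t \<omega>
    by (rule announced_stop_limit[OF ann that(2) S(5)[rule_format, OF that(2)] that(1)])
  have L_eq: "L t \<omega> = (if ennreal (tmin t (\<rho> \<omega>)) < \<tau> \<omega> then N (tmin t (\<rho> \<omega>)) \<omega>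
      else if \<tau> \<omega> = 0 then N 0 \<omega> else left_lim (\<lambda>t. N t \<omega>) (enn2real (\<tau> \<omega>)))"
    if "0 \<le> t" "\<omega> \<in> space P" for t \<omega>
    unfolding L_def by (rule limI[OF conv[OF that]])
  have lim: "(\<lambda>n. N (tmin t (min (\<tau>s n \<omega>) (\<rho> \<omega>))) \<omega>) \<longlonglongrightarrow> L t \<omega>" if "0 \<le> t" "\<omega> \<in> space P" for t \<omega>
    unfolding L_eq[OF that] by (rule conv[OF that])
  show ?thesis
  proof (rule local_martingaleI[where S=S])
    show "adapted F L"
      unfolding adapted_def
    proof (intro allI impI)
      fix t :: real assume t: "0 \<le> t"
      show "L t \<in> borel_measurable (F t)"
      proof (rule borel_measurable_LIMSEQ_metric)
        show "(\<lambda>\<omega>. N (tmin t (min (\<tau>s n \<omega>) (\<rho> \<omega>))) \<omega>) \<in> borel_measurable (F t)" for n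
          by (rule stopped_measurable[OF S(4) _ stop t]) (use S(5) in \<open>auto simp: cadlag_def\<close>)
      qed (use lim[OF t] in \<open>simp add: space_F\<close>)
    qed
    show "cadlag (\<lambda>t. L t \<omega>)" if w: "\<omega> \<in> space P" for \<omega>
      by (rule cadlag_cong[OF _ announced_stop_cadlag[where f="\<lambda>t. N t \<omega>" and x="\<tau> \<omega>" and y="\<rho> \<omega>"]])
        (use L_eq[OF _ w] S(5) w in simp_all)
    show "AE \<omega> in P. L 0 \<omega> = 0" using S(6) by eventually_elim (simp add: L_def)
    fix k
    define Y where "Y t \<omega> = N (tmin t (S k \<omega>)) \<omega> - N 0 \<omega>" for t \<omega>
    have Y: "martingale P F Y" unfolding Y_def[abs_def] using S(3) by blast
    have Yrc: "right_continuous_path (\<lambda>t. Y t \<omega>)" if "\<omega> \<in> space P" for \<omega>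
      unfolding Y_def using right_continuous_localized[of "\<lambda>t. N t \<omega>"] S(5) that by blast
    show "martingale P F (\<lambda>t \<omega>. L (tmin t (S k \<omega>)) \<omega> - L 0 \<omega>)"
    proof (rule martingale_limit)
      show "martingale P F (\<lambda>t \<omega>. Y (tmin t (min (\<tau>s n \<omega>) (\<rho> \<omega>))) \<omega>)" for n
        by (rule stopped_martingale[OF Y Yrc stop])
    next
      fix t \<omega> assume t: "(0::real) \<le> t" and w: "\<omega> \<in> space P"
      have "(\<lambda>n. N (tmin (tmin t (S k \<omega>)) (min (\<tau>s n \<omega>) (\<rho> \<omega>))) \<omega> - N 0 \<omega>) \<longlonglongrightarrow> L (tmin t (S k \<omega>)) \<omega> - N 0 \<omega>"
        by (intro tendsto_diff tendsto_const lim w) simp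
      moreover have "L 0 \<omega> = N 0 \<omega>" by (simp add: L_def)
      ultimately show "(\<lambda>n. Y (tmin t (min (\<tau>s n \<omega>) (\<rho> \<omega>))) \<omega>) \<longlonglongrightarrow> L (tmin t (S k \<omega>)) \<omega> - L 0 \<omega>"
        unfolding Y_def using stopped_commute[OF t, of "\<lambda>t. N t \<omega>"] by simp
    next
      fix t \<epsilon> :: real assume t: "0 \<le> t" and \<epsilon>: "0 < \<epsilon>"
      have "integrable P (Y t)" using Y t by (simp add: martingale_def)
      from excess_tendsto_zero[OF this \<epsilon>] obtain c where c: "0 \<le> c" "excess P c (Y t) \<le> \<epsilon>" by blast
      have "excess P c (\<lambda>\<omega>. Y (tmin t (min (\<tau>s n \<omega>) (\<rho> \<omega>))) \<omega>) \<le> \<epsilon>" for n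
        using stopped_excess[OF Y Yrc stop t c(1)] c(2) by (rule order_trans)
      then show "\<exists>c\<ge>0. \<forall>n. excess P c (\<lambda>\<omega>. Y (tmin t (min (\<tau>s n \<omega>) (\<rho> \<omega>))) \<omega>) \<le> \<epsilon>"
        using c(1) by blast
    qed
  qed (use S in auto)
qed

end

section \<open>The estimate in the three cases\<close>

context gronwall_setting
begin

lemma before_hit_iff: "\<omega> \<in> space P \<Longrightarrow> 0 \<le> v \<Longrightarrow> ennreal v < hit_H H b \<omega> \<longleftrightarrow> H v \<omega> < b"
  using hit_H_le_iff[of H \<omega> v b] H_path[of \<omega>] by (simp flip: not_le)

lemma H_L_ab_nondecreasing: "nondecreasing_process F (H_L_ab H lam u)"
  unfolding nondecreasing_process_def
proof (intro conjI ballI mono_onI)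
  show "adapted F (H_L_ab H lam u)"
    unfolding adapted_def
  proof (intro allI impI)
    fix t :: real assume "0 \<le> t"
    then have [measurable]: "H t \<in> borel_measurable (F t)" using H_adapted by (simp add: adapted_def)
    have "(\<lambda>\<omega>. min (H t \<omega>) (lam * u) + u * (if lam * u \<le> H t \<omega> then 1 else 0)) \<in> borel_measurable (F t)" by measurable
    then show "H_L_ab H lam u t \<in> borel_measurable (F t)"
      unfolding H_L_ab_def[abs_def] of_bool_def by simp
  qed
  fix \<omega> and s t :: real assume "\<omega> \<in> space (F 0)" "s \<in> {0..}" "t \<in> {0..}" "s \<le> t"
  then have "H s \<omega> \<le> H t \<omega>" by (intro H_mono) (auto simp: space_F)
  then show "H_L_ab H lam u s \<omega> \<le> H_L_ab H lam u t \<omega>"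
    using u_pos unfolding H_L_ab_def by (auto simp: of_bool_def intro!: add_mono min.mono)
qed

text \<open>
  The common part of the cases (a) and (b).  Before \<open>H\<close> reaches \<open>lam * u\<close> the integral inequality is
  used directly.  Once it has been reached, the summand \<open>u\<close> of \<open>H\<^sup>L\<close> dominates the left-hand side,
  and the remaining terms are nonnegative because \<open>0 \<le> X \<le> I + M + lam * u\<close> just before.
\<close>

lemma estimate_at_hit:
  assumes w: "\<omega> \<in> space P" and t: "0 \<le> t"
    and ineq: "\<And>t. 0 \<le> t \<Longrightarrow> (\<forall>s\<in>{0..<t}. X s \<omega> \<le> u) \<Longrightarrow> X t \<omega> \<le> I t \<omega> + M t \<omega> + H t \<omega>"
    and M0: "M 0 \<omega> = 0" and lam: "0 < lam"
  defines "v \<equiv> tmin t (\<sigma> \<omega>)" and "\<tau> \<equiv> hit_H H (lam * u) \<omega>"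
  assumes before: "ennreal v < \<tau> \<Longrightarrow> m = M v \<omega>"
    and after: "\<not> ennreal v < \<tau> \<Longrightarrow> (if \<tau> = 0 then M 0 \<omega> else left_lim (\<lambda>t. M t \<omega>) (enn2real \<tau>)) \<le> m"
  shows "min (X v \<omega>) u \<le> I t \<omega> + m + H_L_ab H lam u t \<omega>"
proof -
  have v: "0 \<le> v" "v \<le> t" using tmin_le[OF t] by (simp_all add: v_def)
  have below: "X s \<omega> \<le> u" if "0 \<le> s" "s < v" for s
    using below_before_tmin_exit[OF t that(1)] that(2) by (simp add: v_def)
  have Xle: "X s \<omega> \<le> I t \<omega> + M s \<omega> + H s \<omega>" if s: "0 \<le> s" "s \<le> v" for s
  proof -
    have "X s \<omega> \<le> I s \<omega> + M s \<omega> + H s \<omega>" using below s by (intro ineq) auto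
    moreover have "I s \<omega> \<le> I t \<omega>" using s v by (intro I_mono w) auto
    ultimately show ?thesis by simp
  qed
  have Ht: "H v \<omega> \<le> H t \<omega>" by (rule H_mono[OF w v])
  show ?thesis
  proof (cases "ennreal v < \<tau>")
    case True
    then have "H v \<omega> < lam * u" using before_hit_iff[OF w v(1)] by (simp add: \<tau>_def)
    then have "H v \<omega> \<le> H_L_ab H lam u t \<omega>" using Ht u_pos by (auto simp: H_L_ab_def)
    then show ?thesis using Xle[OF v(1) order_refl] before[OF True] by linarith
  next
    case False
    then have "lam * u \<le> H v \<omega>" using before_hit_iff[OF w v(1), of "lam * u"] by (simp add: \<tau>_def)
    then have HL: "H_L_ab H lam u t \<omega> = lam * u + u" using Ht by (simp add: H_L_ab_def)
    have lu: "0 < lam * u" using lam u_pos by simp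
    have "0 \<le> I t \<omega> + m + lam * u"
    proof (cases "\<tau> = 0")
      case True
      then show ?thesis using after[OF False] M0 I_nonneg[of t \<omega>] lu by simp
    next
      case \<tau>0: False
      obtain \<rho> where \<rho>: "0 < \<rho>" "\<tau> = ennreal \<rho>" "\<rho> \<le> v"
        using False \<tau>0 v(1) by (cases \<tau>) (auto simp: not_less top_unique less_le)
      have "0 \<le> I t \<omega> + M s \<omega> + lam * u" if s: "0 \<le> s" "s < \<rho>" for s
      proof -
        have "ennreal s < \<tau>" using s \<rho> by (simp add: ennreal_less_iff)
        then have "H s \<omega> < lam * u" using before_hit_iff[OF w s(1)] by (simp add: \<tau>_def)
        moreover have "0 \<le> X s \<omega>" using X_ge[OF w s(1)] c0_nonneg by simp
        ultimately show ?thesis using Xle[of s] s \<rho>(3) by simp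
      qed
      then have ev: "\<forall>\<^sub>F s in at_left \<rho>. 0 \<le> I t \<omega> + M s \<omega> + lam * u"
        using eventually_at_left_real[OF \<rho>(1)] by (auto elim!: eventually_mono)
      have "((\<lambda>s. M s \<omega>) \<longlongrightarrow> left_lim (\<lambda>s. M s \<omega>) \<rho>) (at_left \<rho>)"
        using M_path[OF w] \<rho>(1) by (intro left_lim_tendsto) (auto simp: cadlag_def)
      then have "((\<lambda>s. I t \<omega> + M s \<omega> + lam * u) \<longlongrightarrow> I t \<omega> + left_lim (\<lambda>s. M s \<omega>) \<rho> + lam * u) (at_left \<rho>)"
        by (intro tendsto_intros)
      then have "0 \<le> I t \<omega> + left_lim (\<lambda>s. M s \<omega>) \<rho> + lam * u"
        by (rule tendsto_lowerbound[OF _ ev]) simp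
      moreover have "left_lim (\<lambda>s. M s \<omega>) \<rho> \<le> m" using after[OF False] \<tau>0 \<rho> by simp
      ultimately show ?thesis by simp
    qed
    then show ?thesis using HL by simp
  qed
qed

lemma estimate_a:
  assumes lam: "0 < lam" and ann: "announcing_sequence F (hit_H H (lam * u)) \<tau>s"
  shows "L_estimate P T u X I (M_L_a X M u \<tau>s) (H_L_ab H lam u)"
proof (rule L_estimateI)
  show "AE \<omega> in P. \<forall>t\<in>{0..T}. min (X (tmin t (\<sigma> \<omega>)) \<omega>) u \<le> I t \<omega> + M_L_a X M u \<tau>s t \<omega> + H_L_ab H lam u t \<omega>"
    using integral_inequality_below M_zero AE_space
  proof eventually_elim
    case (elim \<omega>)
    show ?case
    proof
      fix t assume "t \<in> {0..T}"
      then have t: "0 \<le> t" by simp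
      have eq: "M_L_a X M u \<tau>s t \<omega> = (if ennreal (tmin t (\<sigma> \<omega>)) < hit_H H (lam * u) \<omega> then M (tmin t (\<sigma> \<omega>)) \<omega>
        else if hit_H H (lam * u) \<omega> = 0 then M 0 \<omega> else left_lim (\<lambda>t. M t \<omega>) (enn2real (hit_H H (lam * u) \<omega>)))"
        unfolding M_L_a_def M_L_a_seq_def
        by (rule limI) (rule announced_stop_limit[OF ann elim(3) M_path[OF elim(3)] t])
      show "min (X (tmin t (\<sigma> \<omega>)) \<omega>) u \<le> I t \<omega> + M_L_a X M u \<tau>s t \<omega> + H_L_ab H lam u t \<omega>"
        by (rule estimate_at_hit[OF elim(3) t _ elim(2) lam]) (use elim(1) eq in auto)
    qed
  qed
qed

lemma estimate_b:
  assumes lam: "0 < lam" and jumps: "no_negative_jumps P M"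
  shows "L_estimate P T u X I (M_L_b X H M lam u) (H_L_ab H lam u)"
proof (rule L_estimateI)
  show "AE \<omega> in P. \<forall>t\<in>{0..T}. min (X (tmin t (\<sigma> \<omega>)) \<omega>) u \<le> I t \<omega> + M_L_b X H M lam u t \<omega> + H_L_ab H lam u t \<omega>"
    using integral_inequality_below M_zero AE_space jumps[unfolded no_negative_jumps_def]
  proof eventually_elim
    case (elim \<omega>)
    show ?case
    proof
      fix t assume "t \<in> {0..T}"
      then have t: "0 \<le> t" by simp
      let ?v = "tmin t (\<sigma> \<omega>)" and ?\<tau> = "hit_H H (lam * u) \<omega>"
      have eq: "M_L_b X H M lam u t \<omega> = M (tmin ?v ?\<tau>) \<omega>"
        using tmin_tmin[OF t, of "\<sigma> \<omega>" ?\<tau>] by (simp add: M_L_b_def min.commute)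
      show "min (X ?v \<omega>) u \<le> I t \<omega> + M_L_b X H M lam u t \<omega> + H_L_ab H lam u t \<omega>"
      proof (rule estimate_at_hit[OF elim(3) t _ elim(2) lam])
        show "X s \<omega> \<le> I s \<omega> + M s \<omega> + H s \<omega>" if "0 \<le> s" "\<forall>r\<in>{0..<s}. X r \<omega> \<le> u" for s
          using elim(1) that by blast
        show "M_L_b X H M lam u t \<omega> = M ?v \<omega>" if "ennreal ?v < ?\<tau>"
          using that unfolding eq by (simp add: tmin_eq less_imp_le)
        assume "\<not> ennreal ?v < ?\<tau>"
        then have le: "?\<tau> \<le> ennreal ?v" by simp
        then have val: "tmin ?v ?\<tau> = enn2real ?\<tau>" by (simp add: tmin_def min_absorb2)
        have fin: "?\<tau> < \<top>" using le by (rule le_less_trans) simp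
        show "(if ?\<tau> = 0 then M 0 \<omega> else left_lim (\<lambda>t. M t \<omega>) (enn2real ?\<tau>)) \<le> M_L_b X H M lam u t \<omega>"
          unfolding eq val using elim(4) fin by (auto simp: enn2real_positive_iff zero_less_iff_neq_zero)
      qed
    qed
  qed
qed

lemma stop_const: "stop_time F (\<lambda>\<omega>. ennreal T)"
  unfolding stop_iff
proof (intro allI impI)
  fix t :: real
  show "{\<omega> \<in> space P. ennreal T \<le> ennreal t} \<in> sets (F t)"
    using sets.top[of "F t"] by (cases "ennreal T \<le> ennreal t") (simp_all add: space_F)
qed

end

locale gronwall_integrable = gronwall_setting P F r c0 \<eta> X A H M u
  for P :: "'a measure" and F :: "real \<Rightarrow> 'a measure" and r c0 \<eta> X A H M u +
  fixes T :: real
  assumes T_pos: "0 < T" and H_int: "integrable P (H T)"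
begin

abbreviation "EH \<equiv> \<lambda>t. real_cond_exp P (F t) (H T)"

lemma EH_measurable: "0 \<le> t \<Longrightarrow> EH 0 \<in> borel_measurable (F t)"
  by (rule measurable_F_mono[of 0]) auto

text \<open>
  \<open>H\<close> is non-decreasing, so \<open>H\<^sub>s\<close> is at most the conditional expectation of \<open>H\<^sub>T\<close>; this is what lets the
  martingale \<open>E[H\<^sub>T | F\<^sub>t]\<close> absorb \<open>H\<close> in case (c).
\<close>

lemma H_le_EH:
  assumes "0 \<le> s" "s \<le> T"
  shows "AE \<omega> in P. H s \<omega> \<le> EH s \<omega>"
proof -
  interpret C: sigma_finite_subalgebra P "F s" by (rule F_sigma_finite_subalgebra)
  have m: "H s \<in> borel_measurable (F s)" using H_adapted assms by (simp add: adapted_def)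
  have int: "integrable P (H s)"
    by (rule Bochner_Integration.integrable_bound[OF H_int measurable_F_P[OF m]])
      (use H_mono[OF _ assms] H_nonneg assms T_pos in \<open>auto intro!: AE_I2\<close>)
  have "AE \<omega> in P. real_cond_exp P (F s) (H s) \<omega> \<le> EH s \<omega>"
    by (rule C.real_cond_exp_mono[OF _ int H_int]) (use H_mono[OF _ assms] in \<open>auto intro!: AE_I2\<close>)
  moreover have "AE \<omega> in P. real_cond_exp P (F s) (H s) \<omega> = H s \<omega>" by (rule C.real_cond_exp_F_meas[OF int m])
  ultimately show ?thesis by eventually_elim simp
qed

lemma version_exists: "\<exists>N. cadlag_version_M_tilde P F H M T N"
proof -
  obtain K where K: "\<forall>\<omega>\<in>space P. cadlag (\<lambda>t. K t \<omega>)" "\<forall>t\<ge>0. AE \<omega> in P. K t \<omega> = EH t \<omega>"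
    using cadlag_conditional_expectations[OF H_int] H_nonneg T_pos by auto
  define N where "N t \<omega> = (M t \<omega> + K t \<omega> * 1) + 1 * (- EH 0 \<omega>)" for t \<omega>
  show ?thesis
    unfolding cadlag_version_M_tilde_def
  proof (intro exI[of _ N] conjI ballI)
    fix \<omega> assume w: "\<omega> \<in> space P"
    have "cadlag (\<lambda>t. N t \<omega>)"
      unfolding N_def using K(1) w by (intro cadlag_combine M_path cadlag_const) auto
    from stopped_cadlag[OF this, of "ennreal T"] show "cadlag (\<lambda>t. N (min t T) \<omega>)"
      by (rule cadlag_cong[rotated]) (use T_pos in \<open>simp add: tmin_real\<close>)
  next
    fix t assume "t \<in> {0..T}"
    then have "AE \<omega> in P. K t \<omega> = EH t \<omega>" using K(2) by simp
    then show "AE \<omega> in P. N t \<omega> = M t \<omega> + EH t \<omega> - EH 0 \<omega>" by eventually_elim (simp add: N_def)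
  qed
qed

context
  fixes N assumes N: "cadlag_version_M_tilde P F H M T N"
begin

lemma N_path: "\<omega> \<in> space P \<Longrightarrow> cadlag (\<lambda>t. N (min t T) \<omega>)"
  and N_AE: "0 \<le> t \<Longrightarrow> t \<le> T \<Longrightarrow> AE \<omega> in P. N t \<omega> = M t \<omega> + EH t \<omega> - EH 0 \<omega>"
  using N by (auto simp: cadlag_version_M_tilde_def)

lemma M_stopped_const_path: "\<omega> \<in> space P \<Longrightarrow> cadlag (\<lambda>t. M (min t T) \<omega>)"
  using stopped_cadlag[OF M_path, of \<omega> "ennreal T"]
  by (rule cadlag_cong[rotated]) (use T_pos in \<open>simp_all add: tmin_real\<close>)

text \<open>
  On \<open>[0, T]\<close> this is \<open>N - M + E[H\<^sub>T | F\<^sub>0]\<close>, a cadlag version of \<open>E[H\<^sub>T | F\<^sub>t]\<close>; it stays constant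
  after \<open>T\<close>.  The factors \<open>- 1\<close> and \<open>1\<close> put it into the shape of \<open>cadlag_combine\<close>.
\<close>

definition "K t \<omega> = (N (min t T) \<omega> + M (min t T) \<omega> * - 1) + 1 * EH 0 \<omega>"

lemma K_path: "\<omega> \<in> space P \<Longrightarrow> cadlag (\<lambda>t. K t \<omega>)"
  unfolding K_def by (intro cadlag_combine N_path M_stopped_const_path cadlag_const)

lemma K_martingale: "martingale P F K"
proof (rule martingale_AE_cong)
  show "martingale P F (\<lambda>t. EH (min t T))"
    using T_pos by (intro martingale_stopped_const martingale_cond_exp H_int) simp
  fix t :: real assume t: "0 \<le> t"
  have "AE \<omega> in P. N (min t T) \<omega> = M (min t T) \<omega> + EH (min t T) \<omega> - EH 0 \<omega>"
    using t T_pos by (intro N_AE) auto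
  then show "AE \<omega> in P. EH (min t T) \<omega> = K t \<omega>" by eventually_elim (simp add: K_def)
qed

lemma N_zero: "AE \<omega> in P. N 0 \<omega> = 0"
proof -
  have "AE \<omega> in P. N 0 \<omega> = M 0 \<omega> + EH 0 \<omega> - EH 0 \<omega>" using T_pos by (intro N_AE) auto
  then show ?thesis using M_zero by eventually_elim simp
qed

lemma tmin_min_const: "0 \<le> t \<Longrightarrow> tmin (min t T) a = tmin t (min (ennreal T) a)"
  using tmin_tmin[of t "ennreal T" a] T_pos by (simp add: tmin_real)

text \<open>
  \<open>N\<close> is the sum of \<open>M\<close>, of the martingale \<open>K\<close> and of the \<open>F 0\<close>-measurable \<open>- E[H\<^sub>T | F\<^sub>0]\<close>, so a localising
  sequence of \<open>M\<close> localises it, and the restriction to an event in \<open>F 0\<close> does no harm.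
\<close>

lemma M_L_c_local_martingale: "cadlag_local_martingale_from_0 P F (\<lambda>t. M_L_c P F X H T u N (min t T))"
proof -
  let ?G = "\<lambda>\<omega>. EH 0 \<omega> \<le> u" and ?\<rho> = "\<lambda>\<omega>. min (ennreal T) (\<sigma> \<omega>)"
  have [measurable]: "EH 0 \<in> borel_measurable (F 0)" by simp
  have G: "{\<omega>\<in>space P. ?G \<omega>} \<in> sets (F 0)"
  proof -
    have "{\<omega>\<in>space (F 0). ?G \<omega>} \<in> sets (F 0)" by measurable
    then show ?thesis by (simp add: space_F)
  qed
  have \<rho>: "stop_time F ?\<rho>" by (intro stop_min stop_const exit_stop)
  obtain S :: "nat \<Rightarrow> 'a \<Rightarrow> ennreal" where S: "\<forall>n. stop_time F (S n)"
    "AE \<omega> in P. incseq (\<lambda>n. S n \<omega>) \<and> (\<lambda>n. S n \<omega>) \<longlonglongrightarrow> \<infinity>"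
    "\<forall>n. martingale P F (\<lambda>t \<omega>. M (tmin t (S n \<omega>)) \<omega> - M 0 \<omega>)"
    "adapted F M" "\<forall>\<omega>\<in>space P. cadlag (\<lambda>t. M t \<omega>)" "AE \<omega> in P. M 0 \<omega> = 0"
    using M_local_martingale by (rule local_martingaleE)
  have N_adapted: "adapted F (\<lambda>t. N (min t T))"
    unfolding adapted_def
  proof (intro allI impI)
    fix t :: real assume t: "0 \<le> t"
    have "M (min t T) \<in> borel_measurable (F t)"
      using S(4) t T_pos by (intro measurable_F_mono[of "min t T" t]) (auto simp: adapted_def)
    moreover have "K t \<in> borel_measurable (F t)" using K_martingale t by (simp add: martingale_def adapted_def)
    ultimately have "(\<lambda>\<omega>. K t \<omega> + M (min t T) \<omega> - EH 0 \<omega>) \<in> borel_measurable (F t)"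
      using EH_measurable[OF t] by (intro borel_measurable_add borel_measurable_diff)
    then show "N (min t T) \<in> borel_measurable (F t)" by (simp add: K_def)
  qed
  have val: "M_L_c P F X H T u N (min t T) \<omega> = N (min (tmin t (?\<rho> \<omega>)) T) \<omega> * of_bool (?G \<omega>)"
    if t: "0 \<le> t" for t \<omega>
  proof -
    have "tmin (min t T) (\<sigma> \<omega>) \<le> min t T" using t T_pos by (intro tmin_le) simp
    then have "min (tmin t (?\<rho> \<omega>)) T = tmin (min t T) (\<sigma> \<omega>)" using tmin_min_const[OF t, of "\<sigma> \<omega>"] by simp
    then show ?thesis by (simp add: M_L_c_def)
  qed
  show ?thesis
  proof (rule local_martingaleI[where S=S])
    show "adapted F (\<lambda>t. M_L_c P F X H T u N (min t T))"
      unfolding adapted_def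
    proof (intro allI impI)
      fix t :: real assume t: "0 \<le> t"
      have [measurable]: "(\<lambda>\<omega>. N (min (tmin t (?\<rho> \<omega>)) T) \<omega>) \<in> borel_measurable (F t)"
        by (rule stopped_measurable[OF N_adapted _ \<rho> t]) (use N_path in \<open>simp add: cadlag_def\<close>)
      have [measurable]: "EH 0 \<in> borel_measurable (F t)" by (rule EH_measurable[OF t])
      have "(\<lambda>\<omega>. N (min (tmin t (?\<rho> \<omega>)) T) \<omega> * (if ?G \<omega> then 1 else 0)) \<in> borel_measurable (F t)" by measurable
      then show "M_L_c P F X H T u N (min t T) \<in> borel_measurable (F t)"
        by (rule measurable_cong[THEN iffD1, rotated]) (simp add: val[OF t] of_bool_def)
    qed
    show "cadlag (\<lambda>t. M_L_c P F X H T u N (min t T) \<omega>)" if w: "\<omega> \<in> space P" for \<omega>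
    proof (rule cadlag_cong)
      show "cadlag (\<lambda>t. 0 + N (min (tmin t (?\<rho> \<omega>)) T) \<omega> * of_bool (?G \<omega>))"
        using stopped_cadlag[OF N_path[OF w], of "?\<rho> \<omega>"] by (intro cadlag_combine cadlag_const)
    qed (simp add: val)
    show "AE \<omega> in P. M_L_c P F X H T u N (min 0 T) \<omega> = 0"
      using N_zero by eventually_elim (use T_pos in \<open>simp add: M_L_c_def\<close>)
    fix n
    define Y where "Y t \<omega> = M (tmin t (S n \<omega>)) \<omega> - M 0 \<omega>" for t \<omega>
    have Y: "martingale P F Y" unfolding Y_def[abs_def] using S(3) by blast
    have Yrc: "right_continuous_path (\<lambda>t. Y t \<omega>)" if "\<omega> \<in> space P" for \<omega>
      unfolding Y_def using right_continuous_localized[of "\<lambda>t. M t \<omega>"] S(5) that by blast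
    \<comment> \<open>the increment of \<open>N\<close> splits into those of \<open>K\<close> and of the localised \<open>M\<close>\<close>
    have K0: "integrable P (K 0)" "K 0 \<in> borel_measurable (F 0)"
      using K_martingale by (auto simp: martingale_def adapted_def)
    have "martingale P F (\<lambda>t \<omega>. ((K (tmin t (min (S n \<omega>) (?\<rho> \<omega>))) \<omega> - K 0 \<omega>) + Y (tmin t (?\<rho> \<omega>)) \<omega>) * of_bool (?G \<omega>))"
    proof (intro martingale_restrict[OF _ G] martingale_add martingale_diff martingale_const K0)
      show "martingale P F (\<lambda>t \<omega>. K (tmin t (min (S n \<omega>) (?\<rho> \<omega>))) \<omega>)"
        by (rule stopped_martingale[OF K_martingale])
          (use K_path S(1) \<rho> in \<open>auto simp: cadlag_def intro!: stop_min\<close>)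
      show "martingale P F (\<lambda>t \<omega>. Y (tmin t (?\<rho> \<omega>)) \<omega>)" by (rule stopped_martingale[OF Y Yrc \<rho>])
    qed
    then show "martingale P F (\<lambda>t \<omega>. M_L_c P F X H T u N (min (tmin t (S n \<omega>)) T) \<omega> - M_L_c P F X H T u N (min 0 T) \<omega>)"
    proof (rule martingale_AE_cong)
      fix t :: real assume t: "0 \<le> t"
      have "((K (tmin t (min (S n \<omega>) (?\<rho> \<omega>))) \<omega> - K 0 \<omega>) + Y (tmin t (?\<rho> \<omega>)) \<omega>) * of_bool (?G \<omega>)
        = M_L_c P F X H T u N (min (tmin t (S n \<omega>)) T) \<omega> - M_L_c P F X H T u N (min 0 T) \<omega>" for \<omega>
      proof -
        define x where "x = tmin t (min (S n \<omega>) (?\<rho> \<omega>))"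
        have x1: "tmin (tmin t (S n \<omega>)) (?\<rho> \<omega>) = x" using tmin_tmin[OF t, of "S n \<omega>" "?\<rho> \<omega>"] by (simp add: x_def)
        have x2: "tmin (tmin t (?\<rho> \<omega>)) (S n \<omega>) = x"
          using tmin_tmin[OF t, of "?\<rho> \<omega>" "S n \<omega>"] by (simp add: x_def min.commute)
        have "ennreal x = min (ennreal t) (min (S n \<omega>) (?\<rho> \<omega>))" unfolding x_def by (rule ennreal_tmin[OF t])
        then have "ennreal x \<le> ennreal T" by (simp add: min_le_iff_disj)
        then have xT: "x \<le> T" using T_pos by (simp add: ennreal_le_iff)
        show ?thesis
          using val[of "tmin t (S n \<omega>)" \<omega>] val[of 0 \<omega>] xT T_pos unfolding Y_def x2
          by (simp add: x1 K_def left_diff_distrib flip: x_def)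
      qed
      then show "AE \<omega> in P. ((K (tmin t (min (S n \<omega>) (?\<rho> \<omega>))) \<omega> - K 0 \<omega>) + Y (tmin t (?\<rho> \<omega>)) \<omega>) * of_bool (?G \<omega>)
        = M_L_c P F X H T u N (min (tmin t (S n \<omega>)) T) \<omega> - M_L_c P F X H T u N (min 0 T) \<omega>" by simp
    qed
  qed (use S in auto)
qed

text \<open>
  The comparison at each fixed time becomes simultaneous in time by right-continuity; the end point \<open>T\<close>
  has no rational times of \<open>[0, T]\<close> to its right and is treated separately.
\<close>

lemma H_le_N: "AE \<omega> in P. \<forall>t\<in>{0..T}. H t \<omega> \<le> N t \<omega> - M t \<omega> + EH 0 \<omega>"
proof -
  have "AE \<omega> in P. \<forall>q\<in>insert T (\<rat> \<inter> {0..T}). H q \<omega> \<le> N q \<omega> - M q \<omega> + EH 0 \<omega>"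
  proof (rule AE_ball_countable')
    show "countable (insert T (\<rat> \<inter> {0..T}))" by (simp add: countable_rat)
    fix q assume "q \<in> insert T (\<rat> \<inter> {0..T})"
    then have q: "0 \<le> q" "q \<le> T" using T_pos by auto
    show "AE \<omega> in P. H q \<omega> \<le> N q \<omega> - M q \<omega> + EH 0 \<omega>"
      using H_le_EH[OF q] N_AE[OF q] by eventually_elim simp
  qed
  then show ?thesis
    using AE_space
  proof eventually_elim
    case (elim \<omega>)
    show ?case
    proof
      fix t assume t: "t \<in> {0..T}"
      show "H t \<omega> \<le> N t \<omega> - M t \<omega> + EH 0 \<omega>"
      proof (cases "t = T")
        case False
        then have tT: "0 \<le> t" "t < T" using t by auto
        obtain q where q: "\<And>n. q n \<in> \<rat>" "\<And>n. t < q n" and qT: "\<And>n. q n < T" and qlim: "q \<longlonglongrightarrow> t"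
          by (rule rationals_decreasing_to[OF tT(2)]) auto
        have rc: "(\<lambda>n. f (q n)) \<longlonglongrightarrow> f t" if "right_continuous_path f" for f
          by (rule right_continuous_path_LIMSEQ[OF that tT(1) qlim]) (use q(2) in \<open>auto intro: less_imp_le\<close>)
        have "(\<lambda>n. H (q n) \<omega>) \<longlonglongrightarrow> H t \<omega>" "(\<lambda>n. M (q n) \<omega>) \<longlonglongrightarrow> M t \<omega>"
          using H_path[OF elim(2)] M_path[OF elim(2)]
          by (auto simp: cadlag_def intro: rc[of "\<lambda>t. H t \<omega>"] rc[of "\<lambda>t. M t \<omega>"])
        moreover have "(\<lambda>n. N (q n) \<omega>) \<longlonglongrightarrow> N t \<omega>"
          using rc[of "\<lambda>t. N (min t T) \<omega>"] N_path[OF elim(2)] tT qT by (simp add: cadlag_def min_absorb1 less_imp_le)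
        ultimately have lims: "(\<lambda>n. H (q n) \<omega>) \<longlonglongrightarrow> H t \<omega>"
          "(\<lambda>n. N (q n) \<omega> - M (q n) \<omega> + EH 0 \<omega>) \<longlonglongrightarrow> N t \<omega> - M t \<omega> + EH 0 \<omega>"
          by (auto intro!: tendsto_intros)
        have "H (q n) \<omega> \<le> N (q n) \<omega> - M (q n) \<omega> + EH 0 \<omega>" for n
          using elim(1) q(1,2)[of n] qT[of n] tT by (auto intro: less_imp_le order_trans)
        then show ?thesis by (intro LIMSEQ_le[OF lims]) auto
      qed (use elim(1) in simp)
    qed
  qed
qed

text \<open>
  Where \<open>E[H\<^sub>T | F\<^sub>0] > u\<close> the term \<open>H\<^sup>L = u\<close> alone dominates.
\<close>

lemma estimate_c: "L_estimate P T u X I (M_L_c P F X H T u N) (H_L_c P F H T u)"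
proof (rule L_estimateI)
  show "AE \<omega> in P. \<forall>t\<in>{0..T}. min (X (tmin t (\<sigma> \<omega>)) \<omega>) u \<le> I t \<omega> + M_L_c P F X H T u N t \<omega> + H_L_c P F H T u t \<omega>"
    using integral_inequality_below H_le_N AE_space
  proof eventually_elim
    case (elim \<omega>)
    show ?case
    proof
      fix t assume "t \<in> {0..T}"
      then have t: "0 \<le> t" "t \<le> T" by auto
      define v where "v = tmin t (\<sigma> \<omega>)"
      have v: "0 \<le> v" "v \<le> t" using tmin_le[OF t(1)] by (simp_all add: v_def)
      show "min (X (tmin t (\<sigma> \<omega>)) \<omega>) u \<le> I t \<omega> + M_L_c P F X H T u N t \<omega> + H_L_c P F H T u t \<omega>"
      proof (cases "EH 0 \<omega> \<le> u")
        case True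
        have "\<forall>s\<in>{0..<v}. X s \<omega> \<le> u" using below_before_tmin_exit[OF t(1)] by (auto simp: v_def)
        then have "X v \<omega> \<le> I v \<omega> + M v \<omega> + H v \<omega>" using elim(1) v(1) by blast
        moreover have "I v \<omega> \<le> I t \<omega>" by (rule I_mono[OF elim(3) v])
        moreover have "H v \<omega> \<le> N v \<omega> - M v \<omega> + EH 0 \<omega>" using elim(2) v t by auto
        ultimately show ?thesis using True by (simp add: M_L_c_def H_L_c_def flip: v_def)
      next
        case False
        then show ?thesis using I_nonneg[of t \<omega>] by (simp add: M_L_c_def H_L_c_def)
      qed
    qed
  qed
qed

end

lemma H_L_c_nondecreasing: "nondecreasing_process F (H_L_c P F H T u)"
  unfolding nondecreasing_process_def adapted_def
proof (intro conjI allI impI ballI)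
  fix t :: real assume "0 \<le> t"
  then have [measurable]: "EH 0 \<in> borel_measurable (F t)" by (rule EH_measurable)
  show "H_L_c P F H T u t \<in> borel_measurable (F t)" unfolding H_L_c_def[abs_def] by measurable
qed (simp add: H_L_c_def mono_on_def)

end

theorem lemma4p5:
  fixes P :: "'a measure" and F :: "real \<Rightarrow> 'a measure"
    and X A H M :: "real \<Rightarrow> 'a \<Rightarrow> real" and \<eta> :: "real \<Rightarrow> real"
    and T p c0 u lam :: real and r :: regime
  assumes "usual_filtered_prob_space P F"
    and "T > 0" and "0 < p" and "p < 1"
    and "gronwall_assumption r P F c0 \<eta> X A H M"
    and "u > 0" and "lam > 0"
  shows "nondecreasing_process F (I_L r c0 \<eta> X A u)
    \<and> (predictable_process F H \<longrightarrow>
        nondecreasing_process F (H_L_ab H lam u) \<and>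
        (\<exists>\<tau>s. announcing_sequence F (hit_H H (lam * u)) \<tau>s) \<and>
        (\<forall>\<tau>s. announcing_sequence F (hit_H H (lam * u)) \<tau>s \<longrightarrow>
          (\<forall>t\<ge>0. \<forall>\<omega>\<in>space P. convergent (\<lambda>n. M_L_a_seq X M u \<tau>s n t \<omega>)) \<and>
          cadlag_local_martingale_from_0 P F (M_L_a X M u \<tau>s) \<and>
          L_estimate P T u X (I_L r c0 \<eta> X A u) (M_L_a X M u \<tau>s) (H_L_ab H lam u)))
    \<and> (no_negative_jumps P M \<longrightarrow>
        nondecreasing_process F (H_L_ab H lam u) \<and>
        cadlag_local_martingale_from_0 P F (M_L_b X H M lam u) \<and>
        L_estimate P T u X (I_L r c0 \<eta> X A u) (M_L_b X H M lam u) (H_L_ab H lam u))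
    \<and> (integrable P (H T) \<longrightarrow>
        nondecreasing_process F (H_L_c P F H T u) \<and>
        (\<exists>N. cadlag_version_M_tilde P F H M T N) \<and>
        (\<forall>N. cadlag_version_M_tilde P F H M T N \<longrightarrow>
          cadlag_local_martingale_from_0 P F (\<lambda>t. M_L_c P F X H T u N (min t T)) \<and>
          L_estimate P T u X (I_L r c0 \<eta> X A u) (M_L_c P F X H T u N) (H_L_c P F H T u)))"
proof -
  interpret gronwall_setting P F r c0 \<eta> X A H M u
    using assms by (simp add: gronwall_setting_def gronwall_setting_axioms_def)
  have hit: "stop_time F (hit_H H (lam * u))" by (rule hit_H_stop[OF H_adapted H_path])
  have a: "(\<forall>t\<ge>0. \<forall>\<omega>\<in>space P. convergent (\<lambda>n. M_L_a_seq X M u \<tau>s n t \<omega>)) \<and>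
          cadlag_local_martingale_from_0 P F (M_L_a X M u \<tau>s) \<and>
          L_estimate P T u X I (M_L_a X M u \<tau>s) (H_L_ab H lam u)"
    if ann: "announcing_sequence F (hit_H H (lam * u)) \<tau>s" for \<tau>s
  proof (intro conjI allI impI ballI)
    fix t \<omega> assume "(0::real) \<le> t" "\<omega> \<in> space P"
    then show "convergent (\<lambda>n. M_L_a_seq X M u \<tau>s n t \<omega>)"
      unfolding M_L_a_seq_def by (intro convergentI[OF announced_stop_limit[OF ann]] M_path)
  next
    show "cadlag_local_martingale_from_0 P F (M_L_a X M u \<tau>s)"
      using announced_stop_local_martingale[OF M_local_martingale ann exit_stop]
      unfolding M_L_a_def[abs_def] M_L_a_seq_def .
    show "L_estimate P T u X I (M_L_a X M u \<tau>s) (H_L_ab H lam u)" by (rule estimate_a[OF assms(7) ann])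
  qed
  have b: "cadlag_local_martingale_from_0 P F (M_L_b X H M lam u)"
    using stopped_local_martingale[OF M_local_martingale stop_min[OF hit exit_stop]]
    unfolding M_L_b_def[abs_def] .
  have c: "nondecreasing_process F (H_L_c P F H T u) \<and>
        (\<exists>N. cadlag_version_M_tilde P F H M T N) \<and>
        (\<forall>N. cadlag_version_M_tilde P F H M T N \<longrightarrow>
          cadlag_local_martingale_from_0 P F (\<lambda>t. M_L_c P F X H T u N (min t T)) \<and>
          L_estimate P T u X I (M_L_c P F X H T u N) (H_L_c P F H T u))"
    if int: "integrable P (H T)"
  proof -
    interpret gronwall_integrable P F r c0 \<eta> X A H M u T by standard (fact assms(2) int)+
    show ?thesis using H_L_c_nondecreasing version_exists M_L_c_local_martingale estimate_c by blast
  qed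
  have e: "\<exists>\<tau>s. announcing_sequence F (hit_H H (lam * u)) \<tau>s" if "predictable_process F H"
    by (rule hit_H_announcing_exists[OF that H_path])
  show ?thesis
    by (intro conjI impI allI I_nondecreasing H_L_ab_nondecreasing e a b estimate_b[OF assms(7)])
      (use a c in blast)+
qed

end
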